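(* Let $p=p(n)$ and $G\in\mathcal G(n,p)$. If $p\le \frac13 n^{-3/4}\log^{1/4} n$ and $p=\omega(n^{-5/4})$, then with high probability $G$ is not reconstructible from its $2$-neighbourhoods.
   Context: $\mathcal G(n,p)$ is the Erdős–Rényi random graph on vertex set $[n]$ in which each pair is an edge independently with probability $p$. "With high probability" means with probability tending to $1$ as $n\to\infty$. For a graph $G$, a vertex $v$ and an integer $r\ge1$, the $r$-neighbourhood $N_r^{(G)}(v)$ is the subgraph of $G$ induced by the vertices at distance at most $r$ from $v$, considered as a graph rooted at $v$. Graphs $G$ and $H$ have isomorphic $r$-neighbourhoods if there is a bijection $\phi:V(G)\to V(H)$ such that for every $v\in V(G)$ there is a graph isomorphism $N_r^{(G)}(v)\to N_r^{(H)}(\phi(v))$ mapping $v$ to $\phi(v)$. $G$ is reconstructible from its $r$-neighbourhoods if every graph $H$ with $r$-neighbourhoods isomorphic to those of $G$ is isomorphic to $G$. *)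

theory Defs
  imports Complex_Main
begin

definition all_edges :: "nat \<Rightarrow> nat set set" where
  "all_edges n = {e. \<exists>x y. x < n \<and> y < n \<and> x \<noteq> y \<and> e = {x, y}}"

definition is_graph :: "nat \<Rightarrow> nat set set \<Rightarrow> bool" where
  "is_graph n E \<longleftrightarrow> E \<subseteq> all_edges n"

definition Gnp_prob :: "nat \<Rightarrow> real \<Rightarrow> (nat set set \<Rightarrow> bool) \<Rightarrow> real" where
  "Gnp_prob n p P =
     (\<Sum>E\<in>Pow (all_edges n).
        if P E then p ^ card E * (1 - p) ^ (card (all_edges n) - card E) else 0)"

definition adj_rel :: "'a set set \<Rightarrow> ('a \<times> 'a) set" where
  "adj_rel E = {(x, y). {x, y} \<in> E \<and> x \<noteq> y}"

definition ball :: "'a set \<Rightarrow> 'a set set \<Rightarrow> 'a \<Rightarrow> nat \<Rightarrow> 'a set" where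
  "ball V E v r = {u \<in> V. \<exists>k\<le>r. (v, u) \<in> adj_rel E ^^ k}"

definition induced :: "'a set set \<Rightarrow> 'a set \<Rightarrow> 'a set set" where
  "induced E B = {e \<in> E. e \<subseteq> B}"

definition nbhd_iso ::
  "nat \<Rightarrow> 'a set \<Rightarrow> 'a set set \<Rightarrow> 'a \<Rightarrow> 'b set \<Rightarrow> 'b set set \<Rightarrow> 'b \<Rightarrow> bool" where
  "nbhd_iso r V E v W F w \<longleftrightarrow>
     (\<exists>f. bij_betw f (ball V E v r) (ball W F w r) \<and> f v = w \<and>
        (\<forall>x\<in>ball V E v r. \<forall>y\<in>ball V E v r.
           {x, y} \<in> induced E (ball V E v r) \<longleftrightarrow>
           {f x, f y} \<in> induced F (ball W F w r)))"

definition graph_iso :: "'a set \<Rightarrow> 'a set set \<Rightarrow> 'b set \<Rightarrow> 'b set set \<Rightarrow> bool" where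
  "graph_iso V E W F \<longleftrightarrow>
     (\<exists>f. bij_betw f V W \<and> (\<forall>x\<in>V. \<forall>y\<in>V. {x, y} \<in> E \<longleftrightarrow> {f x, f y} \<in> F))"

definition same_nbhds :: "nat \<Rightarrow> 'a set \<Rightarrow> 'a set set \<Rightarrow> 'b set \<Rightarrow> 'b set set \<Rightarrow> bool" where
  "same_nbhds r V E W F \<longleftrightarrow>
     (\<exists>\<phi>. bij_betw \<phi> V W \<and> (\<forall>v\<in>V. nbhd_iso r V E v W F (\<phi> v)))"

text \<open>A graph on [n] is reconstructible from its r-neighbourhoods if every graph H
  with isomorphic r-neighbourhoods is isomorphic to it. Such an H has n vertices
  (there is a bijection), so up to relabelling it is a graph on [n].\<close>

definition reconstructible :: "nat \<Rightarrow> nat \<Rightarrow> nat set set \<Rightarrow> bool" where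
  "reconstructible r n E \<longleftrightarrow>
     (\<forall>F. is_graph n F \<longrightarrow> same_nbhds r {..<n} E {..<n} F \<longrightarrow>
          graph_iso {..<n} E {..<n} F)"

end

theory Submission
  imports Defs "HOL-Real_Asymp.Real_Asymp"
begin

section \<open>Random graphs that are not reconstructible from their 2-neighbourhoods\<close>

text \<open>
  If \<open>uv\<close> and \<open>xy\<close> are edges with \<open>deg u = deg x\<close> and \<open>deg v = deg y\<close>, and after deleting them the
  2-balls around \<open>u, v, x, y\<close> are disjoint and the neighbourhoods of these vertices independent, then
  replacing \<open>uv, xy\<close> by \<open>uy, xv\<close> preserves every 2-neighbourhood. With \<open>S\<close> the sum of the
  degrees of the neighbours of a vertex, the number of walks of length 5 changes by
  \<open>2 (S u - S x) (S v - S y)\<close> up to sign, so the new graph is not isomorphic to the old one if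
  \<open>S u \<noteq> S x\<close> and \<open>S v \<noteq> S y\<close>.

  For \<open>p \<le> ln n / (10 n)\<close> two isolated paths on five vertices, which exist by the second moment
  method, admit such a switch. For larger \<open>p\<close> the edges at a set \<open>A\<close> of about \<open>n powr 0.7\<close> vertices are
  revealed first: the second moment method gives about \<open>m = n powr 0.11\<close> quadruples \<open>u, v, x, y\<close> in \<open>A\<close>, with
  \<open>uv\<close> and \<open>xy\<close> isolated edges inside \<open>A\<close>, with all four vertices having the same number \<open>k\<close> of
  neighbours outside \<open>A\<close>, and with no overlaps so far. The remaining edges decide
  independently for each quadruple whether the four 2-balls stay disjoint, which has probability
  at least about \<open>exp (- 6 (np)\<^sup>4 / n) \<ge> n powr (- 6/81)\<close>. As \<open>m\<close> times this tends to infinity, some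
  quadruple succeeds. The condition on \<open>S\<close> is ensured modulo 2, which only costs a constant factor
  by a character computation.
\<close>

subsection \<open>Random subsets with independent elements\<close>

text \<open>The obstacle is dependence. A fixed quadruple may satisfy the switch conditions only
  with probability a negative power of n, so polynomially many must be tried, and in the full graph
  the conditions for different quadruples interact. Exposing A first removes this: once the first
  layers are known and disjoint, the second layers of different quadruples are decided by disjoint
  sets of pairs, and the failures multiply exactly. Pairs inside the union of the first layers are
  the exception; they are required to be absent. The 6 in the exponent counts the pairs among four
  balls. For p at the upper bound, (np)^4/n is ln n/81, where 81 is 3^4, so more than n^(6/81)
  trials are needed. The absence of edges between first layers requires m^2 (np)^3/n to be small,
  which keeps m below n^(1/8). The constant 1/3 makes 6/81 less than 1/8, with room for the losses
  in the estimates. Only parities of the degree sums are controlled because a sign-weighted count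
  still factorises over vertices. The sparse range is separate since a concentrated degree k and
  equidistributed parities require np to be large.\<close>

definition bexp :: "real \<Rightarrow> 'e set \<Rightarrow> ('e set \<Rightarrow> real) \<Rightarrow> real" where
  "bexp p U f = (\<Sum>E\<in>Pow U. p ^ card E * (1 - p) ^ card (U - E) * f E)"

abbreviation (input) prob :: "real \<Rightarrow> 'e set \<Rightarrow> ('e set \<Rightarrow> bool) \<Rightarrow> real" where
  "prob p U Q \<equiv> bexp p U (\<lambda>E. of_bool (Q E))"

lemma bexp_cong:
  assumes "\<And>E. E \<subseteq> U \<Longrightarrow> f E = g E"
  shows "bexp p U f = bexp p U g"
  unfolding bexp_def using assms by (intro sum.cong) auto

lemma bexp_add: "bexp p U (\<lambda>E. f E + g E) = bexp p U f + bexp p U g"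
  unfolding bexp_def by (simp add: algebra_simps sum.distrib)

lemma bexp_diff: "bexp p U (\<lambda>E. f E - g E) = bexp p U f - bexp p U g"
  unfolding bexp_def by (simp add: algebra_simps sum_subtractf)

lemma bexp_cmult: "bexp p U (\<lambda>E. c * f E) = c * bexp p U f"
  unfolding bexp_def by (simp add: sum_distrib_left algebra_simps)

lemma bexp_sum: "bexp p U (\<lambda>E. \<Sum>i\<in>I. f i E) = (\<Sum>i\<in>I. bexp p U (f i))"
  unfolding bexp_def by (subst sum.swap) (simp add: sum_distrib_left)

lemma bexp_mono:
  assumes "0 \<le> p" "p \<le> 1" "\<And>E. E \<subseteq> U \<Longrightarrow> f E \<le> g E"
  shows "bexp p U f \<le> bexp p U g"
  unfolding bexp_def using assms by (intro sum_mono mult_left_mono) auto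

text \<open>Fubini for exposing \<open>U1\<close> and then \<open>U2\<close>. It and the product
  rules derived from it are polynomial identities valid for every real \<open>p\<close>; the range
  of \<open>p\<close> matters only for inequalities.\<close>

lemma bexp_union:
  assumes "finite U1" "finite U2" "U1 \<inter> U2 = {}"
  shows "bexp p (U1 \<union> U2) f = bexp p U1 (\<lambda>E1. bexp p U2 (\<lambda>E2. f (E1 \<union> E2)))"
proof -
  have "bexp p (U1 \<union> U2) f = (\<Sum>(E1,E2)\<in>Pow U1 \<times> Pow U2.
      (p ^ card E1 * (1 - p) ^ card (U1 - E1)) * (p ^ card E2 * (1 - p) ^ card (U2 - E2) * f (E1 \<union> E2)))"
    unfolding bexp_def
  proof (rule sum.reindex_bij_witness[of _ "\<lambda>(a,b). a \<union> b" "\<lambda>E. (E \<inter> U1, E \<inter> U2)"], goal_cases)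
    case (2 E)
    then have E: "E \<subseteq> U1 \<union> U2" by auto
    then show ?case by auto
  next
    case (5 E)
    then have E: "E \<subseteq> U1 \<union> U2" by auto
    have fE: "finite E" using E assms finite_subset by auto
    have EE: "E = (E \<inter> U1) \<union> (E \<inter> U2)" using E by auto
    have 1: "card E = card (E \<inter> U1) + card (E \<inter> U2)"
      using EE card_Un_disjoint[of "E \<inter> U1" "E \<inter> U2"] fE assms by auto
    have "U1 \<union> U2 - E = (U1 - E \<inter> U1) \<union> (U2 - E \<inter> U2)" by auto
    then have 2: "card (U1 \<union> U2 - E) = card (U1 - E \<inter> U1) + card (U2 - E \<inter> U2)"
      using card_Un_disjoint[of "U1 - E \<inter> U1" "U2 - E \<inter> U2"] assms by auto
    show ?case using EE 1 2 by (simp add: power_add algebra_simps)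
  qed (use assms in auto)
  then show ?thesis unfolding bexp_def
    by (simp add: sum.cartesian_product[symmetric] sum_distrib_left)
qed

lemma bexp_empty [simp]: "bexp p {} f = f {}"
  by (simp add: bexp_def)

text \<open>The probability generating function with one variable per element. Values 0 and 1 give
  the probability that \<open>E\<close> avoids a set, signs give expectations of parities.\<close>

lemma bexp_gen:
  assumes "finite U"
  shows "bexp p U (\<lambda>E. \<Prod>e\<in>E. c e) = (\<Prod>e\<in>U. 1 - p + p * c e)"
  using assms
proof (induction U rule: finite_induct)
  case (insert x U)
  have "bexp p ({x} \<union> U) (\<lambda>E. \<Prod>e\<in>E. c e) =
      bexp p {x} (\<lambda>E1. bexp p U (\<lambda>E2. (\<Prod>e\<in>E1. c e) * (\<Prod>e\<in>E2. c e)))"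
    using insert by (subst bexp_union)
      (auto intro!: bexp_cong prod.union_disjoint simp: finite_subset[OF _ insert(1)] subset_singleton_iff)
  also have "\<dots> = bexp p {x} (\<lambda>E1. (\<Prod>e\<in>U. 1 - p + p * c e) * (\<Prod>e\<in>E1. c e))"
    by (simp only: bexp_cmult insert(3) mult.commute)
  also have "\<dots> = (\<Prod>e\<in>U. 1 - p + p * c e) * bexp p {x} (\<lambda>E1. (\<Prod>e\<in>E1. c e))"
    by (rule bexp_cmult)
  also have "bexp p {x} (\<lambda>E1. (\<Prod>e\<in>E1. c e)) = 1 - p + p * c x"
    by (simp add: bexp_def Pow_insert)
  finally show ?case using insert by simp
qed simp

lemma bexp_const [simp]: "finite U \<Longrightarrow> bexp p U (\<lambda>_. c) = c"
  using bexp_gen[of U p "\<lambda>_. 1"] bexp_cmult[of p U c "\<lambda>_. 1"] by simp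

lemma bexp_indep:
  assumes "finite U" "V \<subseteq> U" "W \<subseteq> U" "V \<inter> W = {}"
  shows "bexp p U (\<lambda>E. f (E \<inter> V) * g (E \<inter> W)) = bexp p V f * bexp p W g"
proof -
  \<comment> \<open>The elements in neither \<open>V\<close> nor \<open>W\<close> form a third
    block, over which the integrand is constant.\<close>
  define R where "R = U - V - W"
  have U: "U = V \<union> (W \<union> R)" using assms R_def by auto
  have fin: "finite V" "finite W" "finite R" using assms R_def by (auto intro: finite_subset)
  have *: "(A \<union> (B \<union> C)) \<inter> V = A" "(A \<union> (B \<union> C)) \<inter> W = B"
    if "A \<subseteq> V" "B \<subseteq> W" "C \<subseteq> R" for A B C
    using that assms R_def by auto
  have "bexp p U (\<lambda>E. f (E \<inter> V) * g (E \<inter> W)) =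
      bexp p V (\<lambda>A. bexp p (W \<union> R) (\<lambda>D. f ((A \<union> D) \<inter> V) * g ((A \<union> D) \<inter> W)))"
    unfolding U using fin assms R_def by (intro bexp_union) auto
  also have "\<dots> = bexp p V (\<lambda>A. bexp p W (\<lambda>B. bexp p R (\<lambda>C. f ((A \<union> (B \<union> C)) \<inter> V) * g ((A \<union> (B \<union> C)) \<inter> W))))"
    using fin assms R_def by (intro bexp_cong bexp_union) auto
  also have "\<dots> = bexp p V (\<lambda>A. bexp p W (\<lambda>B. bexp p R (\<lambda>C. f A * g B)))"
    by (intro bexp_cong) (simp only: *)
  also have "\<dots> = bexp p V (\<lambda>A. bexp p W g * f A)"
    using fin by (simp add: bexp_cmult mult.commute)
  also have "\<dots> = bexp p V f * bexp p W g"
    by (subst bexp_cmult) (rule mult.commute)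
  finally show ?thesis .
qed

lemma bexp_local:
  assumes "finite U" "V \<subseteq> U"
  shows "bexp p U (\<lambda>E. f (E \<inter> V)) = bexp p V f"
  using bexp_indep[of U V "{}" p f "\<lambda>_. 1"] assms by simp

lemma bexp_prod:
  assumes "finite U" "finite I" "\<And>i. i \<in> I \<Longrightarrow> V i \<subseteq> U"
    "\<And>i j. i \<in> I \<Longrightarrow> j \<in> I \<Longrightarrow> i \<noteq> j \<Longrightarrow> V i \<inter> V j = {}"
  shows "bexp p U (\<lambda>E. \<Prod>i\<in>I. f i (E \<inter> V i)) = (\<Prod>i\<in>I. bexp p (V i) (f i))"
  using assms(2,3,4)
proof (induction I rule: finite_induct)
  case empty
  then show ?case using assms(1) by simp
next
  case (insert x I)
  let ?W = "\<Union>i\<in>I. V i"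
  have "bexp p U (\<lambda>E. \<Prod>i\<in>insert x I. f i (E \<inter> V i)) =
     bexp p U (\<lambda>E. f x (E \<inter> V x) * (\<Prod>i\<in>I. f i ((E \<inter> ?W) \<inter> V i)))"
    using insert(1,2) by (intro bexp_cong) (auto intro!: prod.cong arg_cong[where f = "f _"])
  also have "\<dots> = bexp p (V x) (f x) * bexp p ?W (\<lambda>E. \<Prod>i\<in>I. f i (E \<inter> V i))"
    using insert(2,4,5) assms(1)
    by (intro bexp_indep[of U "V x" ?W p "f x" "\<lambda>E. \<Prod>i\<in>I. f i (E \<inter> V i)"]) fastforce+
  also have "bexp p ?W (\<lambda>E. \<Prod>i\<in>I. f i (E \<inter> V i)) = bexp p U (\<lambda>E. \<Prod>i\<in>I. f i ((E \<inter> ?W) \<inter> V i))"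
    using insert(4) assms(1)
    by (intro bexp_local[symmetric, of U ?W p "\<lambda>E. \<Prod>i\<in>I. f i (E \<inter> V i)"]) auto
  also have "\<dots> = bexp p U (\<lambda>E. \<Prod>i\<in>I. f i (E \<inter> V i))"
    by (intro bexp_cong) (auto intro!: prod.cong arg_cong[where f = "f _"])
  finally show ?case using insert by simp
qed

lemma bexp_eq_set:
  assumes "finite U" "V \<subseteq> U" "S \<subseteq> V"
  shows "prob p U (\<lambda>E. E \<inter> V = S) = p ^ card S * (1 - p) ^ card (V - S)"
proof -
  have "prob p U (\<lambda>E. E \<inter> V = S) = prob p V (\<lambda>E. E = S)"
    using bexp_local[of U V p "\<lambda>E. of_bool (E = S)"] assms by simp
  also have "\<dots> = (\<Sum>E\<in>{S}. p ^ card E * (1 - p) ^ card (V - E))"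
    unfolding bexp_def using assms
    by (intro sum.mono_neutral_cong_right) (auto intro: finite_subset)
  finally show ?thesis by simp
qed

lemma bexp_le_1:
  assumes "finite U" "0 \<le> p" "p \<le> 1" "\<And>E. E \<subseteq> U \<Longrightarrow> f E \<le> 1"
  shows "bexp p U f \<le> 1"
  using bexp_mono[OF assms(2,3), of U f "\<lambda>_. 1"] assms(1,4) by auto

lemma bexp_nonneg:
  assumes "0 \<le> p" "p \<le> 1" "\<And>E. E \<subseteq> U \<Longrightarrow> 0 \<le> f E"
  shows "0 \<le> bexp p U f"
  unfolding bexp_def using assms by (intro sum_nonneg) auto

lemma bexp_not:
  assumes "finite U"
  shows "prob p U (\<lambda>E. \<not> P E) = 1 - prob p U (\<lambda>E. P E)"
proof -
  have "prob p U (\<lambda>E. \<not> P E) = bexp p U (\<lambda>E. 1 - of_bool (P E))"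
    by (intro bexp_cong) auto
  then show ?thesis using assms by (simp add: bexp_diff)
qed

lemma bexp_chebyshev:
  assumes p: "0 \<le> p" "p \<le> 1" and c: "c > 0"
  shows "prob p U (\<lambda>E. c \<le> \<bar>X E - \<mu>\<bar>) \<le> bexp p U (\<lambda>E. (X E - \<mu>)\<^sup>2) / c\<^sup>2"
proof -
  have "prob p U (\<lambda>E. c \<le> \<bar>X E - \<mu>\<bar>) \<le> bexp p U (\<lambda>E. (1 / c\<^sup>2) * (X E - \<mu>)\<^sup>2)"
  proof (intro bexp_mono p)
    fix E
    have "1 \<le> 1 / c\<^sup>2 * (X E - \<mu>)\<^sup>2" if "c \<le> \<bar>X E - \<mu>\<bar>"
      using that c power_mono[of c "\<bar>X E - \<mu>\<bar>" 2] by (auto simp: field_simps)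
    then show "of_bool (c \<le> \<bar>X E - \<mu>\<bar>) \<le> 1 / c\<^sup>2 * (X E - \<mu>)\<^sup>2" by auto
  qed
  also have "\<dots> = bexp p U (\<lambda>E. (X E - \<mu>)\<^sup>2) / c\<^sup>2"
    by (subst bexp_cmult) simp
  finally show ?thesis .
qed

text \<open>The diagonal adds at most \<open>\<mu>\<close> and all pairs together at most
  \<open>(1 + \<delta>) * \<mu>\<^sup>2\<close> to the second moment, so the variance is at most
  \<open>\<mu> + \<delta> * \<mu>\<^sup>2\<close>; Chebyshev at distance \<open>\<mu> / 2\<close>
  gives the factor 4. The multiplicative hypothesis suits the applications, where overlapping
  objects exclude each other and disjoint ones are nearly independent.\<close>

lemma bexp_second_moment:
  assumes p: "0 \<le> p" "p \<le> 1" and fin: "finite U" "finite T"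
    and \<mu>: "\<mu> = (\<Sum>t\<in>T. prob p U (\<lambda>E. I t E))" "\<mu> > 0"
    and pairs: "\<And>s t. s \<in> T \<Longrightarrow> t \<in> T \<Longrightarrow> s \<noteq> t \<Longrightarrow>
      prob p U (\<lambda>E. I s E \<and> I t E) \<le>
        (1 + \<delta>) * (prob p U (\<lambda>E. I s E) * prob p U (\<lambda>E. I t E))"
    and \<delta>: "\<delta> \<ge> 0"
  shows "prob p U (\<lambda>E. real (card {t\<in>T. I t E}) \<le> \<mu> / 2) \<le> 4 * (1 / \<mu> + \<delta>)"
proof -
  define P where "P t = prob p U (\<lambda>E. I t E)" for t
  have P0: "P t \<ge> 0" for t unfolding P_def by (intro bexp_nonneg p) auto
  define X where "X E = (\<Sum>t\<in>T. of_bool (I t E) :: real)" for E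
  have X: "real (card {t\<in>T. I t E}) = X E" for E
    unfolding X_def using fin by (simp add: Collect_conj_eq)
  have EX: "bexp p U X = \<mu>"
    using \<mu>(1) unfolding X_def by (subst bexp_sum) simp
  have XX: "bexp p U (\<lambda>E. X E * X E) = (\<Sum>s\<in>T. \<Sum>t\<in>T. prob p U (\<lambda>E. I s E \<and> I t E))"
    unfolding X_def sum_product by (subst bexp_sum, subst bexp_sum) (simp add: of_bool_conj)
  also have "\<dots> \<le> (\<Sum>s\<in>T. \<Sum>t\<in>T. (if s = t then P s else 0) + (1 + \<delta>) * (P s * P t))"
  proof (intro sum_mono)
    fix s t assume "s \<in> T" "t \<in> T"
    then show "prob p U (\<lambda>E. I s E \<and> I t E) \<le> (if s = t then P s else 0) + (1 + \<delta>) * (P s * P t)"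
      using pairs[of s t] \<delta> P0[of s] P0[of t] by (cases "s = t") (auto simp: P_def)
  qed
  also have "\<dots> = \<mu> + (1 + \<delta>) * \<mu>\<^sup>2"
    using fin \<mu>(1) unfolding P_def[symmetric]
    by (simp add: sum.distrib power2_eq_square sum_product) (simp flip: sum_distrib_left sum_distrib_right)
  finally have V: "bexp p U (\<lambda>E. X E * X E) \<le> \<mu> + (1 + \<delta>) * \<mu>\<^sup>2" .
  have "bexp p U (\<lambda>E. (X E - \<mu>)\<^sup>2) = bexp p U (\<lambda>E. X E * X E - (2 * \<mu>) * X E + \<mu>\<^sup>2)"
    by (intro bexp_cong) (simp add: power2_eq_square algebra_simps)
  also have "\<dots> = bexp p U (\<lambda>E. X E * X E) - \<mu>\<^sup>2"
    using fin EX by (simp only: bexp_add bexp_diff bexp_cmult bexp_const) (simp add: power2_eq_square)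
  finally have V': "bexp p U (\<lambda>E. (X E - \<mu>)\<^sup>2) \<le> \<mu> + \<delta> * \<mu>\<^sup>2" using V by (simp add: algebra_simps)
  have "prob p U (\<lambda>E. real (card {t\<in>T. I t E}) \<le> \<mu> / 2) \<le> prob p U (\<lambda>E. \<mu>/2 \<le> \<bar>X E - \<mu>\<bar>)"
    by (intro bexp_mono p) (use \<mu>(2) in \<open>auto simp: X\<close>)
  also have "\<dots> \<le> (\<mu> + \<delta> * \<mu>\<^sup>2) / (\<mu>/2)\<^sup>2"
    using bexp_chebyshev[OF p, of "\<mu>/2" U X \<mu>] V' \<mu>(2) by (smt (verit) divide_right_mono half_gt_zero zero_le_power2)
  also have "\<dots> = 4 * (1 / \<mu> + \<delta>)" using \<mu>(2) by (simp add: field_simps power2_eq_square)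
  finally show ?thesis .
qed

lemma bexp_binomial_moments:
  assumes "finite U"
  shows "bexp p U (\<lambda>E. real (card E)) = real (card U) * p"
    and "bexp p U (\<lambda>E. (real (card E) - real (card U) * p)\<^sup>2) = real (card U) * p * (1 - p)"
proof -
  have *: "real (card E) = (\<Sum>e\<in>U. of_bool (e \<in> E))" if "E \<subseteq> U" for E
    using that assms by (simp add: Int_absorb1 Collect_conj_eq)
  have 1: "prob p U (\<lambda>E. e \<in> E) = p" if "e \<in> U" for e
  proof -
    have "prob p U (\<lambda>E. e \<in> E) = prob p U (\<lambda>E. E \<inter> {e} = {e})"
      by (intro bexp_cong) auto
    then show ?thesis using bexp_eq_set[of U "{e}" "{e}" p] that assms by simp
  qed
  show m1: "bexp p U (\<lambda>E. real (card E)) = real (card U) * p"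
  proof -
    have "bexp p U (\<lambda>E. real (card E)) = bexp p U (\<lambda>E. \<Sum>e\<in>U. of_bool (e \<in> E))"
      by (intro bexp_cong *)
    also have "\<dots> = (\<Sum>e\<in>U. p)" by (subst bexp_sum) (intro sum.cong refl 1)
    finally show ?thesis by simp
  qed
  have 2: "bexp p U (\<lambda>E. of_bool (e \<in> E) * of_bool (f \<in> E)) = (if e = f then p - p\<^sup>2 else 0) + p\<^sup>2"
    if "e \<in> U" "f \<in> U" for e f
  proof (cases "e = f")
    case True
    have "bexp p U (\<lambda>E. of_bool (e \<in> E) * of_bool (f \<in> E)) = prob p U (\<lambda>E. e \<in> E)"
      by (intro bexp_cong) (auto simp: True)
    then show ?thesis using 1 that True by simp
  next
    case False
    have "bexp p U (\<lambda>E. of_bool (e \<in> E) * of_bool (f \<in> E)) = prob p U (\<lambda>E. E \<inter> {e,f} = {e,f})"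
      by (intro bexp_cong) auto
    then show ?thesis using bexp_eq_set[of U "{e,f}" "{e,f}" p] that assms False by (simp add: power2_eq_square)
  qed
  have m2: "bexp p U (\<lambda>E. real (card E) * real (card E)) = real (card U) * (p - p\<^sup>2) + (real (card U))\<^sup>2 * p\<^sup>2"
  proof -
    have "bexp p U (\<lambda>E. real (card E) * real (card E)) =
      bexp p U (\<lambda>E. \<Sum>e\<in>U. \<Sum>f\<in>U. of_bool (e \<in> E) * of_bool (f \<in> E))"
      by (intro bexp_cong) (simp add: * sum_product)
    also have "\<dots> = (\<Sum>e\<in>U. \<Sum>f\<in>U. (if e = f then p - p\<^sup>2 else 0) + p\<^sup>2)"
      by (subst bexp_sum, subst bexp_sum) (intro sum.cong refl 2)
    also have "\<dots> = real (card U) * (p - p\<^sup>2) + (real (card U))\<^sup>2 * p\<^sup>2"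
      using assms by (simp add: sum.distrib power2_eq_square algebra_simps)
    finally show ?thesis .
  qed
  have "bexp p U (\<lambda>E. (real (card E) - real (card U) * p)\<^sup>2) =
    bexp p U (\<lambda>E. real (card E) * real (card E) - (2 * real (card U) * p) * real (card E) + (real (card U) * p)\<^sup>2)"
    by (intro bexp_cong) (simp add: power2_eq_square algebra_simps)
  also have "\<dots> = real (card U) * p * (1 - p)"
    using assms by (simp only: bexp_add bexp_diff bexp_cmult bexp_const m1 m2) (simp add: power2_eq_square algebra_simps)
  finally show "bexp p U (\<lambda>E. (real (card E) - real (card U) * p)\<^sup>2) = real (card U) * p * (1 - p)" .
qed

lemma finite_all_edges [simp]: "finite (all_edges n)"
  by (rule finite_subset[of _ "Pow {..<n}"]) (auto simp: all_edges_def)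

lemma Gnp_prob_eq_bexp: "Gnp_prob n p P = prob p (all_edges n) (\<lambda>E. P E)"
  unfolding Gnp_prob_def bexp_def
  by (intro sum.cong refl) (auto simp: card_Diff_subset finite_subset[OF _ finite_all_edges])

subsection \<open>Switching two edges\<close>

definition nb :: "'a set set \<Rightarrow> 'a \<Rightarrow> 'a set" where
  "nb E v = {w. {v, w} \<in> E \<and> v \<noteq> w}"

definition ball2 :: "'a set set \<Rightarrow> 'a \<Rightarrow> 'a set" where
  "ball2 E v = insert v (nb E v \<union> (\<Union>w\<in>nb E v. nb E w))"

text \<open>The number of walks of length 2 from \<open>v\<close>. Hence the sum of
  \<open>nbdegsum E b * nbdegsum E c\<close> over ordered adjacent pairs \<open>b\<close>,
  \<open>c\<close> counts walks with five edges by their middle edge.\<close>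

definition nbdegsum :: "'a set set \<Rightarrow> 'a \<Rightarrow> nat" where
  "nbdegsum E v = (\<Sum>w\<in>nb E v. card (nb E w))"

lemma nb_sym: "w \<in> nb E v \<longleftrightarrow> v \<in> nb E w"
  by (auto simp: nb_def insert_commute)

lemma nb_irrefl [simp]: "v \<notin> nb E v"
  by (simp add: nb_def)

lemma graph_edge:
  assumes "is_graph n E" "{x, y} \<in> E"
  shows "x < n" "y < n" "x \<noteq> y"
proof -
  have "{x, y} \<in> all_edges n" using assms unfolding is_graph_def by blast
  then obtain a b where "a < n" "b < n" "a \<noteq> b" "{x, y} = {a, b}"
    unfolding all_edges_def by blast
  then show "x < n" "y < n" "x \<noteq> y" by (metis doubleton_eq_iff)+
qed

lemma nb_subset:
  assumes "is_graph n E"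
  shows "nb E v \<subseteq> {..<n}"
  using graph_edge(2)[OF assms, of v] by (auto simp: nb_def)

lemma finite_nb: "is_graph n E \<Longrightarrow> finite (nb E v)"
  by (rule finite_subset[OF nb_subset]) auto

lemma edge_iff_nb:
  assumes "is_graph n E"
  shows "{x, y} \<in> E \<longleftrightarrow> y \<in> nb E x"
  using graph_edge(3)[OF assms, of x y] by (auto simp: nb_def)

lemma ball_2_eq:
  assumes "is_graph n E" "v < n"
  shows "ball {..<n} E v 2 = ball2 E v"
proof -
  have "(\<exists>k\<le>2. (v, u) \<in> adj_rel E ^^ k) \<longleftrightarrow> u \<in> ball2 E v" for u
  proof -
    have "k \<le> 2 \<longleftrightarrow> k = 0 \<or> k = 1 \<or> k = 2" for k :: nat by arith
    moreover have "(v, u) \<in> adj_rel E ^^ 2 \<longleftrightarrow> (\<exists>w\<in>nb E v. u \<in> nb E w)"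
      by (simp only: relpow.simps numeral_2_eq_2 One_nat_def) (auto simp: nb_def adj_rel_def)
    moreover have "(v, u) \<in> adj_rel E ^^ 1 \<longleftrightarrow> u \<in> nb E v"
      by (simp add: nb_def adj_rel_def)
    ultimately show ?thesis by (auto simp: ball2_def)
  qed
  moreover have "ball2 E v \<subseteq> {..<n}"
    using nb_subset[OF assms(1)] assms(2) by (auto simp: ball2_def)
  ultimately show ?thesis by (auto simp: ball_def)
qed

lemma nbhd_iso_2I:
  assumes "is_graph n E" "is_graph n F" "v < n" "w < n"
    and "bij_betw f (ball2 E v) (ball2 F w)" "f v = w"
    and "\<And>x y. x \<in> ball2 E v \<Longrightarrow> y \<in> ball2 E v \<Longrightarrow> y \<in> nb E x \<longleftrightarrow> f y \<in> nb F (f x)"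
  shows "nbhd_iso 2 {..<n} E v {..<n} F w"
proof -
  have "f x \<in> ball2 F w" if "x \<in> ball2 E v" for x
    using assms(5) that by (auto simp: bij_betw_def)
  then show ?thesis
    unfolding nbhd_iso_def using assms
    by (intro exI[of _ f]) (auto simp: ball_2_eq induced_def edge_iff_nb)
qed

text \<open>The weighted edge sum below is the number of walks of length 5.\<close>

lemma graph_iso_nbdegsum:
  assumes "is_graph n E" "is_graph n F" "graph_iso {..<n} E {..<n} F"
  shows "(\<Sum>b<n. \<Sum>c\<in>nb E b. nbdegsum E b * nbdegsum E c) =
         (\<Sum>b<n. \<Sum>c\<in>nb F b. nbdegsum F b * nbdegsum F c)"
proof -
  from assms(3) obtain f where f: "bij_betw f {..<n} {..<n}"
    and e: "\<And>x y. x < n \<Longrightarrow> y < n \<Longrightarrow> {x, y} \<in> E \<longleftrightarrow> {f x, f y} \<in> F"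
    unfolding graph_iso_def by auto
  have fn: "f x < n" if "x < n" for x using f that by (auto simp: bij_betw_def)
  have nbF: "bij_betw f (nb E x) (nb F (f x))" if x: "x < n" for x
  proof (rule bij_betw_subset[OF f nb_subset[OF assms(1)]])
    show "f ` nb E x = nb F (f x)"
    proof (intro equalityI subsetI)
      fix y assume "y \<in> f ` nb E x"
      then obtain z where z: "z \<in> nb E x" "y = f z" by auto
      then have "z < n" using nb_subset[OF assms(1)] by auto
      then show "y \<in> nb F (f x)"
        using z e[OF x] edge_iff_nb[OF assms(1)] edge_iff_nb[OF assms(2)] by auto
    next
      fix y assume y: "y \<in> nb F (f x)"
      then have "y < n" using nb_subset[OF assms(2)] by auto
      then obtain z where z: "z < n" "y = f z" using f by (auto simp: bij_betw_def)
      then show "y \<in> f ` nb E x"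
        using y e[OF x z(1)] edge_iff_nb[OF assms(1)] edge_iff_nb[OF assms(2)] by auto
    qed
  qed
  have lt: "z < n" if "z \<in> nb E x" for x z using that nb_subset[OF assms(1)] by auto
  have deg: "card (nb F (f x)) = card (nb E x)" if "x < n" for x
    using bij_betw_same_card[OF nbF[OF that]] by simp
  have S: "nbdegsum F (f x) = nbdegsum E x" if x: "x < n" for x
    unfolding nbdegsum_def
    by (subst sum.reindex_bij_betw[OF nbF[OF x], symmetric]) (auto intro!: sum.cong deg lt)
  have "(\<Sum>b<n. \<Sum>c\<in>nb F b. nbdegsum F b * nbdegsum F c) =
        (\<Sum>b<n. \<Sum>c\<in>nb F (f b). nbdegsum F (f b) * nbdegsum F c)"
    by (subst sum.reindex_bij_betw[OF f, symmetric]) simp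
  also have "\<dots> = (\<Sum>b<n. \<Sum>c\<in>nb E b. nbdegsum E b * nbdegsum E c)"
  proof (rule sum.cong[OF refl])
    fix b assume "b \<in> {..<n}"
    then have b: "b < n" by simp
    show "(\<Sum>c\<in>nb F (f b). nbdegsum F (f b) * nbdegsum F c) = (\<Sum>c\<in>nb E b. nbdegsum E b * nbdegsum E c)"
      by (subst sum.reindex_bij_betw[OF nbF[OF b], symmetric]) (auto intro!: sum.cong simp: S b lt)
  qed
  finally show ?thesis by simp
qed

lemma ball2I:
  "v \<in> ball2 E v" "w \<in> nb E v \<Longrightarrow> w \<in> ball2 E v" "w \<in> nb E v \<Longrightarrow> z \<in> nb E w \<Longrightarrow> z \<in> ball2 E v"
  by (auto simp: ball2_def)

declare ball2I(1) [simp]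

lemma ball2_sym: "w \<in> ball2 E v \<longleftrightarrow> v \<in> ball2 E w"
proof -
  have "v \<in> ball2 E w" if wv: "w \<in> ball2 E v" for v w
  proof -
    consider "w = v" | "w \<in> nb E v" | c where "c \<in> nb E v" "w \<in> nb E c"
      using wv by (auto simp: ball2_def)
    then show ?thesis by cases (auto dest: nb_sym[THEN iffD1] intro: ball2I)
  qed
  then show ?thesis by blast
qed

text \<open>\<open>E0\<close> is what the two graphs have in common, so the hypotheses treat the
  graph before and after the switch alike. Disjoint 2-balls say that the four vertices are pairwise
  at distance at least 5 in \<open>E0\<close>; \<open>indep\<close> excludes triangles at
  them.\<close>

locale edge_switch =
  fixes n :: nat and E0 :: "nat set set" and u v x y :: nat
  assumes graph: "is_graph n E0"
    and lt: "u < n" "v < n" "x < n" "y < n"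
    and disj: "ball2 E0 u \<inter> ball2 E0 v = {}" "ball2 E0 u \<inter> ball2 E0 x = {}"
      "ball2 E0 u \<inter> ball2 E0 y = {}" "ball2 E0 v \<inter> ball2 E0 x = {}"
      "ball2 E0 v \<inter> ball2 E0 y = {}" "ball2 E0 x \<inter> ball2 E0 y = {}"
    and indep: "\<And>s a b. s \<in> {u,v,x,y} \<Longrightarrow> a \<in> nb E0 s \<Longrightarrow> b \<in> nb E0 s \<Longrightarrow> b \<notin> nb E0 a"
    and deg: "card (nb E0 u) = card (nb E0 x)" "card (nb E0 v) = card (nb E0 y)"
begin

definition "E = E0 \<union> {{u, v}, {x, y}}"
definition "F = E0 \<union> {{u, y}, {x, v}}"

lemma distinct: "u \<noteq> v" "u \<noteq> x" "u \<noteq> y" "v \<noteq> x" "v \<noteq> y" "x \<noteq> y"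
  "v \<noteq> u" "x \<noteq> u" "y \<noteq> u" "x \<noteq> v" "y \<noteq> v" "y \<noteq> x"
  using disj by (auto simp: ball2_def)

lemma nbE: "nb E w = nb E0 w \<union> (if w = u then {v} else if w = v then {u} else if w = x then {y}
    else if w = y then {x} else {})"
  using distinct by (auto simp: nb_def E_def doubleton_eq_iff)

lemma nbF: "nb F w = nb E0 w \<union> (if w = u then {y} else if w = y then {u} else if w = x then {v}
    else if w = v then {x} else {})"
  using distinct by (auto simp: nb_def F_def doubleton_eq_iff)

lemma graphs: "is_graph n E" "is_graph n F"
  using graph lt distinct by (auto simp: is_graph_def E_def F_def all_edges_def)

text \<open>Together with the identity these relabellings form a Klein four-group that is transitive
  on the four vertices and preserves both edge sets, so local isomorphisms need only be constructed
  around \<open>u\<close>.\<close>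

lemma switched: "edge_switch n E0 v u y x" "edge_switch n E0 x y u v" "edge_switch n E0 y x v u"
proof -
  have i: "b \<notin> nb E0 a" if "s = u \<or> s = v \<or> s = x \<or> s = y" "a \<in> nb E0 s" "b \<in> nb E0 s" for s a b
    using that indep by auto
  note facts = graph lt disj disj[THEN trans[OF Int_commute]] deg deg[symmetric]
  show "edge_switch n E0 v u y x" "edge_switch n E0 x y u v" "edge_switch n E0 y x v u"
    by (unfold_locales; (rule facts | (use i in blast)))+
qed

lemma sep:
  "z \<in> ball2 E0 u \<Longrightarrow> z \<notin> ball2 E0 v" "z \<in> ball2 E0 u \<Longrightarrow> z \<notin> ball2 E0 x"
  "z \<in> ball2 E0 u \<Longrightarrow> z \<notin> ball2 E0 y" "z \<in> ball2 E0 v \<Longrightarrow> z \<notin> ball2 E0 u"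
  "z \<in> ball2 E0 v \<Longrightarrow> z \<notin> ball2 E0 x" "z \<in> ball2 E0 v \<Longrightarrow> z \<notin> ball2 E0 y"
  "z \<in> ball2 E0 x \<Longrightarrow> z \<notin> ball2 E0 y" "z \<in> ball2 E0 y \<Longrightarrow> z \<notin> ball2 E0 x"
  using disj by auto

lemma nbE_other: "w \<noteq> u \<Longrightarrow> w \<noteq> v \<Longrightarrow> w \<noteq> x \<Longrightarrow> w \<noteq> y \<Longrightarrow> nb E w = nb E0 w"
  and nbF_other: "w \<noteq> u \<Longrightarrow> w \<noteq> v \<Longrightarrow> w \<noteq> x \<Longrightarrow> w \<noteq> y \<Longrightarrow> nb F w = nb E0 w"
  by (simp_all add: nbE nbF)

lemma nbE_u: "nb E u = insert v (nb E0 u)" and nbE_v: "nb E v = insert u (nb E0 v)"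
  and nbF_u: "nb F u = insert y (nb E0 u)" and nbF_y: "nb F y = insert u (nb E0 y)"
  using distinct by (auto simp: nbE nbF)

lemma apart:
  assumes "s \<in> {u, v, x, y}" "t \<in> {u, v, x, y}"
  shows "t \<notin> nb E0 s"
proof
  assume t: "t \<in> nb E0 s"
  then have "t \<in> ball2 E0 s" "t \<in> ball2 E0 t" "t \<noteq> s" by (auto intro: ball2I)
  with disj assms show False by (elim insertE emptyE) blast+
qed

lemma near_u:
  assumes "w \<in> ball2 E0 u"
  shows "w \<noteq> v" "w \<noteq> x" "w \<noteq> y" "w \<notin> nb E0 v" "w \<notin> nb E0 y" "v \<notin> nb E0 w" "y \<notin> nb E0 w"
    "c \<in> nb E0 v \<Longrightarrow> c \<notin> nb E0 w" "c \<in> nb E0 y \<Longrightarrow> c \<notin> nb E0 w"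
proof -
  note sep = sep(1-3)[OF assms]
  show "w \<noteq> v" "w \<noteq> x" "w \<noteq> y" using sep ball2I(1)[of _ E0] by auto
  show 1: "w \<notin> nb E0 v" "w \<notin> nb E0 y" using sep ball2I(2)[of w E0] by auto
  show "v \<notin> nb E0 w" "y \<notin> nb E0 w"
    using 1 nb_sym[of v E0 w] nb_sym[of y E0 w] by auto
  show "c \<in> nb E0 v \<Longrightarrow> c \<notin> nb E0 w" "c \<in> nb E0 y \<Longrightarrow> c \<notin> nb E0 w"
    using sep ball2I(3)[of c E0 _ w] nb_sym[of c E0 w] by auto
qed

lemma near_v:
  assumes "w \<in> ball2 E0 v" shows "w \<noteq> u" "w \<noteq> x" "w \<noteq> y"
  using sep(4-6)[OF assms] ball2I(1)[of _ E0] by auto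

lemma near_y:
  assumes "w \<in> ball2 E0 y" shows "w \<noteq> u" "w \<noteq> x" "w \<noteq> v"
  using sep(3,6,7) assms by auto

text \<open>Around \<open>u\<close> the two graphs differ in one branch: \<open>v\<close> with its
  \<open>E0\<close>-neighbours against \<open>y\<close> with its own. Fix \<open>ball2 E0 u\<close>,
  send \<open>v\<close> to \<open>y\<close> and map the leaves by any bijection. Equal degrees
  provide one, and by \<open>indep\<close> there are no edges between leaves that it would have to
  respect.\<close>

lemma ball2_iso_at_u: "nbhd_iso 2 {..<n} E u {..<n} F u"
proof -
  have "finite (nb E0 v)" "finite (nb E0 y)" using finite_nb[OF graph] by auto
  then obtain h where h: "bij_betw h (nb E0 v) (nb E0 y)"
    using deg(2) finite_same_card_bij by blast
  define f where "f w = (if w = v then y else if w \<in> nb E0 v then h w else w)" for w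
  have 1: "nb E w = nb E0 w" "nb F w = nb E0 w" if "w \<in> nb E0 u" for w
    using near_u(1,2,3)[OF ball2I(2)[OF that]] that by (cases "w = u"; simp add: nbE_other nbF_other)+
  have 2: "nb E w = nb E0 w" if "w \<in> nb E0 v" for w
    using near_v[OF ball2I(2)[OF that]] that by (cases "w = v"; simp add: nbE_other)
  have 3: "nb F w = nb E0 w" if "w \<in> nb E0 y" for w
    using near_y[OF ball2I(2)[OF that]] that by (cases "w = y"; simp add: nbF_other)
  have 4: "nb E w = (if w = u then insert v (nb E0 u) else nb E0 w)"
    "nb F w = (if w = u then insert y (nb E0 u) else nb E0 w)" if "w \<in> ball2 E0 u" for w
    using near_u(1,2,3)[OF that] nbE_other nbF_other nbE_u nbF_u by auto
  have BE: "ball2 E u = ball2 E0 u \<union> insert v (nb E0 v)"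
    by (simp add: ball2_def nbE_u nbE_v 1 insert_commute Un_ac insert_absorb)
  have BF: "ball2 F u = ball2 E0 u \<union> insert y (nb E0 y)"
    by (simp add: ball2_def nbF_u nbF_y 1 insert_commute Un_ac insert_absorb)
  have f0: "f w = w" if "w \<in> ball2 E0 u" for w
    using near_u(1,4)[OF that] by (simp add: f_def)
  have fv: "f v = y" by (simp add: f_def)
  have fh: "f w = h w" "f w \<in> nb E0 y" if "w \<in> nb E0 v" for w
    using that h by (auto simp: f_def bij_betw_def)
  have bij: "bij_betw f (ball2 E u) (ball2 F u)"
    unfolding BE BF
  proof (intro bij_betw_combine)
    show "bij_betw f (ball2 E0 u) (ball2 E0 u)"
      using f0 by (simp add: bij_betw_def inj_on_def image_def)
    have "bij_betw f (nb E0 v) (nb E0 y)"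
      using h fh(1) by (subst bij_betw_cong[of _ f h]) auto
    then show "bij_betw f (insert v (nb E0 v)) (insert y (nb E0 y))"
      using fv by (auto simp: bij_betw_def)
    show "ball2 E0 u \<inter> insert y (nb E0 y) = {}" using near_u(3,5) by auto
  qed
  \<comment> \<open>The edge at \<open>u\<close> is the only one between \<open>ball2 E0 u\<close>
    and the branch.\<close>
  have key: "b \<in> nb E a \<longleftrightarrow> f b \<in> nb F (f a)"
    if a: "a \<in> ball2 E0 u" and b: "b \<in> ball2 E u" for a b
  proof -
    consider "b \<in> ball2 E0 u" | "b = v" | "b \<in> nb E0 v" using b BE by auto
    then show ?thesis
    proof cases
      case 1
      then show ?thesis using a near_u(1,3)[OF 1] by (simp add: f0 4)
    next
      case 2
      then show ?thesis using a near_u(6,7)[OF a] by (simp add: f0 4 fv)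
    next
      case 3
      then have "b \<noteq> v" "f b \<noteq> y" using fh(2)[OF 3] by auto
      then show ?thesis
        using a near_u(8)[OF a 3] near_u(9)[OF a fh(2)[OF 3]] by (auto simp: f0 4)
    qed
  qed
  have key': "b \<in> nb E a \<longleftrightarrow> f b \<in> nb F (f a)"
    if ab: "a \<in> insert v (nb E0 v)" "b \<in> insert v (nb E0 v)" for a b
  proof -
    have adj: "y \<in> nb E0 (f w)" "v \<in> nb E0 w" "w \<noteq> u" "f w \<noteq> u" if w: "w \<in> nb E0 v" for w
      using w fh(2)[OF w] nb_sym[of y] nb_sym[of v] near_u(4,5)[OF ball2I(1)] by auto
    consider "a = v" "b = v" | "a = v" "b \<in> nb E0 v" | "a \<in> nb E0 v" "b = v"
      | "a \<in> nb E0 v" "b \<in> nb E0 v" using ab by auto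
    then show ?thesis
    proof cases
      case 4
      then have "b \<notin> nb E0 a" "f b \<notin> nb E0 (f a)"
        using indep[of v a b] indep[of y "f a" "f b"] fh(2) by auto
      then show ?thesis using 2[OF 4(1)] 3[OF fh(2)[OF 4(1)]] by simp
    qed (use 2 3 fh(2) adj distinct in \<open>simp_all add: fv nbE_v nbF_y\<close>)
  qed
  show ?thesis
  proof (rule nbhd_iso_2I[OF graphs lt(1) lt(1) bij f0[OF ball2I(1)]])
    fix a b assume ab: "a \<in> ball2 E u" "b \<in> ball2 E u"
    then consider "a \<in> ball2 E0 u" | "b \<in> ball2 E0 u"
      | "a \<in> insert v (nb E0 v)" "b \<in> insert v (nb E0 v)"
      unfolding BE by auto
    then show "b \<in> nb E a \<longleftrightarrow> f b \<in> nb F (f a)"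
    proof cases
      case 2
      then show ?thesis using key[OF 2 ab(1)] nb_sym by metis
    qed (use key key' ab in auto)
  qed
qed

text \<open>From a neighbour of \<open>u\<close> the branch beyond \<open>v\<close> is out of reach:
  \<open>v\<close> appears at distance 2, joined inside the ball to \<open>u\<close> alone. Putting
  \<open>y\<close> in its place is an isomorphism.\<close>

lemma ball2_iso_near_u:
  assumes w: "w \<in> nb E0 u"
  shows "nbhd_iso 2 {..<n} E w {..<n} F w"
proof -
  define f where "f z = (if z = v then y else z)" for z
  have wu: "w \<in> ball2 E0 u" "u \<in> nb E0 w" using w ball2I nb_sym by metis+
  have w_lt: "w < n" using nb_subset[OF graph] w by auto
  have nbw: "nb E w = nb E0 w" "nb F w = nb E0 w"
    using near_u(1,2,3)[OF wu(1)] w by (cases "w = u"; simp add: nbE_other nbF_other)+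
  have nbz: "z \<noteq> v" "z \<noteq> x" "z \<noteq> y" if "z \<in> ball2 E0 w" for z
  proof -
    have "w \<in> ball2 E0 z" using that ball2_sym by metis
    then show "z \<noteq> v" "z \<noteq> x" "z \<noteq> y" using sep(1-3)[OF wu(1)] by auto
  qed
  have 4: "nb E z = (if z = u then insert v (nb E0 u) else nb E0 z)"
    "nb F z = (if z = u then insert y (nb E0 u) else nb E0 z)" if "z \<in> ball2 E0 w" for z
    using nbz[OF that] nbE_other nbF_other nbE_u nbF_u by auto
  have BE: "ball2 E w = insert v (ball2 E0 w)"
    using wu(2) by (auto simp: ball2_def nbw 4 ball2I(2) split: if_splits)
  have BF: "ball2 F w = insert y (ball2 E0 w)"
    using wu(2) by (auto simp: ball2_def nbw 4 ball2I(2) split: if_splits)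
  \<comment> \<open>An edge from \<open>z\<close> to \<open>v\<close> or \<open>y\<close> would give
    a walk of length at most 4 from \<open>u\<close> in \<open>E0\<close>, against the disjointness
    of the 2-balls.\<close>
  have far: "z \<notin> nb E0 s" "s \<notin> nb E0 z" if zw: "z \<in> ball2 E0 w" and s: "s = v \<or> s = y" for z s
  proof -
    show "z \<notin> nb E0 s"
    proof
      assume z: "z \<in> nb E0 s"
      consider "z = w" | "z \<in> nb E0 w" | c where "c \<in> nb E0 w" "z \<in> nb E0 c"
        using zw by (auto simp: ball2_def)
      then show False
      proof cases
        case 1
        then show ?thesis using z s near_u(4,5)[OF wu(1)] by auto
      next
        case 2
        then show ?thesis using z s near_u(8,9)[OF wu(1)] by auto
      next
        case 3
        then have "c \<in> ball2 E0 u" using w ball2I(3) by metis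
        then show ?thesis using z 3(2) s near_u(8,9) by auto
      qed
    qed
    then show "s \<notin> nb E0 z" using nb_sym by metis
  qed
  have f0: "f z = z" if "z \<in> ball2 E0 w" for z using nbz(1)[OF that] by (simp add: f_def)
  have fv: "f v = y" by (simp add: f_def)
  have "v \<notin> ball2 E0 w" "y \<notin> ball2 E0 w" using nbz by auto
  then have bij: "bij_betw f (ball2 E w) (ball2 F w)"
    unfolding BE BF using f0 fv by (auto simp: bij_betw_def inj_on_def image_def)
  have key: "b \<in> nb E a \<longleftrightarrow> f b \<in> nb F (f a)"
    if "a \<in> ball2 E0 w" "b \<in> ball2 E w" for a b
  proof (cases "b = v")
    case True
    then show ?thesis using that(1) far(2)[OF that(1)] by (simp add: f0 4 fv)
  next
    case False
    then have "b \<in> ball2 E0 w" using that(2) BE by auto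
    then show ?thesis using that(1) nbz[OF \<open>b \<in> ball2 E0 w\<close>] by (simp add: f0 4)
  qed
  show ?thesis
  proof (rule nbhd_iso_2I[OF graphs w_lt w_lt bij f0[OF ball2I(1)]])
    fix a b assume ab: "a \<in> ball2 E w" "b \<in> ball2 E w"
    then consider "a \<in> ball2 E0 w" | "b \<in> ball2 E0 w" | "a = v" "b = v" unfolding BE by auto
    then show "b \<in> nb E a \<longleftrightarrow> f b \<in> nb F (f a)"
    proof cases
      case 2
      then show ?thesis using key[OF 2 ab(1)] nb_sym by metis
    qed (use key ab in auto)
  qed
qed

lemma ball2_iso_elsewhere:
  assumes w: "w < n" "\<And>s. s \<in> {u, v, x, y} \<Longrightarrow> w \<noteq> s \<and> w \<notin> nb E0 s"
  shows "nbhd_iso 2 {..<n} E w {..<n} F w"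
proof -
  have nbw: "nb E w = nb E0 w" "nb F w = nb E0 w"
    using w(2)[of u] w(2)[of v] w(2)[of x] w(2)[of y] by (simp_all add: nbE_other nbF_other)
  have "z \<notin> {u, v, x, y}" if "z \<in> nb E0 w" for z
    using w(2)[of z] that nb_sym[of z] by blast
  then have nbz: "nb E z = nb E0 z" "nb F z = nb E0 z" if "z \<in> nb E0 w" for z
    using that by (simp_all add: nbE_other nbF_other)
  have BE: "ball2 E w = ball2 E0 w" and BF: "ball2 F w = ball2 E0 w"
    by (simp_all add: ball2_def nbw nbz)
  have key: "b \<in> nb E a \<longleftrightarrow> b \<in> nb F a" if "a \<in> ball2 E0 w" "b \<in> ball2 E0 w" for a b
  proof -
    have s: "w \<in> ball2 E0 a" "w \<in> ball2 E0 b" using that ball2_sym by metis+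
    \<comment> \<open>The two graphs differ only in pairs of switch vertices. Two such vertices in
      the ball of \<open>w\<close> would put \<open>w\<close> into two of the disjoint
      2-balls.\<close>
    have "\<not> (a \<in> {u, v, x, y} \<and> b \<in> {u, v, x, y} \<and> a \<noteq> b)"
    proof
      assume "a \<in> {u, v, x, y} \<and> b \<in> {u, v, x, y} \<and> a \<noteq> b"
      then have "ball2 E0 a \<inter> ball2 E0 b = {}" using disj by (elim conjE insertE) (auto simp: Int_commute)
      then show False using s by blast
    qed
    then show ?thesis using distinct by (auto simp: nbE nbF split: if_splits)
  qed
  show ?thesis
    by (rule nbhd_iso_2I[OF graphs w(1) w(1), where f = id]) (auto simp: BE BF key)
qed

end

text \<open>Stated outside the locale because it compares four of its instances.\<close>

lemma edge_switch_F:
  assumes "edge_switch n E0 u v x y"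
  shows "edge_switch.E E0 v u y x = edge_switch.E E0 u v x y"
    "edge_switch.E E0 x y u v = edge_switch.E E0 u v x y"
    "edge_switch.E E0 y x v u = edge_switch.E E0 u v x y"
    "edge_switch.F E0 v u y x = edge_switch.F E0 u v x y"
    "edge_switch.F E0 x y u v = edge_switch.F E0 u v x y"
    "edge_switch.F E0 y x v u = edge_switch.F E0 u v x y"
proof -
  interpret edge_switch n E0 u v x y by (rule assms)
  note sw = edge_switch.E_def[OF switched(1)] edge_switch.E_def[OF switched(2)]
    edge_switch.E_def[OF switched(3)] edge_switch.F_def[OF switched(1)]
    edge_switch.F_def[OF switched(2)] edge_switch.F_def[OF switched(3)]
  show "edge_switch.E E0 v u y x = E" "edge_switch.E E0 x y u v = E" "edge_switch.E E0 y x v u = E"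
    "edge_switch.F E0 v u y x = F" "edge_switch.F E0 x y u v = F" "edge_switch.F E0 y x v u = F"
    unfolding sw E_def F_def by (auto simp: insert_commute)
qed

context edge_switch
begin

lemma same_nbhds: "same_nbhds 2 {..<n} E {..<n} F"
proof -
  note eqs = edge_switch_F[OF edge_switch_axioms]
  have "nbhd_iso 2 {..<n} E w {..<n} F w" if "w < n" for w
  proof (cases "\<forall>s\<in>{u, v, x, y}. w \<noteq> s \<and> w \<notin> nb E0 s")
    case True
    then show ?thesis using ball2_iso_elsewhere[OF that] by auto
  next
    case False
    then show ?thesis
      using ball2_iso_at_u edge_switch.ball2_iso_at_u[OF switched(1)]
        edge_switch.ball2_iso_at_u[OF switched(2)] edge_switch.ball2_iso_at_u[OF switched(3)]
        ball2_iso_near_u edge_switch.ball2_iso_near_u[OF switched(1)]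
        edge_switch.ball2_iso_near_u[OF switched(2)] edge_switch.ball2_iso_near_u[OF switched(3)]
      unfolding eqs by blast
  qed
  then show ?thesis unfolding same_nbhds_def by (intro exI[of _ id]) auto
qed

lemma card_nb_insert:
  assumes "s \<in> {u, v, x, y}" "t \<in> {u, v, x, y}"
  shows "card (nb E0 s \<union> {t}) = Suc (card (nb E0 s))"
  using finite_nb[OF graph] apart[OF assms] by simp

lemma degrees_eq: "card (nb F w) = card (nb E w)"
  unfolding nbE nbF by (simp add: card_nb_insert del: Un_insert_right)

text \<open>Each switch vertex trades a neighbour for one of equal degree. Hence a single weight
  function serves both graphs, and their walk counts differ only in the terms of the switched
  edges.\<close>

lemma nbdegsum_eq: "nbdegsum F w = nbdegsum E w"
proof -
  have E: "card (nb E v) = card (nb E y)" "card (nb E u) = card (nb E x)"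
    unfolding nbE using deg distinct by (simp_all add: card_nb_insert del: Un_insert_right)
  show ?thesis
    unfolding nbdegsum_def degrees_eq
    using E finite_nb[OF graph] distinct apart by (auto simp: nbE[of w] nbF[of w])
qed

lemma not_iso:
  assumes "nbdegsum E u \<noteq> nbdegsum E x" "nbdegsum E v \<noteq> nbdegsum E y"
  shows "\<not> graph_iso {..<n} E {..<n} F"
proof
  let ?S = "nbdegsum E"
  assume "graph_iso {..<n} E {..<n} F"
  from graph_iso_nbdegsum[OF graphs this]
  have eq: "(\<Sum>b<n. \<Sum>c\<in>nb E b. ?S b * ?S c) = (\<Sum>b<n. \<Sum>c\<in>nb F b. ?S b * ?S c)"
    by (simp add: nbdegsum_eq)
  define W where "W = (\<Sum>b<n. \<Sum>c\<in>nb E0 b. ?S b * ?S c)"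
  have sE: "(\<Sum>c\<in>nb E b. ?S b * ?S c) = (\<Sum>c\<in>nb E0 b. ?S b * ?S c) +
    ((if b = u then ?S u * ?S v else 0) + (if b = v then ?S v * ?S u else 0) +
     (if b = x then ?S x * ?S y else 0) + (if b = y then ?S y * ?S x else 0))" for b
    using finite_nb[OF graph] distinct apart by (auto simp: nbE)
  have sF: "(\<Sum>c\<in>nb F b. ?S b * ?S c) = (\<Sum>c\<in>nb E0 b. ?S b * ?S c) +
    ((if b = u then ?S u * ?S y else 0) + (if b = y then ?S y * ?S u else 0) +
     (if b = x then ?S x * ?S v else 0) + (if b = v then ?S v * ?S x else 0))" for b
    using finite_nb[OF graph] distinct apart by (auto simp: nbF)
  have "W + (?S u * ?S v + ?S v * ?S u + ?S x * ?S y + ?S y * ?S x) =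
        W + (?S u * ?S y + ?S y * ?S u + ?S x * ?S v + ?S v * ?S x)"
    using eq lt unfolding sE sF sum.distrib W_def by simp
  then have "?S u * ?S v + ?S x * ?S y = ?S u * ?S y + ?S x * ?S v" by (simp add: mult.commute)
  then have "(int (?S u) - int (?S x)) * (int (?S v) - int (?S y)) = 0"
    by (simp add: algebra_simps flip: of_nat_mult of_nat_add)
  then show False using assms by auto
qed

lemma not_reconstructible:
  assumes "nbdegsum E u \<noteq> nbdegsum E x" "nbdegsum E v \<noteq> nbdegsum E y"
  shows "\<not> reconstructible 2 n E"
  using not_iso[OF assms] same_nbhds graphs by (auto simp: reconstructible_def)

end

lemma not_reconstructibleI:
  assumes E: "is_graph n E" "{u, v} \<in> E" "{x, y} \<in> E"
    and sw: "edge_switch n (E - {{u, v}, {x, y}}) u v x y"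
    and S: "nbdegsum E u \<noteq> nbdegsum E x" "nbdegsum E v \<noteq> nbdegsum E y"
  shows "\<not> reconstructible 2 n E"
proof -
  have "edge_switch.E (E - {{u, v}, {x, y}}) u v x y = E"
    using E by (auto simp: edge_switch.E_def[OF sw])
  then show ?thesis using edge_switch.not_reconstructible[OF sw] S by simp
qed

subsection \<open>The sparse regime\<close>

abbreviation (input) nonrec_prob :: "nat \<Rightarrow> real \<Rightarrow> real" where
  "nonrec_prob n p \<equiv> Gnp_prob n p (\<lambda>E. \<not> reconstructible 2 n E)"

section \<open>Pairs meeting a vertex set\<close>

definition touching :: "nat \<Rightarrow> nat set \<Rightarrow> nat set set" where
  "touching n W = {e \<in> all_edges n. e \<inter> W \<noteq> {}}"

lemma finite_touching [simp]: "finite (touching n W)"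
  by (simp add: touching_def)

lemma touching_subset: "touching n W \<subseteq> all_edges n"
  by (auto simp: touching_def)

lemma all_edges_iff: "{a, b} \<in> all_edges n \<longleftrightarrow> a < n \<and> b < n \<and> a \<noteq> b"
  by (auto simp: all_edges_def doubleton_eq_iff)

lemma all_edgesE:
  assumes "e \<in> all_edges n"
  obtains a b where "a < n" "b < n" "a \<noteq> b" "e = {a, b}"
  using assms by (auto simp: all_edges_def)

lemma card_touching_le:
  assumes "finite W"
  shows "card (touching n W) \<le> card W * n"
proof -
  have "touching n W \<subseteq> (\<lambda>(v, w). {v, w}) ` (W \<times> {..<n})"
  proof
    fix e assume e: "e \<in> touching n W"
    then have "e \<in> all_edges n" by (simp add: touching_def)
    then obtain a b where ab: "a < n" "b < n" "e = {a, b}" by (rule all_edgesE)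
    with e have "a \<in> W \<or> b \<in> W" by (auto simp: touching_def)
    then show "e \<in> (\<lambda>(v, w). {v, w}) ` (W \<times> {..<n})"
      using ab by (auto simp: insert_commute image_iff)
  qed
  then have "card (touching n W) \<le> card (W \<times> {..<n})"
    using assms surj_card_le[of "W \<times> {..<n}"] by auto
  then show ?thesis by (simp add: card_cartesian_product)
qed

lemma card_touching_Int_le:
  assumes "finite V" "finite W" "V \<inter> W = {}"
  shows "card (touching n V \<inter> touching n W) \<le> card V * card W"
proof -
  have "touching n V \<inter> touching n W \<subseteq> (\<lambda>(v, w). {v, w}) ` (V \<times> W)"
  proof
    fix e assume e: "e \<in> touching n V \<inter> touching n W"
    then have "e \<in> all_edges n" by (simp add: touching_def)
    then obtain a b where ab: "e = {a, b}" by (rule all_edgesE)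
    from e ab assms(3) have "a \<in> V \<and> b \<in> W \<or> b \<in> V \<and> a \<in> W"
      by (auto simp: touching_def)
    then show "e \<in> (\<lambda>(v, w). {v, w}) ` (V \<times> W)"
      using ab by (auto simp: insert_commute image_iff)
  qed
  then have "card (touching n V \<inter> touching n W) \<le> card (V \<times> W)"
    using assms surj_card_le[of "V \<times> W"] by auto
  then show ?thesis by (simp add: card_cartesian_product)
qed

section \<open>Isolated paths on five vertices\<close>

type_synonym tuple5 = "nat \<times> nat \<times> nat \<times> nat \<times> nat"

fun path5 :: "tuple5 \<Rightarrow> nat set set" where
  "path5 (a, b, c, d, e) = {{a, b}, {b, c}, {c, d}, {d, e}}"

fun verts5 :: "tuple5 \<Rightarrow> nat set" where
  "verts5 (a, b, c, d, e) = {a, b, c, d, e}"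

text \<open>One block of labels for each position on the path: the five vertices are automatically
  distinct, and a path is listed in one direction only.\<close>

definition blocks5 :: "nat \<Rightarrow> tuple5 set" where
  "blocks5 m = {..<m} \<times> {m..<2*m} \<times> {2*m..<3*m} \<times> {3*m..<4*m} \<times> {4*m..<5*m}"

text \<open>The path is a connected component exactly if the trace of \<open>E\<close> on the pairs
  meeting it is the path itself; \<open>bexp_eq_set\<close> gives the probability of a prescribed
  trace.\<close>

definition isolated_path5 :: "nat \<Rightarrow> nat set set \<Rightarrow> tuple5 \<Rightarrow> bool" where
  "isolated_path5 n E t \<longleftrightarrow> E \<inter> touching n (verts5 t) = path5 t"

lemma finite_blocks5 [simp]: "finite (blocks5 m)" and card_blocks5: "card (blocks5 m) = m ^ 5"
proof -
  have "4 * m - 3 * m = m" "5 * m - 4 * m = m" "3 * m - 2 * m = m" "2 * m - m = m" by auto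
  then show "finite (blocks5 m)" "card (blocks5 m) = m ^ 5"
    unfolding blocks5_def by (auto simp: card_cartesian_product eval_nat_numeral)
qed

lemma blocks5D:
  assumes "(a, b, c, d, e) \<in> blocks5 m" "5 * m \<le> n"
  shows "a < b" "b < c" "c < d" "d < e" "a < m" "m \<le> b" "b < 2*m" "2*m \<le> c" "c < 3*m"
    "3*m \<le> d" "d < 4*m" "4*m \<le> e" "e < n"
  using assms by (auto simp: blocks5_def)

lemma path5_props:
  assumes "t \<in> blocks5 m" "5 * m \<le> n"
  shows "path5 t \<subseteq> touching n (verts5 t)" "card (path5 t) = 4" "card (verts5 t) = 5"
proof -
  obtain a b c d e where t: "t = (a, b, c, d, e)" by (cases t)
  note bl = blocks5D[OF assms[unfolded t]]
  then show "path5 t \<subseteq> touching n (verts5 t)"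
    by (auto simp: t touching_def all_edges_iff)
  have "distinct [{a, b}, {b, c}, {c, d}, {d, e}]" using bl by (auto simp: doubleton_eq_iff)
  then have "card (set [{a, b}, {b, c}, {c, d}, {d, e}]) = 4" by (simp only: distinct_card) simp
  then show "card (path5 t) = 4" by (simp add: t)
  have "distinct [a, b, c, d, e]" using bl by auto
  then have "card (set [a, b, c, d, e]) = 5" by (simp only: distinct_card) simp
  then show "card (verts5 t) = 5" by (simp add: t)
qed

text \<open>Both paths are connected components, so a common vertex forces equal vertex sets; the
  blocks then identify the vertices position by position.\<close>

lemma isolated_path5_disjoint:
  assumes E: "isolated_path5 n E s" "isolated_path5 n E t"
    and st: "s \<in> blocks5 m" "t \<in> blocks5 m" "5 * m \<le> n" "s \<noteq> t"
  shows "verts5 s \<inter> verts5 t = {}"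
proof (rule ccontr)
  assume ne: "verts5 s \<inter> verts5 t \<noteq> {}"
  obtain a b c d e where s: "s = (a, b, c, d, e)" by (cases s)
  obtain a' b' c' d' e' where t: "t = (a', b', c', d', e')" by (cases t)
  have step: "f \<subseteq> verts5 t" if "f \<in> path5 s" "f \<inter> verts5 t \<noteq> {}" for f
  proof -
    have "f \<in> E" "f \<in> touching n (verts5 s)" using E(1) that by (auto simp: isolated_path5_def)
    then have "f \<in> E \<inter> touching n (verts5 t)" using that by (auto simp: touching_def)
    then have "f \<in> path5 t" using E(2) unfolding isolated_path5_def by blast
    then show ?thesis by (auto simp: t)
  qed
  have "{a, b} \<inter> verts5 t \<noteq> {} \<Longrightarrow> {a, b} \<subseteq> verts5 t" "{b, c} \<inter> verts5 t \<noteq> {} \<Longrightarrow> {b, c} \<subseteq> verts5 t"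
    "{c, d} \<inter> verts5 t \<noteq> {} \<Longrightarrow> {c, d} \<subseteq> verts5 t" "{d, e} \<inter> verts5 t \<noteq> {} \<Longrightarrow> {d, e} \<subseteq> verts5 t"
    by (rule step; simp add: s)+
  then have sub: "{a, b, c, d, e} \<subseteq> verts5 t" using ne by (auto simp: s)
  note bl = blocks5D[OF st(1,3)[unfolded s]] blocks5D[OF st(2,3)[unfolded t]]
  have "a = a'" "b = b'" "c = c'" "d = d'" "e = e'"
    using sub bl by (simp_all add: t)
  then show False using st(4) s t by simp
qed

lemma nb_isolated_path5:
  assumes "is_graph n E" "isolated_path5 n E t" "z \<in> verts5 t"
  shows "nb E z = nb (path5 t) z"
proof -
  have "{z, w} \<in> E \<longleftrightarrow> {z, w} \<in> path5 t" for w
    using assms by (auto simp: isolated_path5_def touching_def is_graph_def)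
  then show ?thesis by (simp add: nb_def)
qed

lemma nb_path5:
  assumes "a < b" "b < c" "c < d" "d < (e::nat)"
  shows "nb (path5 (a, b, c, d, e)) a = {b}" "nb (path5 (a, b, c, d, e)) b = {a, c}"
    "nb (path5 (a, b, c, d, e)) c = {b, d}" "nb (path5 (a, b, c, d, e)) d = {c, e}"
    "nb (path5 (a, b, c, d, e)) e = {d}"
  using assms by (auto simp: nb_def doubleton_eq_iff)

lemma nb_Diff2:
  "nb (E - {{u, v}, {x, y}}) w = nb E w - (if w = u then {v} else {}) - (if w = v then {u} else {})
     - (if w = x then {y} else {}) - (if w = y then {x} else {})"
  by (auto simp: nb_def doubleton_eq_iff)

text \<open>Cut the second edge of one path and the third of the other: the pieces with 2, 3 and 3,
  2 vertices are rejoined to paths on 4 and 6 vertices. The degree sums are 3 against 4 at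
  \<open>b\<close> and \<open>c'\<close>, and 4 against 3 at \<open>c\<close> and
  \<open>d'\<close>.\<close>

lemma two_isolated_path5:
  assumes E: "is_graph n E" "isolated_path5 n E s" "isolated_path5 n E t"
    and st: "s \<in> blocks5 m" "t \<in> blocks5 m" "5 * m \<le> n" "s \<noteq> t"
  shows "\<not> reconstructible 2 n E"
proof -
  obtain a b c d e where s: "s = (a, b, c, d, e)" by (cases s)
  obtain a' b' c' d' e' where t: "t = (a', b', c', d', e')" by (cases t)
  note bl = blocks5D[OF st(1,3)[unfolded s]] blocks5D[OF st(2,3)[unfolded t]]
  have dj: "verts5 s \<inter> verts5 t = {}" by (rule isolated_path5_disjoint[OF E(2,3) st])
  have nbs: "nb E a = {b}" "nb E b = {a, c}" "nb E c = {b, d}" "nb E d = {c, e}" "nb E e = {d}"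
    using nb_isolated_path5[OF E(1,2)] nb_path5[OF bl(1-4)] by (simp_all add: s)
  have nbt: "nb E a' = {b'}" "nb E b' = {a', c'}" "nb E c' = {b', d'}" "nb E d' = {c', e'}" "nb E e' = {d'}"
    using nb_isolated_path5[OF E(1,3)] nb_path5[OF bl(14-17)] by (simp_all add: t)
  have lt: "a < b" "a < c" "a < d" "a < e" "b < c" "b < d" "b < e" "c < d" "c < e" "d < e" "e < n"
    "a' < b'" "a' < c'" "a' < d'" "a' < e'" "b' < c'" "b' < d'" "b' < e'" "c' < d'" "c' < e'" "d' < e'" "e' < n"
    using bl by linarith+
  have "distinct [a, b, c, d, e]" "distinct [a', b', c', d', e']" using lt by simp_all
  then have "distinct ([a, b, c, d, e] @ [a', b', c', d', e'])"
    unfolding distinct_append using dj by (simp add: s t)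
  then have dis: "distinct [a, b, c, d, e, a', b', c', d', e']" by simp
  \<comment> \<open>\<open>distinct\<close> yields each inequation in one orientation; the reversed
    list supplies the other one to the simplifier.\<close>
  then have "distinct (rev [a, b, c, d, e, a', b', c', d', e'])" by (simp only: distinct_rev)
  with dis have neq: "distinct [a, b, c, d, e, a', b', c', d', e']"
    "distinct [e', d', c', b', a', e, d, c, b, a]" by simp_all
  let ?E0 = "E - {{b, c}, {c', d'}}"
  have nb0: "nb ?E0 a = {b}" "nb ?E0 b = {a}" "nb ?E0 c = {d}" "nb ?E0 d = {c, e}" "nb ?E0 e = {d}"
    "nb ?E0 a' = {b'}" "nb ?E0 b' = {a', c'}" "nb ?E0 c' = {b'}" "nb ?E0 d' = {e'}" "nb ?E0 e' = {d'}"
    using neq by (simp_all add: nb_Diff2 nbs nbt insert_Diff_if)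
  have b0: "ball2 ?E0 b = {a, b}" "ball2 ?E0 c = {c, d, e}" "ball2 ?E0 c' = {a', b', c'}" "ball2 ?E0 d' = {d', e'}"
    by (simp_all add: ball2_def nb0 insert_commute)
  show ?thesis
  proof (rule not_reconstructibleI[of n E b c c' d'])
    show "is_graph n E" by (rule E)
    show "{b, c} \<in> E" "{c', d'} \<in> E"
    proof -
      have "path5 s \<subseteq> E" "path5 t \<subseteq> E" using E(2,3) unfolding isolated_path5_def by blast+
      then show "{b, c} \<in> E" "{c', d'} \<in> E" by (simp_all add: s t)
    qed
    show "edge_switch n ?E0 b c c' d'"
    proof
      show "is_graph n ?E0" using E(1) by (auto simp: is_graph_def)
      show "b < n" "c < n" "c' < n" "d' < n" using lt by auto
    next
      fix s \<alpha> \<beta> assume "s \<in> {b, c, c', d'}" "\<alpha> \<in> nb ?E0 s" "\<beta> \<in> nb ?E0 s"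
      then have "\<alpha> = \<beta>" by (auto simp: nb0)
      then show "\<beta> \<notin> nb ?E0 \<alpha>" by simp
    qed (use neq in \<open>simp_all add: b0 nb0\<close>)
    show "nbdegsum E b \<noteq> nbdegsum E c'" "nbdegsum E c \<noteq> nbdegsum E d'"
      using neq by (simp_all add: nbdegsum_def nbs nbt)
  qed
qed

lemma prob_isolated_path5:
  assumes "t \<in> blocks5 m" "5 * m \<le> n"
  shows "prob p (all_edges n) (\<lambda>E. isolated_path5 n E t) =
    p ^ 4 * (1 - p) ^ (card (touching n (verts5 t)) - 4)"
  unfolding isolated_path5_def
  using bexp_eq_set[OF finite_all_edges touching_subset path5_props(1)[OF assms]] path5_props(2)[OF assms]
    path5_props(1)[OF assms] by (simp add: card_Diff_subset finite_subset[OF path5_props(1)[OF assms]])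

lemma Int_Un_eq_iff:
  assumes "P \<subseteq> S" "Q \<subseteq> T" "P \<inter> T = {}" "Q \<inter> S = {}"
  shows "E \<inter> S = P \<and> E \<inter> T = Q \<longleftrightarrow> E \<inter> (S \<union> T) = P \<union> Q"
proof
  assume "E \<inter> (S \<union> T) = P \<union> Q"
  then have "E \<inter> S = (P \<union> Q) \<inter> S" "E \<inter> T = (P \<union> Q) \<inter> T" by blast+
  then show "E \<inter> S = P \<and> E \<inter> T = Q" using assms by blast
qed (use assms in blast)

text \<open>The joint event prescribes the trace on the union of the two touching sets. At most 25
  pairs lie in both sets, and the product of the single probabilities charges for their absence
  twice.\<close>

lemma prob_two_isolated_path5:
  assumes p: "0 \<le> p" "p < 1"
    and st: "s \<in> blocks5 m" "t \<in> blocks5 m" "5 * m \<le> n" "s \<noteq> t"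
  shows "prob p (all_edges n) (\<lambda>E. isolated_path5 n E s \<and> isolated_path5 n E t) \<le>
    (1 / (1 - p) ^ 25) * (prob p (all_edges n) (\<lambda>E. isolated_path5 n E s) *
      prob p (all_edges n) (\<lambda>E. isolated_path5 n E t))" (is "?two \<le> _")
proof (cases "verts5 s \<inter> verts5 t = {}")
  case False
  then have "?two = 0"
    using isolated_path5_disjoint[OF _ _ st] finite_all_edges
    by (subst bexp_cong[where g = "\<lambda>_. 0"]) auto
  moreover have "0 \<le> prob p (all_edges n) (\<lambda>E. isolated_path5 n E r)" for r
    using p by (intro bexp_nonneg) auto
  ultimately show ?thesis using p by simp
next
  case True
  note ps = path5_props[OF st(1,3)] and pt = path5_props[OF st(2,3)]
  let ?S = "touching n (verts5 s)" and ?T = "touching n (verts5 t)"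
  have fin: "finite (verts5 s)" "finite (verts5 t)" using ps(3) pt(3) card.infinite by fastforce+
  have fp: "finite (path5 s)" "finite (path5 t)" using ps(2) pt(2) card.infinite by fastforce+
  have sub: "e \<subseteq> verts5 r" if "e \<in> path5 r" for e r using that by (cases r) auto
  have dj: "path5 s \<inter> ?T = {}" "path5 t \<inter> ?S = {}"
    using sub True unfolding touching_def by blast+
  have eq: "isolated_path5 n E s \<and> isolated_path5 n E t \<longleftrightarrow> E \<inter> (?S \<union> ?T) = path5 s \<union> path5 t" for E
    unfolding isolated_path5_def by (rule Int_Un_eq_iff[OF ps(1) pt(1) dj])
  have c8: "card (path5 s \<union> path5 t) = 8"
    using ps(1,2) pt(1,2) dj fp by (subst card_Un_disjoint) auto
  have cU: "card ?S + card ?T \<le> card (?S \<union> ?T) + 25"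
    using card_Un_Int[of ?S ?T] card_touching_Int_le[OF fin True, of n] ps(3) pt(3) by simp
  have c4: "card ?S \<ge> 4" "card ?T \<ge> 4"
    using card_mono[OF finite_touching ps(1)] card_mono[OF finite_touching pt(1)] ps(2) pt(2) by auto
  have c8': "card (?S \<union> ?T) \<ge> 8"
    using card_mono[of "?S \<union> ?T" "path5 s \<union> path5 t"] ps(1) pt(1) c8 by auto
  have "?two =
      p ^ 8 * (1 - p) ^ (card (?S \<union> ?T) - 8)"
    unfolding eq using bexp_eq_set[OF finite_all_edges, of "?S \<union> ?T" n "path5 s \<union> path5 t" p]
      touching_subset ps(1) pt(1) c8 fp
    by (simp add: card_Diff_subset le_supI1 le_supI2)
  also have "\<dots> \<le> p ^ 8 * ((1 / (1 - p) ^ 25) * (1 - p) ^ ((card ?S - 4) + (card ?T - 4)))"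
  proof (rule mult_left_mono)
    have "(1 - p) ^ (card (?S \<union> ?T) - 8 + 25) \<le> (1 - p) ^ ((card ?S - 4) + (card ?T - 4))"
      using cU c4 c8' p by (intro power_decreasing) auto
    then show "(1 - p) ^ (card (?S \<union> ?T) - 8) \<le> (1 / (1 - p) ^ 25) * (1 - p) ^ ((card ?S - 4) + (card ?T - 4))"
      using p by (simp add: power_add field_simps)
  qed (use p in auto)
  also have "\<dots> = (1 / (1 - p) ^ 25) * (p ^ 4 * (1 - p) ^ (card ?S - 4) * (p ^ 4 * (1 - p) ^ (card ?T - 4)))"
    by (simp add: power_add field_simps flip: power_add)
  finally show ?thesis
    by (simp add: prob_isolated_path5[OF st(1,3)] prob_isolated_path5[OF st(2,3)])
qed

text \<open>At most \<open>5 * n\<close> pairs meet a path, so \<open>\<mu>\<close> bounds the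
  expected number of isolated paths from below. With \<open>\<mu> \<ge> 4\<close>, more than half
  the expectation means at least two paths.\<close>

lemma sparse_bound:
  assumes p: "0 \<le> p" "p < 1" and m: "5 * m \<le> n"
    and \<mu>: "\<mu> \<le> real m ^ 5 * p ^ 4 * (1 - p) ^ (5 * n)" "\<mu> \<ge> 4"
  shows "nonrec_prob n p \<ge>
    1 - 4 * (1 / \<mu> + (1 / (1 - p) ^ 25 - 1))"
proof -
  let ?P = "\<lambda>t. prob p (all_edges n) (\<lambda>E. isolated_path5 n E t)"
  define \<nu> where "\<nu> = (\<Sum>t\<in>blocks5 m. ?P t)"
  have "p ^ 4 * (1 - p) ^ (5 * n) \<le> ?P t" if "t \<in> blocks5 m" for t
  proof -
    have f: "finite (verts5 t)" using path5_props(3)[OF that m] card.infinite by fastforce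
    show ?thesis unfolding prob_isolated_path5[OF that m]
      using card_touching_le[OF f, of n] path5_props(3)[OF that m] p
      by (intro mult_left_mono power_decreasing) auto
  qed
  then have "(\<Sum>t\<in>blocks5 m. p ^ 4 * (1 - p) ^ (5 * n)) \<le> \<nu>" unfolding \<nu>_def by (intro sum_mono)
  then have \<nu>: "\<mu> \<le> \<nu>" using \<mu>(1) by (simp add: card_blocks5 mult.assoc)
  let ?few = "\<lambda>E. real (card {t\<in>blocks5 m. isolated_path5 n E t}) \<le> \<nu> / 2"
  have p25: "0 < (1 - p) ^ 25" "(1 - p) ^ 25 \<le> 1" using p by (auto intro: power_le_one)
  have "prob p (all_edges n) (\<lambda>E. ?few E)
      \<le> 4 * (1 / \<nu> + (1 / (1 - p) ^ 25 - 1))"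
    using p \<nu> \<mu>(2) p25 prob_two_isolated_path5[OF p _ _ m]
    by (intro bexp_second_moment[OF _ _ finite_all_edges finite_blocks5 \<nu>_def]) auto
  also have "\<dots> \<le> 4 * (1 / \<mu> + (1 / (1 - p) ^ 25 - 1))"
    using \<nu> \<mu>(2) by (simp add: frac_le)
  finally have *: "1 - 4 * (1 / \<mu> + (1 / (1 - p) ^ 25 - 1)) \<le>
     prob p (all_edges n) (\<lambda>E. \<not> ?few E)"
    by (subst bexp_not) auto
  also have "\<dots> \<le> prob p (all_edges n) (\<lambda>E. \<not> reconstructible 2 n E)"
  proof (intro bexp_mono)
    fix E assume E: "E \<subseteq> all_edges n"
    have "\<not> reconstructible 2 n E" if "\<not> ?few E"
    proof -
      let ?A = "{t\<in>blocks5 m. isolated_path5 n E t}"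
      have "card ?A \<ge> 2" using that \<nu> \<mu>(2) by linarith
      then obtain B where "B \<subseteq> ?A" "card B = 2" by (rule obtain_subset_with_card_n)
      then obtain s t where "s \<in> ?A" "t \<in> ?A" "s \<noteq> t" by (auto simp: card_2_iff)
      then show ?thesis using two_isolated_path5[of n E s t m] E m by (auto simp: is_graph_def)
    qed
    then show "of_bool (\<not> ?few E)
       \<le> (of_bool (\<not> reconstructible 2 n E) :: real)" by auto
  qed (use p in auto)
  finally show ?thesis by (simp add: Gnp_prob_eq_bexp)
qed

section \<open>Limits in the sparse regime\<close>

lemma Gnp_prob_le_1: "0 \<le> p \<Longrightarrow> p \<le> 1 \<Longrightarrow> Gnp_prob n p P \<le> 1"
  unfolding Gnp_prob_eq_bexp by (intro bexp_le_1) auto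

text \<open>\<open>(1 - x) * (1 + 1.1 * x)\<close> is at least 1 for \<open>x\<close> up to 1/11.
  The loss of ten percent in the exponent is the source of the later constants 5.5 and 6.6.\<close>

lemma one_minus_ge_exp:
  fixes x :: real
  assumes "0 \<le> x" "x \<le> 1/20"
  shows "exp (- 1.1 * x) \<le> 1 - x"
proof -
  have "1 \<le> (1 - x) * (1 + 1.1 * x)" using assms mult_mono[of x "1/20" x x] by (simp add: algebra_simps)
  also have "\<dots> \<le> (1 - x) * exp (1.1 * x)"
    using assms exp_ge_add_one_self[of "1.1 * x"] by (intro mult_left_mono) auto
  finally show ?thesis using exp_gt_zero[of "1.1 * x"] by (simp add: exp_minus field_simps)
qed

lemma one_minus_power_ge_exp:
  fixes x :: real
  assumes "0 \<le> x" "x \<le> 1/20"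
  shows "exp (- 1.1 * x * real k) \<le> (1 - x) ^ k"
  using power_mono[OF one_minus_ge_exp[OF assms], of k] by (simp add: mult.commute flip: exp_of_nat_mult)

theorem sparse_regime:
  fixes p :: "nat \<Rightarrow> real"
  assumes up: "\<forall>\<^sub>F n in sequentially. p n \<le> ln (real n) / (10 * real n)"
    and low: "filterlim (\<lambda>n. p n / real n powr (-5/4)) at_top sequentially"
  shows "(\<lambda>n. nonrec_prob n (p n)) \<longlonglongrightarrow> 1"
proof -
  define D where "D n = ln (real n) / (10 * real n)" for n :: nat
  define x where "x n = p n / real n powr (-5/4)" for n
  \<comment> \<open>As \<open>n ^ 5 * p n ^ 4 = x n ^ 4\<close>, the expected number of isolated
    paths is at least \<open>x n ^ 4 * exp (- 5.5 * p n * n) / 10 ^ 5\<close>; the divisor comes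
    from blocks of size \<open>n div 5 \<ge> n / 10\<close>. The two entries serve
    \<open>p n * n \<le> 1\<close> and \<open>p n * n > 1\<close>. In the latter case the upper
    bound on \<open>p\<close> makes the exponential at least \<open>n powr (- 0.55)\<close>.\<close>
  define \<mu> where "\<mu> n = min (x n * exp (-5.5)) (real n powr 0.45) / 10 ^ 5" for n
  have \<mu>: "filterlim \<mu> at_top sequentially"
    unfolding filterlim_at_top
  proof
    fix Z :: real
    have "\<forall>\<^sub>F n in sequentially. Z * 10 ^ 5 / exp (-5.5) \<le> x n"
      using low unfolding x_def filterlim_at_top by blast
    moreover have "filterlim (\<lambda>n::nat. real n powr 0.45) at_top sequentially" by real_asymp
    then have "\<forall>\<^sub>F n in sequentially. Z * 10 ^ 5 \<le> real n powr 0.45"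
      unfolding filterlim_at_top by blast
    ultimately show "\<forall>\<^sub>F n in sequentially. Z \<le> \<mu> n"
      by eventually_elim (auto simp: \<mu>_def field_simps)
  qed
  have D: "D \<longlonglongrightarrow> 0" unfolding D_def by real_asymp
  have "\<forall>\<^sub>F n in sequentially. D n \<le> 1/20"
    unfolding D_def by real_asymp
  moreover have "\<forall>\<^sub>F n in sequentially. x n \<ge> 1"
    using low unfolding x_def filterlim_at_top by blast
  moreover have "\<forall>\<^sub>F n in sequentially. \<mu> n \<ge> 4"
    using \<mu> unfolding filterlim_at_top by blast
  moreover have "\<forall>\<^sub>F n in sequentially. n \<ge> 10" by (rule eventually_ge_at_top)
  ultimately have ev: "\<forall>\<^sub>F n in sequentially. p n \<ge> 0 \<and> p n \<le> 1 \<and>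
    nonrec_prob n (p n) \<ge> 1 - 4 * (1 / \<mu> n + (1 / (1 - D n) ^ 25 - 1))"
    using up
  proof eventually_elim
    case (elim n)
    define m where "m = n div 5"
    have n: "real n > 0" using elim by simp
    have pD: "p n \<le> D n" using elim by (simp add: D_def)
    have px: "p n = x n * real n powr (-5/4)" using n by (simp add: x_def)
    have p: "0 \<le> p n" "p n \<le> 1/20" "p n < 1" using px elim pD by auto
    have "real m \<ge> real n / 10" using elim unfolding m_def by linarith
    then have m: "real m ^ 5 \<ge> real n ^ 5 / 10 ^ 5"
      using power_mono[of "real n / 10" "real m" 5] by (simp add: power_divide)
    have e: "exp (- 5.5 * (p n * real n)) \<le> (1 - p n) ^ (5 * n)"
      using one_minus_power_ge_exp[OF p(1,2), of "5 * n"] by (simp add: algebra_simps)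
    have x4: "real n ^ 5 * p n ^ 4 = x n ^ 4"
    proof -
      have "(real n powr (-5/4)) ^ 4 = real n powr (-5)" using n by (simp add: powr_power)
      then have "real n ^ 5 * p n ^ 4 = x n ^ 4 * (real n ^ 5 * real n powr (-5))"
        by (simp add: px power_mult_distrib)
      also have "real n ^ 5 * real n powr (-5) = 1"
        using n by (simp add: powr_minus)
      finally show ?thesis by simp
    qed
    have "\<mu> n * 10 ^ 5 \<le> real n ^ 5 * p n ^ 4 * exp (- 5.5 * (p n * real n))"
    proof (cases "p n * real n \<le> 1")
      case True
      have "\<mu> n * 10 ^ 5 \<le> x n * exp (-5.5)" by (simp add: \<mu>_def)
      also have "\<dots> \<le> x n ^ 4 * exp (- 5.5 * (p n * real n))"
        using True elim(2) self_le_power[of "x n" 4] by (intro mult_mono) (auto simp: mult.commute)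
      finally show ?thesis by (simp add: x4)
    next
      case False
      have "p n * real n \<le> ln (real n) / 10" using elim n by (simp add: field_simps)
      then have "real n powr (-0.55) \<le> exp (- 5.5 * (p n * real n))"
        using n by (simp add: powr_def algebra_simps)
      moreover have "1 \<le> (p n * real n) ^ 4" using False by simp
      ultimately have "real n * (1 * real n powr (-0.55)) \<le> real n * ((p n * real n) ^ 4 * exp (- 5.5 * (p n * real n)))"
        by (intro mult_left_mono mult_mono) auto
      moreover have "real n * real n powr (-0.55) = real n powr 0.45"
        using n by (subst powr_mult_base) auto
      moreover have "real n * ((p n * real n) ^ 4 * c) = real n ^ 5 * p n ^ 4 * c" for c
        by (simp add: power_mult_distrib eval_nat_numeral)
      moreover have "\<mu> n * 10 ^ 5 \<le> real n powr 0.45" by (simp add: \<mu>_def)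
      ultimately show ?thesis by (simp only: mult_1_left)
    qed
    also have "\<dots> \<le> real n ^ 5 * p n ^ 4 * (1 - p n) ^ (5 * n)"
      using e p by (intro mult_left_mono) auto
    also have "\<dots> \<le> (real m ^ 5 * 10 ^ 5) * p n ^ 4 * (1 - p n) ^ (5 * n)"
      using m p by (intro mult_right_mono) (auto simp: field_simps)
    finally have "\<mu> n \<le> real m ^ 5 * p n ^ 4 * (1 - p n) ^ (5 * n)" by simp
    from sparse_bound[OF p(1,3) _ this elim(3)]
    have "1 - 4 * (1 / \<mu> n + (1 / (1 - p n) ^ 25 - 1)) \<le> nonrec_prob n (p n)"
      by (simp add: m_def)
    moreover have "1 / (1 - p n) ^ 25 \<le> 1 / (1 - D n) ^ 25"
      using pD elim(1) p by (intro divide_left_mono power_mono) auto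
    ultimately show ?case using p by auto
  qed
  have "(\<lambda>n. 1 / \<mu> n) \<longlonglongrightarrow> 0"
    using tendsto_inverse_0_at_top[OF \<mu>] by (simp add: inverse_eq_divide)
  then have lim: "(\<lambda>n. 1 - 4 * (1 / \<mu> n + (1 / (1 - D n) ^ 25 - 1))) \<longlonglongrightarrow> 1 - 4 * (0 + (1 / (1 - 0) ^ 25 - 1))"
    using D by (intro tendsto_intros) auto
  have one: "1 - 4 * (0 + (1 / (1 - 0) ^ 25 - 1)) = (1::real)" by simp
  show ?thesis
  proof (rule tendsto_sandwich[OF _ _ lim[unfolded one] tendsto_const])
    show "\<forall>\<^sub>F n in sequentially. 1 - 4 * (1 / \<mu> n + (1 / (1 - D n) ^ 25 - 1))
        \<le> nonrec_prob n (p n)"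
      using ev by eventually_elim auto
    show "\<forall>\<^sub>F n in sequentially. nonrec_prob n (p n) \<le> 1"
      using ev by eventually_elim (auto intro: Gnp_prob_le_1)
  qed
qed

subsection \<open>Random edges towards four vertex sets\<close>

lemma exp_minus_le:
  fixes y :: real
  assumes "0 \<le> y" "y \<le> 1"
  shows "exp (- y) \<le> 1 - y / 2"
proof -
  have "1 \<le> (1 - y / 2) * (1 + y)" using assms mult_left_mono[of y 1 y] by (simp add: algebra_simps)
  also have "\<dots> \<le> (1 - y / 2) * exp y" using assms exp_ge_add_one_self[of y] by (intro mult_left_mono) auto
  finally show ?thesis by (simp add: exp_minus field_simps)
qed

lemma one_minus_power_le_exp:
  fixes x :: real
  assumes "x \<le> 1"
  shows "(1 - x) ^ k \<le> exp (- (real k * x))"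
  using power_mono[of "1 - x" "exp (- x)" k] assms exp_ge_add_one_self[of "- x"]
  by (simp flip: exp_of_nat_mult)

lemma prod_zero_power: "finite A \<Longrightarrow> (\<Prod>e\<in>A. 0::real) = of_bool (A = {})"
  by (induction A rule: finite_induct) auto

text \<open>\<open>K j z\<close> is the set of possible edges from the vertex \<open>z\<close> to the \<open>j\<close>-th of four vertex sets.\<close>

locale four_stars =
  fixes K :: "nat \<Rightarrow> 'z \<Rightarrow> 'e set" and Z :: "'z set" and k :: nat and p :: real
  assumes finZ: "finite Z"
    and finK: "\<And>j z. j < 4 \<Longrightarrow> finite (K j z)"
    and cardK: "\<And>j z. j < 4 \<Longrightarrow> z \<in> Z \<Longrightarrow> card (K j z) = k"
    and disjK: "\<And>i j z z'. i < 4 \<Longrightarrow> j < 4 \<Longrightarrow> z \<in> Z \<Longrightarrow> z' \<in> Z \<Longrightarrow> (i, z) \<noteq> (j, z') \<Longrightarrow> K i z \<inter> K j z' = {}"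
    and p: "0 \<le> p" "p \<le> 1"
begin

definition star where "star z = (\<Union>j<4. K j z)"
definition U where "U = (\<Union>z\<in>Z. star z)"

text \<open>A vertex \<open>z\<close> hit from two of the four sets would lie in two of the 2-balls,
  so this is what the random edges at \<open>z\<close> must satisfy to keep the balls
  disjoint.\<close>

definition hit_once :: "'e set \<Rightarrow> 'z \<Rightarrow> bool" where
  "hit_once E z \<longleftrightarrow> (\<forall>i<4. \<forall>j<4. i \<noteq> j \<longrightarrow> E \<inter> K i z = {} \<or> E \<inter> K j z = {})"

definition cnt :: "'e set \<Rightarrow> nat \<Rightarrow> nat" where
  "cnt E j = (\<Sum>z\<in>Z. card (E \<inter> K j z))"

definition separated :: "'e set \<Rightarrow> bool" where
  "separated E \<longleftrightarrow> (\<forall>z\<in>Z. hit_once E z)"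

text \<open>A signed count of the edges at \<open>z\<close>, restricted to the event \<open>hit_once\<close>; written as a
  combination of products over edges, whose expectations factorise.\<close>

definition \<phi> :: "(nat \<Rightarrow> real) \<Rightarrow> 'z \<Rightarrow> 'e set \<Rightarrow> real" where
  "\<phi> \<sigma> z E = (\<Sum>j<4. \<Prod>e\<in>E. if e \<in> K j z then \<sigma> j else 0) - 3 * (\<Prod>e\<in>E. 0)"

lemma star_Int: "z \<in> Z \<Longrightarrow> z' \<in> Z \<Longrightarrow> z \<noteq> z' \<Longrightarrow> star z \<inter> star z' = {}"
  using disjK unfolding star_def by fastforce

lemma finite_star [simp]: "finite (star z)" and finite_U [simp]: "finite U"
  using finK finZ by (auto simp: star_def U_def)

text \<open>A nonempty \<open>E\<close> inside one \<open>K j z\<close> is counted by that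
  \<open>j\<close> alone, an \<open>E\<close> meeting two of the sets by none. The empty set is
  counted four times, hence the correction by 3.\<close>

lemma phi_eq:
  assumes z: "z \<in> Z" and E: "E \<subseteq> star z"
  shows "\<phi> \<sigma> z E = of_bool (hit_once E z) * (\<Prod>j<4. \<sigma> j ^ card (E \<inter> K j z))"
proof -
  have fE: "finite E" using E finite_star finite_subset by blast
  consider "E = {}" | j where "j < 4" "E \<subseteq> K j z" "E \<noteq> {}" | "\<not> (\<exists>j<4. E \<subseteq> K j z)" by blast
  then show ?thesis
  proof cases
    case 1
    then show ?thesis by (simp add: \<phi>_def hit_once_def)
  next
    case (2 j)
    have dj: "E \<inter> K i z = {}" if "i < 4" "i \<noteq> j" for i
      using disjK[OF that(1) 2(1) z z] that 2(2) by auto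
    have "(\<Prod>e\<in>E. if e \<in> K i z then \<sigma> i else 0) = (if i = j then \<sigma> j ^ card E else 0)" if "i < 4" for i
    proof (cases "i = j")
      case True
      then have "(\<Prod>e\<in>E. if e \<in> K i z then \<sigma> i else 0) = (\<Prod>e\<in>E. \<sigma> j)"
        using 2(2) by (intro prod.cong) auto
      then show ?thesis using True by simp
    next
      case False
      then have "(\<Prod>e\<in>E. if e \<in> K i z then \<sigma> i else 0) = (\<Prod>e\<in>E. 0)"
        using dj[OF that False] by (intro prod.cong) auto
      then show ?thesis using False 2(3) fE by (simp add: prod_zero_power card_gt_0_iff)
    qed
    then have "\<phi> \<sigma> z E = (\<Sum>i<4. if i = j then \<sigma> j ^ card E else 0) - 3 * (\<Prod>e\<in>E. 0)"
      unfolding \<phi>_def by (intro arg_cong2[where f = "(-)"] sum.cong) auto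
    also have "\<dots> = \<sigma> j ^ card E" using 2 fE by (simp add: prod_zero_power card_gt_0_iff)
    also have "(\<Prod>i<4. \<sigma> i ^ card (E \<inter> K i z)) = (\<Prod>i<4. if i = j then \<sigma> j ^ card E else 1)"
      using dj 2(2) by (intro prod.cong) (auto simp: Int_absorb2)
    then have "\<sigma> j ^ card E = (\<Prod>i<4. \<sigma> i ^ card (E \<inter> K i z))"
      using 2(1) by simp
    moreover have "hit_once E z" unfolding hit_once_def using dj by metis
    ultimately show ?thesis by simp
  next
    case 3
    have "(\<Prod>e\<in>E. if e \<in> K i z then \<sigma> i else 0) = 0" if "i < 4" for i
    proof -
      obtain e where "e \<in> E" "e \<notin> K i z" using 3 \<open>i < 4\<close> by blast
      then show ?thesis using fE by (intro prod_zero) auto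
    qed
    then have "(\<Sum>i<4. \<Prod>e\<in>E. if e \<in> K i z then \<sigma> i else 0) = (\<Sum>i<4::nat. 0)"
      by (intro sum.cong refl) simp
    moreover have "E \<noteq> {}" using 3 by (metis empty_subsetI zero_less_numeral)
    ultimately have "\<phi> \<sigma> z E = 0" using fE unfolding \<phi>_def by (simp add: prod_zero_power card_gt_0_iff)
    moreover have "\<not> hit_once E z"
    proof
      assume h: "hit_once E z"
      from \<open>E \<noteq> {}\<close> obtain e where "e \<in> E" by blast
      then obtain i where i: "i < 4" "e \<in> K i z" using E by (auto simp: star_def)
      then have "E \<inter> K j z = {}" if "j < 4" "j \<noteq> i" for j
        using h \<open>e \<in> E\<close> that unfolding hit_once_def by blast
      then have "E \<subseteq> K i z" using E unfolding star_def by blast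
      then show False using 3 i by blast
    qed
    ultimately show ?thesis by simp
  qed
qed

text \<open>The expectation of \<open>\<phi>\<close>: in the \<open>j\<close>-th product the
  \<open>k\<close> edges of \<open>K j z\<close> carry the sign, and the other \<open>3 * k\<close>
  must be absent.\<close>

definition val :: "(nat \<Rightarrow> real) \<Rightarrow> real" where
  "val \<sigma> = (\<Sum>j<4. (1 - p + p * \<sigma> j) ^ k * (1 - p) ^ (3 * k)) - 3 * (1 - p) ^ (4 * k)"

lemma card_star:
  assumes "z \<in> Z" shows "card (star z) = 4 * k"
proof -
  have "card (star z) = (\<Sum>j<4. card (K j z))"
    unfolding star_def using disjK assms finK by (intro card_UN_disjoint) auto
  then show ?thesis using cardK assms by simp
qed

lemma bexp_phi:
  assumes z: "z \<in> Z"
  shows "bexp p (star z) (\<phi> \<sigma> z) = val \<sigma>"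
proof -
  have "(\<Prod>e\<in>star z. 1 - p + p * (if e \<in> K j z then \<sigma> j else 0)) = (1 - p + p * \<sigma> j) ^ k * (1 - p) ^ (3 * k)"
    if j: "j < 4" for j
  proof -
    have sub: "K j z \<subseteq> star z" using j by (auto simp: star_def)
    have c: "card (star z - K j z) = 3 * k"
      using card_star[OF z] cardK[OF j z] sub finK[OF j] by (subst card_Diff_subset) auto
    have "(\<Prod>e\<in>star z. 1 - p + p * (if e \<in> K j z then \<sigma> j else 0)) =
      (\<Prod>e\<in>star z - K j z. 1 - p) * (\<Prod>e\<in>K j z. 1 - p + p * \<sigma> j)"
      by (subst prod.subset_diff[OF sub]) (auto intro!: arg_cong2[where f = "(*)"] prod.cong)
    then show ?thesis by (simp add: c cardK[OF j z] mult.commute)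
  qed
  then show ?thesis
    unfolding \<phi>_def val_def
    by (subst bexp_diff, subst bexp_sum, subst bexp_cmult, subst (1 2) bexp_gen)
      (auto simp: card_star[OF z] intro!: sum.cong)
qed

text \<open>Different \<open>z\<close> have disjoint stars, so the signed count over separated
  configurations splits into equal factors. With all signs 1 it is the probability of
  \<open>separated\<close>.\<close>

lemma bexp_separated:
  "bexp p U (\<lambda>E. of_bool (separated E) * (\<Prod>j<4. \<sigma> j ^ cnt E j)) = val \<sigma> ^ card Z"
proof -
  have "bexp p U (\<lambda>E. of_bool (separated E) * (\<Prod>j<4. \<sigma> j ^ cnt E j)) =
      bexp p U (\<lambda>E. \<Prod>z\<in>Z. \<phi> \<sigma> z (E \<inter> star z))"
  proof (intro bexp_cong)
    fix E assume "E \<subseteq> U"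
    have K: "E \<inter> star z \<inter> K j z = E \<inter> K j z" if "j < 4" for j z
      using that by (auto simp: star_def)
    have "(\<Prod>z\<in>Z. \<phi> \<sigma> z (E \<inter> star z)) =
        (\<Prod>z\<in>Z. of_bool (hit_once E z) * (\<Prod>j<4. \<sigma> j ^ card (E \<inter> K j z)))"
      by (intro prod.cong refl) (simp add: phi_eq hit_once_def K)
    also have "\<dots> = (\<Prod>z\<in>Z. of_bool (hit_once E z)) * (\<Prod>j<4. \<sigma> j ^ cnt E j)"
      by (subst prod.distrib, subst prod.swap) (simp add: cnt_def power_sum)
    also have "(\<Prod>z\<in>Z. of_bool (hit_once E z)) = (of_bool (separated E) :: real)"
      using finZ by (auto simp: separated_def intro!: prod_zero)
    finally show "of_bool (separated E) * (\<Prod>j<4. \<sigma> j ^ cnt E j) = (\<Prod>z\<in>Z. \<phi> \<sigma> z (E \<inter> star z))" ..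
  qed
  also have "\<dots> = (\<Prod>z\<in>Z. bexp p (star z) (\<phi> \<sigma> z))"
    using finZ star_Int by (intro bexp_prod) (auto simp: U_def)
  also have "\<dots> = val \<sigma> ^ card Z" by (simp add: bexp_phi)
  finally show ?thesis .
qed

text \<open>Fourier inversion on a pair of parities: their indicator is the average of four signed
  characters. The trivial one gives \<open>q ^ card Z\<close>, where \<open>q\<close> is the
  probability that a vertex is hit from at most one set; the main loss in \<open>q\<close> is
  \<open>6 * (k * p)\<^sup>2\<close>, one term for each pair of sets. Each of the three others is
  smaller by a factor of at most \<open>exp (- k * p)\<close> per vertex.\<close>

lemma prob_separated_parities:
  assumes kp: "real k * p \<le> 1 / 20"
  shows "prob p U (\<lambda>E. separated E \<and> odd (cnt E 0 + cnt E 2) = a \<and> odd (cnt E 1 + cnt E 3) = b)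
    \<ge> (1 - 6 * (real k * p)\<^sup>2) ^ card Z * (1 - 3 * exp (- (real k * p * card Z))) / 4"
    (is "?pr \<ge> _")
proof -
  define h where "h = (1 - p) ^ k"
  define r where "r = (1 - 2 * p) ^ k"
  define q where "q = 4 * h ^ 3 - 3 * h ^ 4"
  \<comment> \<open>The counts enter only through the sums over indices 0, 2 and over indices 1, 3,
    so each of these pairs shares one sign.\<close>
  define \<sigma> :: "real \<Rightarrow> real \<Rightarrow> nat \<Rightarrow> real" where "\<sigma> \<alpha> \<beta> j = (if even j then \<alpha> else \<beta>)" for \<alpha> \<beta> j
  define Q where "Q \<alpha> \<beta> = bexp p U (\<lambda>E. of_bool (separated E) * (\<Prod>j<4. \<sigma> \<alpha> \<beta> j ^ cnt E j))" for \<alpha> \<beta>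
  have four: "(\<Sum>j<4. f j) = f 0 + f 1 + f 2 + f 3" "(\<Prod>j<4. f j) = f 0 * f 1 * f 2 * f 3" for f :: "nat \<Rightarrow> real"
    by (simp_all add: eval_nat_numeral)
  define c where "c \<alpha> = (1 - p + p * \<alpha>) ^ k" for \<alpha>
  have c1: "c 1 = 1" "c (-1) = r" by (simp_all add: c_def r_def)
  have val: "val (\<sigma> \<alpha> \<beta>) = 2 * h ^ 3 * (c \<alpha> + c \<beta>) - 3 * h ^ 4" for \<alpha> \<beta>
    unfolding val_def four \<sigma>_def c_def h_def by (simp add: algebra_simps flip: power_mult)
  have Q: "Q \<alpha> \<beta> = (2 * h ^ 3 * (c \<alpha> + c \<beta>) - 3 * h ^ 4) ^ card Z" for \<alpha> \<beta>
    unfolding Q_def bexp_separated val ..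
  define sa :: real where "sa = (if a then -1 else 1)"
  define sb :: real where "sb = (if b then -1 else 1)"
  have par: "of_bool (odd x = a) = (1 + sa * (-1) ^ x) / 2" "of_bool (odd x = b) = (1 + sb * (-1) ^ x) / 2" for x :: nat
    by (auto simp: sa_def sb_def)
  have "?pr =
    bexp p U (\<lambda>E. 1 / 4 * (of_bool (separated E) * (\<Prod>j<4. \<sigma> 1 1 j ^ cnt E j)
      + sa * (of_bool (separated E) * (\<Prod>j<4. \<sigma> (-1) 1 j ^ cnt E j))
      + sb * (of_bool (separated E) * (\<Prod>j<4. \<sigma> 1 (-1) j ^ cnt E j))
      + sa * sb * (of_bool (separated E) * (\<Prod>j<4. \<sigma> (-1) (-1) j ^ cnt E j))))"
    by (intro bexp_cong) (simp only: of_bool_conj par four \<sigma>_def, simp add: power_add algebra_simps)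
  also have "\<dots> = 1 / 4 * (Q 1 1 + sa * Q (-1) 1 + sb * Q 1 (-1) + sa * sb * Q (-1) (-1))"
    unfolding Q_def by (simp only: bexp_cmult bexp_add)
  finally have main: "?pr
    = (Q 1 1 + sa * Q (-1) 1 + sb * Q 1 (-1) + sa * sb * Q (-1) (-1)) / 4" by simp
  show ?thesis
  \<comment> \<open>In the degenerate case every character has expectation 1 and the claimed bound
    is negative. Otherwise \<open>k \<ge> 1\<close>, so that \<open>p\<close> itself is at most
    1/20.\<close>
  proof (cases "k = 0 \<or> p = 0")
    case True
    then have "c \<alpha> = 1" "h = 1" for \<alpha> by (auto simp: c_def h_def)
    moreover have "real k * p = 0" using True by auto
    ultimately show ?thesis unfolding main Q by (auto simp: sa_def sb_def)
  next
    case False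
    have p20: "p \<le> 1 / 20"
    proof -
      have "1 * p \<le> real k * p" using False p by (intro mult_right_mono) auto
      then show ?thesis using kp by simp
    qed
    define t where "t = real k * p"
    have t: "0 \<le> t" "t \<le> 1/20" using p kp by (auto simp: t_def)
    have h: "1 - t \<le> h" "h \<le> 1" "0 \<le> h"
      using Bernoulli_inequality[of "-p" k] p by (auto simp: h_def t_def intro: power_le_one)
    have r: "1 - 2 * t \<le> r" using Bernoulli_inequality[of "-2 * p" k] p20 by (simp add: r_def t_def)
    have r': "r \<le> 1 - t"
      using one_minus_power_le_exp[of "2 * p" k] exp_minus_le[of "2 * t"] p20 t
      by (simp add: r_def t_def mult_ac)
    have h3: "1/2 \<le> h ^ 3" "h ^ 3 \<le> 1"
      using power_mono[of "19/20" h 3] h t by (simp add: eval_nat_numeral, simp add: power_le_one)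
    have hh: "h ^ 4 = h ^ 3 * h" by (simp add: eval_nat_numeral)
    have q6: "1 - 6 * t\<^sup>2 \<le> q"
    proof -
      \<comment> \<open>The expansion of \<open>4 * h ^ 3 - 3 * h ^ 4\<close> at
        \<open>h = 1\<close>, which has no linear term.\<close>
      have "q = 1 - 6 * (1 - h)\<^sup>2 + (1 - h) ^ 3 * (5 + 3 * h)"
        unfolding q_def by (simp add: eval_nat_numeral algebra_simps)
      moreover have "(1 - h)\<^sup>2 \<le> t\<^sup>2" using h t by (intro power_mono) auto
      moreover have "0 \<le> (1 - h) ^ 3 * (5 + 3 * h)" using h by (intro mult_nonneg_nonneg) auto
      ultimately show ?thesis by linarith
    qed
    have q1: "q \<le> 1"
    proof -
      have "1 - q = (1 - h)\<^sup>2 * (1 + 2 * h + 3 * h\<^sup>2)"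
        unfolding q_def by (simp add: eval_nat_numeral algebra_simps)
      then show ?thesis using h by (smt (verit) mult_nonneg_nonneg zero_le_power2)
    qed
    have t6: "0 \<le> 1 - 6 * t\<^sup>2" using t power_mono[of t "1/20" 2] by (simp add: power2_eq_square)
    have q0: "0 \<le> q" using q6 t6 by simp
    \<comment> \<open>A sign -1 lowers \<open>c \<alpha> + c \<beta>\<close> from 2 to at most
      \<open>1 + r \<le> 2 - t\<close>, which costs \<open>2 * h ^ 3 * t \<ge> q * t\<close>.
      Nonnegativity is needed to raise the bound to the power \<open>card Z\<close>.\<close>
    have v: "0 \<le> 2 * h ^ 3 * (c \<alpha> + c \<beta>) - 3 * h ^ 4 \<and> 2 * h ^ 3 * (c \<alpha> + c \<beta>) - 3 * h ^ 4 \<le> q * exp (- t)"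
      if ab: "(\<alpha>, \<beta>) \<in> {(-1, 1), (1, -1), (-1, -1)}" for \<alpha> \<beta>
    proof -
      have s: "2 * r \<le> c \<alpha> + c \<beta>" "c \<alpha> + c \<beta> \<le> 1 + r" using ab r' t by (auto simp: c1)
      have "9 / 10 \<le> r" using r t(2) by simp
      then have "3 * h \<le> 2 * (c \<alpha> + c \<beta>)" using s(1) h(2) by (simp add: algebra_simps)
      then have "h ^ 3 * (3 * h) \<le> h ^ 3 * (2 * (c \<alpha> + c \<beta>))" using h(3) by (intro mult_left_mono) auto
      then have 1: "0 \<le> 2 * h ^ 3 * (c \<alpha> + c \<beta>) - 3 * h ^ 4" by (simp add: hh algebra_simps)
      have "2 * h ^ 3 * (c \<alpha> + c \<beta>) \<le> 2 * h ^ 3 * (2 - t)"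
        using s(2) r' h(3) by (intro mult_left_mono) auto
      then have "2 * h ^ 3 * (c \<alpha> + c \<beta>) - 3 * h ^ 4 \<le> q - 2 * h ^ 3 * t" by (simp add: q_def algebra_simps)
      also have "\<dots> \<le> q - q * t"
        using mult_right_mono[of q "2 * h ^ 3" t] q1 h3 t by simp
      also have "\<dots> = q * (1 - t)" by (simp add: algebra_simps)
      also have "\<dots> \<le> q * exp (- t)" using q0 exp_ge_add_one_self[of "- t"] by (intro mult_left_mono) auto
      finally show ?thesis using 1 by simp
    qed
    define B where "B = q ^ card Z * exp (- (t * card Z))"
    have small: "\<bar>Q \<alpha> \<beta>\<bar> \<le> B" if ab: "(\<alpha>, \<beta>) \<in> {(-1, 1), (1, -1), (-1, -1)}" for \<alpha> \<beta>
    proof -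
      have "\<bar>Q \<alpha> \<beta>\<bar> \<le> (q * exp (- t)) ^ card Z"
        unfolding Q using v[OF ab] by (simp add: power_mono)
      also have "\<dots> = B" by (simp add: B_def power_mult_distrib mult.commute flip: exp_of_nat_mult)
      finally show ?thesis .
    qed
    have "\<bar>sa * Q (-1) 1\<bar> \<le> B" "\<bar>sb * Q 1 (-1)\<bar> \<le> B" "\<bar>sa * sb * Q (-1) (-1)\<bar> \<le> B"
      using small by (auto simp: sa_def sb_def abs_mult)
    moreover have "Q 1 1 = q ^ card Z" by (simp add: Q c1 q_def mult.commute)
    ultimately have "q ^ card Z - 3 * B \<le> Q 1 1 + sa * Q (-1) 1 + sb * Q 1 (-1) + sa * sb * Q (-1) (-1)"
      by linarith
    moreover have pr: "0 \<le> ?pr"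
      using p by (intro bexp_nonneg) auto
    moreover have "q ^ card Z - 3 * B = q ^ card Z * (1 - 3 * exp (- (t * card Z)))"
      by (simp add: B_def algebra_simps)
    ultimately have low: "q ^ card Z * (1 - 3 * exp (- (t * card Z))) / 4 \<le>
        ?pr"
      unfolding main by simp
    show ?thesis
    \<comment> \<open>Replacing \<open>q\<close> by its lower bound preserves the inequality if the
      other factor is nonnegative; if not, the claimed bound is at most 0.\<close>
    proof (cases "1 - 3 * exp (- (t * card Z)) \<ge> 0")
      case True
      have "(1 - 6 * t\<^sup>2) ^ card Z * (1 - 3 * exp (- (t * card Z))) / 4 \<le> q ^ card Z * (1 - 3 * exp (- (t * card Z))) / 4"
        using True q6 t6 by (intro divide_right_mono mult_right_mono power_mono) auto
      then show ?thesis using low by (simp add: t_def)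
    next
      case False
      then have "(1 - 6 * t\<^sup>2) ^ card Z * (1 - 3 * exp (- (t * card Z))) / 4 \<le> 0"
        using t6 by (simp add: mult_nonneg_nonpos)
      then show ?thesis using pr by (simp add: t_def)
    qed
  qed
qed

end

subsection \<open>Revealing the remaining edges\<close>

text \<open>Indices 0, 1, 2, 3 of a quadruple stand for \<open>u\<close>, \<open>v\<close>,
  \<open>x\<close>, \<open>y\<close>.\<close>

definition partner :: "nat \<Rightarrow> nat" where
  "partner j = (if j = 0 then 1 else if j = 1 then 0 else if j = 2 then 3 else 2)"

text \<open>What the first exposure must provide, as properties of one fixed edge set:
  \<open>{..<a}\<close> is A, \<open>c i\<close> is the \<open>i\<close>-th quadruple and
  \<open>S i j\<close> the first layer outside A at its \<open>j\<close>-th vertex. The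
  \<open>S i j\<close> are disjoint across all quadruples, as this makes the second-stage events
  independent; the neighbours of the layers inside A have to be disjoint only within one
  quadruple.\<close>

locale first_stage =
  fixes n a m k :: nat and p :: real and E1 :: "nat set set" and c :: "nat \<Rightarrow> nat \<Rightarrow> nat"
    and S :: "nat \<Rightarrow> nat \<Rightarrow> nat set"
  assumes an: "a \<le> n"
    and p: "0 \<le> p" "p \<le> 1"
    and E1: "E1 \<subseteq> touching n {..<a}"
    and c_lt: "\<And>i j. i < m \<Longrightarrow> j < 4 \<Longrightarrow> c i j < a"
    and c_inj: "\<And>i j l. i < m \<Longrightarrow> j < 4 \<Longrightarrow> l < 4 \<Longrightarrow> j \<noteq> l \<Longrightarrow> c i j \<noteq> c i l"
    and nb_A: "\<And>i j. i < m \<Longrightarrow> j < 4 \<Longrightarrow> nb E1 (c i j) \<inter> {..<a} = {c i (partner j)}"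
    and nb_B: "\<And>i j. i < m \<Longrightarrow> j < 4 \<Longrightarrow> nb E1 (c i j) \<inter> {a..<n} = S i j"
    and cardS: "\<And>i j. i < m \<Longrightarrow> j < 4 \<Longrightarrow> card (S i j) = k"
    and disjS: "\<And>i j i' j'. i < m \<Longrightarrow> j < 4 \<Longrightarrow> i' < m \<Longrightarrow> j' < 4 \<Longrightarrow> (i, j) \<noteq> (i', j') \<Longrightarrow>
      S i j \<inter> S i' j' = {}"
    and disjR: "\<And>i j l. i < m \<Longrightarrow> j < 4 \<Longrightarrow> l < 4 \<Longrightarrow> j \<noteq> l \<Longrightarrow>
      (\<Union>w\<in>S i j. nb E1 w) \<inter> (\<Union>w\<in>S i l. nb E1 w) = {}"
begin

definition "N = (\<Union>i<m. \<Union>j<4. S i j)"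
definition "Z = {a..<n} - N"
text \<open>Pairs inside \<open>N\<close> could link different first layers. Requiring all of them
  to be absent sends the second-stage neighbours of \<open>N\<close> into \<open>Z\<close>, and it
  is cheap because \<open>N\<close> has at most \<open>4 * m * k\<close> vertices.\<close>

definition "inner_edges = {e \<in> all_edges n. e \<subseteq> N}"
definition "outer_edges = all_edges n - touching n {..<a}"

abbreviation K :: "nat \<Rightarrow> nat \<Rightarrow> nat \<Rightarrow> nat set set" where
  "K i j z \<equiv> (\<lambda>s. {s, z}) ` S i j"

abbreviation F :: "nat \<Rightarrow> nat set set" where
  "F i \<equiv> four_stars.U (K i) Z"

text \<open>The parities of the second-stage edge counts that make the neighbour degree sums at
  opposite vertices of the \<open>i\<close>-th quadruple differ.\<close>

definition target :: "nat \<Rightarrow> nat \<Rightarrow> nat \<Rightarrow> bool" where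
  "target i j l \<longleftrightarrow> even ((\<Sum>w\<in>S i j. card (nb E1 w)) + (\<Sum>w\<in>S i l. card (nb E1 w)))"

definition good :: "nat \<Rightarrow> nat set set \<Rightarrow> bool" where
  "good i E \<longleftrightarrow> four_stars.separated (K i) Z E \<and>
     odd (four_stars.cnt (K i) Z E 0 + four_stars.cnt (K i) Z E 2) = target i 0 2 \<and>
     odd (four_stars.cnt (K i) Z E 1 + four_stars.cnt (K i) Z E 3) = target i 1 3"

lemma S_sub: "i < m \<Longrightarrow> j < 4 \<Longrightarrow> S i j \<subseteq> {a..<n} \<inter> N"
  using nb_B by (fastforce simp: N_def)

lemma finS: "i < m \<Longrightarrow> j < 4 \<Longrightarrow> finite (S i j)"
  by (rule finite_subset[OF S_sub]) auto

lemma N_sub: "N \<subseteq> {a..<n}"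
  using S_sub unfolding N_def by blast

lemma finN: "finite N"
  by (rule finite_subset[OF N_sub]) simp

lemma cardN: "card N \<le> 4 * m * k"
proof -
  have "card N \<le> (\<Sum>i<m. card (\<Union>j<4. S i j))" unfolding N_def by (rule card_UN_le) simp
  also have "\<dots> \<le> (\<Sum>i<m. 4 * k)"
  proof (rule sum_mono)
    fix i assume "i \<in> {..<m}"
    then have "card (\<Union>j<4. S i j) \<le> (\<Sum>j<(4::nat). k)"
      using card_UN_le[of "{..<4::nat}" "S i"] cardS by simp
    then show "card (\<Union>j<4. S i j) \<le> 4 * k" by simp
  qed
  finally show ?thesis by simp
qed

lemma outer_iff: "{x, y} \<in> outer_edges \<longleftrightarrow> a \<le> x \<and> x < n \<and> a \<le> y \<and> y < n \<and> x \<noteq> y"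
  by (auto simp: outer_edges_def touching_def all_edges_iff)

lemma SZ: "i < m \<Longrightarrow> j < 4 \<Longrightarrow> s \<in> S i j \<Longrightarrow> s \<notin> Z"
  using S_sub by (auto simp: Z_def)

lemma four_stars: "i < m \<Longrightarrow> four_stars (K i) Z k p"
proof
  fix j z :: nat assume i: "i < m" and "j < 4" "z \<in> Z"
  then show "card (K i j z) = k"
    using cardS SZ by (subst card_image) (auto simp: inj_on_def doubleton_eq_iff)
next
  fix j l z z' :: nat assume i: "i < m" and jl: "j < 4" "l < 4" "z \<in> Z" "z' \<in> Z" "(j, z) \<noteq> (l, z')"
  show "K i j z \<inter> K i l z' = {}"
  proof (rule ccontr)
    assume "K i j z \<inter> K i l z' \<noteq> {}"
    then obtain s s' where s: "s \<in> S i j" "s' \<in> S i l" "{s, z} = {s', z'}" by auto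
    then have "s = s'" "z = z'" using SZ[OF i] jl by (auto simp: doubleton_eq_iff)
    then show False using s disjS[OF i jl(1) i jl(2)] jl(5) by auto
  qed
qed (use p finS in \<open>auto simp: Z_def\<close>)

lemma U_eq: "i < m \<Longrightarrow> F i = (\<Union>z\<in>Z. \<Union>j<4. K i j z)"
  using four_stars.U_def[OF four_stars] four_stars.star_def[OF four_stars] by simp

lemma U_sub: "i < m \<Longrightarrow> F i \<subseteq> outer_edges"
  using S_sub SZ unfolding U_eq by (fastforce simp: outer_iff Z_def)

lemma U_disj:
  assumes "i < m" "i' < m" "i \<noteq> i'"
  shows "F i \<inter> F i' = {}"
proof (rule ccontr)
  assume "F i \<inter> F i' \<noteq> {}"
  then obtain s s' z z' j l where s: "z \<in> Z" "z' \<in> Z" "j < 4" "l < 4" "s \<in> S i j" "s' \<in> S i' l" "{s, z} = {s', z'}"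
    using assms unfolding U_eq[OF assms(1)] U_eq[OF assms(2)] by auto
  then have "s = s'" using SZ assms by (auto simp: doubleton_eq_iff)
  then show False using s disjS[OF assms(1) s(3) assms(2) s(4)] assms(3) by auto
qed

lemma U_inner:
  assumes "i < m" shows "inner_edges \<inter> F i = {}"
  unfolding U_eq[OF assms] by (auto simp: inner_edges_def Z_def)

lemma inner_sub: "inner_edges \<subseteq> outer_edges"
  using N_sub by (fastforce simp: inner_edges_def outer_edges_def touching_def)

lemma good_local:
  assumes "i < m" shows "good i (E \<inter> F i) \<longleftrightarrow> good i E"
proof -
  note fs = four_stars[OF assms]
  have "E \<inter> F i \<inter> K i j z = E \<inter> K i j z" if "j < 4" "z \<in> Z" for j z
    using that unfolding U_eq[OF assms] by blast
  then show ?thesis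
    unfolding good_def four_stars.separated_def[OF fs] four_stars.cnt_def[OF fs] four_stars.hit_once_def[OF fs]
    by simp
qed

text \<open>\<open>good i\<close> reads only the pairs in \<open>F i\<close>. These sets are
  disjoint from each other and from \<open>inner_edges\<close>, so the failures of the
  \<open>m\<close> quadruples are exactly independent.\<close>

lemma prob_second_stage:
  assumes g: "\<And>i. i < m \<Longrightarrow> g \<le> prob p (F i) (\<lambda>E. good i E)"
  shows "prob p outer_edges (\<lambda>E. E \<inter> inner_edges = {} \<and> (\<exists>i<m. good i E))
    \<ge> (1 - p) ^ card inner_edges * (1 - (1 - g) ^ m)"
proof -
  let ?U = "\<lambda>i. F i"
  let ?W = "\<Union>i<m. ?U i"
  have fo: "finite outer_edges" by (simp add: outer_edges_def)
  have fW: "finite ?W" using U_sub by (intro finite_subset[OF _ fo]) auto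
  have "prob p outer_edges (\<lambda>E. E \<inter> inner_edges = {} \<and> (\<exists>i<m. good i E)) =
    bexp p outer_edges (\<lambda>E. of_bool (E \<inter> inner_edges = {}) * (1 - (\<Prod>i<m. 1 - of_bool (good i (E \<inter> ?W \<inter> ?U i)))))"
  proof (intro bexp_cong)
    fix E
    have W: "E \<inter> ?W \<inter> ?U i = E \<inter> ?U i" if "i < m" for i using that by auto
    have "(\<Prod>i<m. 1 - of_bool (good i (E \<inter> ?W \<inter> ?U i))) = (\<Prod>i<m. 1 - of_bool (good i E) :: real)"
      by (intro prod.cong refl) (simp add: W good_local)
    also have "\<dots> = of_bool (\<not> (\<exists>i<m. good i E))" by (auto intro!: prod_zero)
    finally show "of_bool (E \<inter> inner_edges = {} \<and> (\<exists>i<m. good i E)) =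
      of_bool (E \<inter> inner_edges = {}) * (1 - (\<Prod>i<m. 1 - of_bool (good i (E \<inter> ?W \<inter> ?U i))) :: real)" by simp
  qed
  also have "\<dots> = prob p inner_edges (\<lambda>E. E = {}) *
      bexp p ?W (\<lambda>E. 1 - (\<Prod>i<m. 1 - of_bool (good i (E \<inter> ?U i))))"
    using U_sub U_inner inner_sub fo
    by (intro bexp_indep[where f = "\<lambda>E. of_bool (E = {})" and g = "\<lambda>E. 1 - (\<Prod>i<m. 1 - of_bool (good i (E \<inter> ?U i)))"])
       blast+
  also have "prob p inner_edges (\<lambda>E. E = {}) = (1 - p) ^ card inner_edges"
  proof -
    have "finite inner_edges" using inner_sub fo finite_subset by blast
    moreover have "prob p inner_edges (\<lambda>E. E = {}) = prob p inner_edges (\<lambda>E. E \<inter> inner_edges = {})"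
      by (intro bexp_cong) (simp add: Int_absorb2)
    ultimately show ?thesis using bexp_eq_set[of inner_edges inner_edges "{}" p] by simp
  qed
  also have "bexp p ?W (\<lambda>E. 1 - (\<Prod>i<m. 1 - of_bool (good i (E \<inter> ?U i)))) =
     1 - (\<Prod>i<m. bexp p (?U i) (\<lambda>E. 1 - of_bool (good i E)))"
  proof -
    have "bexp p ?W (\<lambda>E. \<Prod>i<m. 1 - of_bool (good i (E \<inter> ?U i))) = (\<Prod>i<m. bexp p (?U i) (\<lambda>E. 1 - of_bool (good i E)))"
      using U_disj fW by (intro bexp_prod) auto
    then show ?thesis using fW by (simp add: bexp_diff)
  qed
  also have "(1 - p) ^ card inner_edges * (1 - (\<Prod>i<m. bexp p (?U i) (\<lambda>E. 1 - of_bool (good i E)))) \<ge>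
      (1 - p) ^ card inner_edges * (1 - (1 - g) ^ m)"
  proof (intro mult_left_mono diff_left_mono)
    have "(\<Prod>i<m. bexp p (?U i) (\<lambda>E. 1 - of_bool (good i E))) \<le> (\<Prod>i<m. 1 - g)"
    proof (intro prod_mono conjI)
      fix i assume "i \<in> {..<m}"
      then have i: "i < m" by simp
      show "0 \<le> bexp p (?U i) (\<lambda>E. 1 - of_bool (good i E))" using p by (intro bexp_nonneg) auto
      have "finite (?U i)" using U_sub[OF i] fo finite_subset by blast
      then show "bexp p (?U i) (\<lambda>E. 1 - of_bool (good i E)) \<le> 1 - g" using g[OF i] by (simp add: bexp_diff)
    qed
    then show "(\<Prod>i<m. bexp p (?U i) (\<lambda>E. 1 - of_bool (good i E))) \<le> (1 - g) ^ m" by simp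
  qed (use p in auto)
  finally show ?thesis by simp
qed

text \<open>Each 2-ball splits into a part \<open>R j\<close> in A, the first layer
  \<open>S i j\<close> in \<open>N\<close> and a part \<open>Y j\<close> in \<open>Z\<close>. These
  regions are disjoint, so overlaps are excluded region by region: by the first stage in A and
  \<open>N\<close>, by \<open>hit_once\<close> in \<open>Z\<close>.\<close>

lemma second_stage_not_reconstructible:
  assumes E2: "E2 \<subseteq> outer_edges" "E2 \<inter> inner_edges = {}" and i: "i < m" "good i E2"
  shows "\<not> reconstructible 2 n (E1 \<union> E2)"
proof -
  define E where "E = E1 \<union> E2"
  note fs = four_stars[OF i(1)]
  have gE: "is_graph n E" using E1 E2(1) by (auto simp: E_def is_graph_def touching_def outer_edges_def)
  have gE2: "is_graph n E2" using E2(1) by (auto simp: is_graph_def outer_edges_def)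
  have gE1: "is_graph n E1" using E1 by (auto simp: is_graph_def touching_def)
  have nbE: "nb E w = nb E1 w \<union> nb E2 w" for w by (auto simp: E_def nb_def)
  have nb2A: "nb E2 w = {}" if "w < a" for w
  proof -
    have "{w, z} \<notin> E2" for z using E2(1) that outer_iff[of w z] by auto
    then show ?thesis by (simp add: nb_def)
  qed
  have nb1B: "nb E1 w \<subseteq> {..<a}" if "a \<le> w" for w
  proof
    fix z assume "z \<in> nb E1 w"
    then have "{w, z} \<in> touching n {..<a}" using E1 by (auto simp: nb_def)
    then show "z \<in> {..<a}" using that by (auto simp: touching_def)
  qed
  have nb2Z: "nb E2 w \<subseteq> Z" if w: "w \<in> S i j" "j < 4" for w j
  proof
    fix z assume "z \<in> nb E2 w"
    then have z: "{w, z} \<in> E2" "w \<noteq> z" by (auto simp: nb_def)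
    then have "{w, z} \<in> outer_edges" using E2(1) by auto
    then have zr: "a \<le> z" "z < n" "w < n" by (auto simp: outer_iff)
    have "z \<notin> N"
    proof
      assume "z \<in> N"
      moreover have "w \<in> N" using S_sub[OF i(1) w(2)] w(1) by auto
      ultimately have "{w, z} \<in> inner_edges" using zr z(2) by (auto simp: inner_edges_def all_edges_iff)
      then show False using E2(2) z(1) by auto
    qed
    then show "z \<in> Z" using zr by (simp add: Z_def)
  qed
  have nbEc: "nb E (c i j) = insert (c i (partner j)) (S i j)" "c i (partner j) \<notin> S i j" if j: "j < 4" for j
  proof -
    have "nb E1 (c i j) \<subseteq> {..<a} \<union> {a..<n}" using nb_subset[OF gE1] by fastforce
    then show "nb E (c i j) = insert (c i (partner j)) (S i j)"
      using nb_A[OF i(1) j] nb_B[OF i(1) j] nb2A[OF c_lt[OF i(1) j]] unfolding nbE by blast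
    have "partner j < 4" by (simp add: partner_def)
    then show "c i (partner j) \<notin> S i j" using S_sub[OF i(1) j] c_lt[OF i(1), of "partner j"] by auto
  qed
  define E0 where "E0 = E - {{c i 0, c i 1}, {c i 2, c i 3}}"
  have nb0A: "nb E0 (c i j) = S i j" if j: "j < 4" for j
  proof -
    have ne: "c i j' \<noteq> c i l" if "j' < 4" "l < 4" "j' \<noteq> l" for j' l using c_inj[OF i(1)] that by auto
    from j consider "j = 0" | "j = 1" | "j = 2" | "j = 3" by linarith
    then show ?thesis
      unfolding E0_def nb_Diff2 nbEc(1)[OF j] using nbEc(2)[OF j] ne[of 0] ne[of 1] ne[of 2] ne[of 3] by cases (simp_all add: partner_def)
  qed
  have nb0B: "nb E0 w = nb E1 w \<union> nb E2 w" "w \<noteq> c i j" if w: "a \<le> w" and j: "j < 4" for w j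
  proof -
    have ne: "w \<noteq> c i l" if "l < 4" for l using w c_lt[OF i(1) that] by auto
    then show "nb E0 w = nb E1 w \<union> nb E2 w" using ne[of 0] ne[of 1] ne[of 2] ne[of 3]
      by (simp add: E0_def nb_Diff2 nbE)
    show "w \<noteq> c i j" using ne[OF j] .
  qed
  define R where "R j = insert (c i j) (\<Union>w\<in>S i j. nb E1 w)" for j
  define Y where "Y j = (\<Union>w\<in>S i j. nb E2 w)" for j
  have Sge: "a \<le> w" "w \<in> N" "w < n" if "w \<in> S i j" "j < 4" for w j
    using S_sub[OF i(1) that(2)] that(1) by auto
  have ball: "ball2 E0 (c i j) = R j \<union> S i j \<union> Y j" if j: "j < 4" for j
  proof -
    have "(\<Union>w\<in>S i j. nb E0 w) = (\<Union>w\<in>S i j. nb E1 w \<union> nb E2 w)"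
      by (intro SUP_cong refl nb0B(1)[OF Sge(1)[OF _ j] j])
    then show ?thesis unfolding ball2_def nb0A[OF j] R_def Y_def by (auto simp: UN_Un_distrib)
  qed
  have RA: "R j \<subseteq> {..<a}" if j: "j < 4" for j
  proof -
    have "(\<Union>w\<in>S i j. nb E1 w) \<subseteq> {..<a}" by (intro UN_least nb1B) (rule Sge(1)[OF _ j])
    then show ?thesis using c_lt[OF i(1) j] by (simp add: R_def)
  qed
  have YZ: "Y j \<subseteq> Z" if j: "j < 4" for j
    unfolding Y_def by (rule UN_least) (rule nb2Z[OF _ j])
  have finZ: "finite Z" by (simp add: Z_def)
  have ZB: "Z \<subseteq> {a..<n}" by (auto simp: Z_def)
  have RR: "R j \<inter> R l = {}" if jl: "j < 4" "l < 4" "j \<noteq> l" for j l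
  proof -
    have cR: "c i j \<notin> (\<Union>w\<in>S i l. nb E1 w)" if jl: "j < 4" "l < 4" "j \<noteq> l" for j l
    proof
      assume "c i j \<in> (\<Union>w\<in>S i l. nb E1 w)"
      then obtain w where w: "w \<in> S i l" "c i j \<in> nb E1 w" by blast
      then have "w \<in> nb E1 (c i j) \<inter> {a..<n}"
        using nb_sym[of "c i j" E1 w] Sge[OF w(1) jl(2)] by simp
      then have "w \<in> S i j" using nb_B[OF i(1) jl(1)] by simp
      moreover have "S i j \<inter> S i l = {}" using disjS[OF i(1) jl(1) i(1) jl(2)] jl(3) by simp
      ultimately show False using w(1) by blast
    qed
    show ?thesis
      unfolding R_def using cR[OF jl] cR[OF jl(2,1) jl(3)[symmetric]] disjR[OF i(1) jl] c_inj[OF i(1) jl]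
      by (simp add: Int_insert_left Int_insert_right)
  qed
  have SS: "S i j \<inter> S i l = {}" if "j < 4" "l < 4" "j \<noteq> l" for j l
    using disjS[OF i(1) that(1) i(1) that(2)] that(3) by simp
  have YY: "Y j \<inter> Y l = {}" if jl: "j < 4" "l < 4" "j \<noteq> l" for j l
  proof (rule ccontr)
    assume "Y j \<inter> Y l \<noteq> {}"
    then obtain z w w' where w: "w \<in> S i j" "w' \<in> S i l" "z \<in> nb E2 w" "z \<in> nb E2 w'"
      by (auto simp: Y_def)
    then have "z \<in> Z" using YZ[OF jl(1)] by (auto simp: Y_def)
    then have "four_stars.hit_once (K i) E2 z"
      using i(2) by (auto simp: good_def four_stars.separated_def[OF fs])
    moreover have "{w, z} \<in> E2 \<inter> K i j z" "{w', z} \<in> E2 \<inter> K i l z" using w by (auto simp: nb_def)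
    ultimately show False using jl unfolding four_stars.hit_once_def[OF fs] by blast
  qed
  have disj: "ball2 E0 (c i j) \<inter> ball2 E0 (c i l) = {}" if jl: "j < 4" "l < 4" "j \<noteq> l" for j l
  proof -
    have "S i j \<subseteq> {a..<n} - Z" "S i l \<subseteq> {a..<n} - Z"
      using Sge[OF _ jl(1)] Sge[OF _ jl(2)] by (auto simp: Z_def)
    moreover have "{..<a} \<inter> {a..<n} = {}" by auto
    ultimately show ?thesis
      unfolding ball[OF jl(1)] ball[OF jl(2)]
      using RA[OF jl(1)] RA[OF jl(2)] YZ[OF jl(1)] YZ[OF jl(2)] RR[OF jl] SS[OF jl] YY[OF jl] ZB by blast
  qed
  have part: "{c i 0, c i 1} \<in> E" "{c i 2, c i 3} \<in> E"
    using nb_A[OF i(1), of 0] nb_A[OF i(1), of 2] by (auto simp: partner_def nb_def E_def)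
  have sw: "edge_switch n E0 (c i 0) (c i 1) (c i 2) (c i 3)"
  proof
    show "is_graph n E0" using gE by (auto simp: E0_def is_graph_def)
    have "c i j < n" if "j < 4" for j using c_lt[OF i(1) that] an by simp
    then show "c i 0 < n" "c i 1 < n" "c i 2 < n" "c i 3 < n" by simp_all
    show "card (nb E0 (c i 0)) = card (nb E0 (c i 2))" "card (nb E0 (c i 1)) = card (nb E0 (c i 3))"
      using cardS[OF i(1)] by (simp_all add: nb0A)
    fix s \<alpha> \<beta> assume "s \<in> {c i 0, c i 1, c i 2, c i 3}" and ab: "\<alpha> \<in> nb E0 s" "\<beta> \<in> nb E0 s"
    then have "s = c i 0 \<or> s = c i 1 \<or> s = c i 2 \<or> s = c i 3" by blast
    then obtain j where j: "j < 4" "s = c i j"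
      by (auto intro: that[of 0] that[of 1] that[of 2] that[of 3])
    then have ab': "\<alpha> \<in> S i j" "\<beta> \<in> S i j" using ab nb0A by auto
    have "\<beta> \<notin> nb E1 \<alpha>" using nb1B[OF Sge(1)[OF ab'(1) j(1)]] Sge(1)[OF ab'(2) j(1)] by auto
    moreover have "\<beta> \<notin> nb E2 \<alpha>" using nb2Z[OF ab'(1) j(1)] SZ[OF i(1) j(1) ab'(2)] by auto
    ultimately show "\<beta> \<notin> nb E0 \<alpha>" using nb0B(1)[OF Sge(1)[OF ab'(1) j(1)] j(1)] by auto
  qed (simp_all add: disj)
  have degc: "card (nb E (c i j)) = Suc k" if "j < 4" for j
    using nbEc[OF that] finS[OF i(1) that] cardS[OF i(1) that] by simp
  have cnt: "(\<Sum>w\<in>S i j. card (nb E2 w)) = four_stars.cnt (K i) Z E2 j" if j: "j < 4" for j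
  proof -
    have "(\<Sum>w\<in>S i j. card (nb E2 w)) = (\<Sum>w\<in>S i j. \<Sum>z\<in>Z. of_bool ({w, z} \<in> E2))"
    proof (intro sum.cong refl)
      fix w assume w: "w \<in> S i j"
      have "nb E2 w = {z\<in>Z. {w, z} \<in> E2}"
        using nb2Z[OF w j] SZ[OF i(1) j w] by (auto simp: nb_def)
      then show "card (nb E2 w) = (\<Sum>z\<in>Z. of_bool ({w, z} \<in> E2))"
        using finZ by (simp add: Collect_conj_eq)
    qed
    also have "\<dots> = (\<Sum>z\<in>Z. \<Sum>w\<in>S i j. of_bool ({w, z} \<in> E2))" by (rule sum.swap)
    also have "\<dots> = (\<Sum>z\<in>Z. card (E2 \<inter> K i j z))"
    proof (intro sum.cong refl)
      fix z assume z: "z \<in> Z"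
      have "E2 \<inter> K i j z = (\<lambda>w. {w, z}) ` {w\<in>S i j. {w, z} \<in> E2}" by auto
      moreover have "inj_on (\<lambda>w. {w, z}) {w\<in>S i j. {w, z} \<in> E2}"
        using SZ[OF i(1) j] z by (auto simp: inj_on_def doubleton_eq_iff)
      ultimately have "card (E2 \<inter> K i j z) = card {w\<in>S i j. {w, z} \<in> E2}" by (simp add: card_image)
      then show "(\<Sum>w\<in>S i j. of_bool ({w, z} \<in> E2)) = card (E2 \<inter> K i j z)"
        using finS[OF i(1) j] by (simp add: Collect_conj_eq)
    qed
    finally show ?thesis by (simp add: four_stars.cnt_def[OF fs])
  qed
  \<comment> \<open>The partner has degree \<open>Suc k\<close>; a vertex of \<open>S i j\<close>
    contributes its first-stage neighbours in A and its second-stage neighbours in \<open>Z\<close>.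
    Only the latter depend on \<open>E2\<close>.\<close>
  have degsum: "nbdegsum E (c i j) = Suc k + (\<Sum>w\<in>S i j. card (nb E1 w)) + four_stars.cnt (K i) Z E2 j"
    if j: "j < 4" for j
  proof -
    have pj: "partner j < 4" by (simp add: partner_def)
    have "card (nb E w) = card (nb E1 w) + card (nb E2 w)" if w: "w \<in> S i j" for w
    proof -
      have "nb E1 w \<inter> nb E2 w = {}"
        using nb1B[OF Sge(1)[OF w j]] nb2Z[OF w j] ZB by fastforce
      then show ?thesis
        unfolding nbE using finite_nb[OF gE1] finite_nb[OF gE2] by (intro card_Un_disjoint)
    qed
    then have "(\<Sum>w\<in>S i j. card (nb E w)) = (\<Sum>w\<in>S i j. card (nb E1 w)) + (\<Sum>w\<in>S i j. card (nb E2 w))"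
      by (simp add: sum.distrib)
    then show ?thesis
      unfolding nbdegsum_def nbEc(1)[OF j]
      using nbEc(2)[OF j] finS[OF i(1) j] by (simp add: degc[OF pj] cnt[OF j])
  qed
  \<comment> \<open>Equal degree sums would have an even total, which the parity condition in
    \<open>good\<close> excludes.\<close>
  have neq: "nbdegsum E (c i j) \<noteq> nbdegsum E (c i l)"
    if jl: "j < 4" "l < 4" "odd (four_stars.cnt (K i) Z E2 j + four_stars.cnt (K i) Z E2 l) = target i j l" for j l
  proof
    assume "nbdegsum E (c i j) = nbdegsum E (c i l)"
    then have "even (nbdegsum E (c i j) + nbdegsum E (c i l))" by simp
    then show False using jl(3) unfolding degsum[OF jl(1)] degsum[OF jl(2)] target_def by auto
  qed
  show ?thesis
    using not_reconstructibleI[OF gE part sw[unfolded E0_def] neq neq] i(2)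
    unfolding good_def E_def by simp
qed

end

subsection \<open>Revealing the edges at a small vertex set\<close>

definition binom_prob :: "nat \<Rightarrow> nat \<Rightarrow> real \<Rightarrow> real" where
  "binom_prob b k p = prob p {..<b} (\<lambda>E. card E = k)"

lemma bexp_reindex:
  assumes "inj_on f U"
  shows "bexp p (f ` U) g = bexp p U (\<lambda>E. g (f ` E))"
  unfolding bexp_def
proof (rule sum.reindex_bij_witness[of _ "\<lambda>E. f ` E" "\<lambda>E. U \<inter> f -` E"], goal_cases)
  case (5 E)
  have e: "f ` (U \<inter> f -` E) = E" using 5 by auto
  have i: "inj_on f (U \<inter> f -` E)" using assms by (rule inj_on_subset) auto
  have c1: "card (U \<inter> f -` E) = card E" using card_image[OF i] e by simp
  have "f ` (U - U \<inter> f -` E) = f ` U - E" by auto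
  moreover have "inj_on f (U - U \<inter> f -` E)" using assms by (rule inj_on_subset) auto
  ultimately have c2: "card (U - U \<inter> f -` E) = card (f ` U - E)" using card_image by metis
  show ?case using e c1 c2 by simp
qed (use assms in \<open>auto simp: inj_on_def\<close>)

lemma prob_card_eq:
  assumes "finite W"
  shows "prob p W (\<lambda>E. card E = k) = binom_prob (card W) k p"
proof -
  obtain f where f: "bij_betw f {..<card W} W"
    using assms by (metis card_lessThan finite_lessThan finite_same_card_bij)
  then have W: "W = f ` {..<card W}" and inj: "inj_on f {..<card W}" by (auto simp: bij_betw_def)
  have "prob p W (\<lambda>E. card E = k) = prob p {..<card W} (\<lambda>E. card (f ` E) = k)"
    by (subst W, subst bexp_reindex[OF inj]) simp
  also have "\<dots> = binom_prob (card W) k p"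
    unfolding binom_prob_def using card_image[OF inj_on_subset[OF inj]]
    by (intro bexp_cong) auto
  finally show ?thesis .
qed

lemma binom_prob_eq: "binom_prob b k p = real (b choose k) * p ^ k * (1 - p) ^ (b - k)"
proof -
  have "binom_prob b k p = (\<Sum>E\<in>{E \<in> Pow {..<b}. card E = k}. p ^ card E * (1 - p) ^ card ({..<b} - E))"
    unfolding binom_prob_def bexp_def by (intro sum.mono_neutral_cong_right) auto
  also have "\<dots> = (\<Sum>E\<in>{E \<in> Pow {..<b}. card E = k}. p ^ k * (1 - p) ^ (b - k))"
    by (intro sum.cong refl) (auto simp: card_Diff_subset finite_subset)
  also have "\<dots> = real (b choose k) * p ^ k * (1 - p) ^ (b - k)"
    using n_subsets[of "{..<b}" k] by (simp add: Pow_def)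
  finally show ?thesis .
qed

text \<open>Given its size, \<open>E\<close> is a uniformly random \<open>k\<close>-subset and
  contains a fixed element with probability \<open>k / card W\<close>. The computation splits off
  the element and uses the absorption identity for binomial coefficients.\<close>

lemma prob_card_eq_member:
  assumes "finite W" "e \<in> W"
  shows "prob p W (\<lambda>E. card E = k \<and> e \<in> E) = real k / card W * binom_prob (card W) k p"
proof (cases k)
  case 0
  then have "prob p W (\<lambda>E. card E = k \<and> e \<in> E) = bexp p W (\<lambda>_. 0)"
    using assms(1) by (intro bexp_cong) (auto dest: finite_subset)
  then show ?thesis using 0 assms by simp
next
  case (Suc l)
  define b where "b = card (W - {e})"
  have cW: "card W = Suc b" unfolding b_def by (rule card_Suc_Diff1[OF assms, symmetric])
  have W: "W = {e} \<union> (W - {e})" using assms by auto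
  have "prob p W (\<lambda>E. card E = k \<and> e \<in> E) =
    bexp p {e} (\<lambda>E1. prob p (W - {e}) (\<lambda>E2. card (E1 \<union> E2) = k \<and> e \<in> E1 \<union> E2))"
    by (subst W, subst bexp_union) (use assms in auto)
  also have "\<dots> = bexp p {e} (\<lambda>E1. of_bool (e \<in> E1) * binom_prob b l p)"
  proof (intro bexp_cong)
    fix E1 assume "E1 \<subseteq> {e}"
    then consider "E1 = {}" | "E1 = {e}" by blast
    then show "prob p (W - {e}) (\<lambda>E2. card (E1 \<union> E2) = k \<and> e \<in> E1 \<union> E2) = of_bool (e \<in> E1) * binom_prob b l p"
    proof cases
      case 1
      then have "prob p (W - {e}) (\<lambda>E2. card (E1 \<union> E2) = k \<and> e \<in> E1 \<union> E2) = bexp p (W - {e}) (\<lambda>E2. 0)"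
        by (intro bexp_cong) auto
      then show ?thesis using 1 assms by simp
    next
      case 2
      have "prob p (W - {e}) (\<lambda>E2. card (E1 \<union> E2) = k \<and> e \<in> E1 \<union> E2) =
        prob p (W - {e}) (\<lambda>E2. card E2 = l)"
      proof (intro bexp_cong)
        fix E2 assume E2: "E2 \<subseteq> W - {e}"
        then have "finite E2" "e \<notin> E2" using assms finite_subset by auto
        then show "of_bool (card (E1 \<union> E2) = k \<and> e \<in> E1 \<union> E2) = (of_bool (card E2 = l) :: real)"
          using 2 Suc by simp
      qed
      then show ?thesis using 2 assms by (simp add: prob_card_eq b_def)
    qed
  qed
  also have "\<dots> = p * binom_prob b l p"
    by (simp add: bexp_def Pow_insert)
  also have "\<dots> = real k / card W * binom_prob (card W) k p"
  proof -
    have "real (Suc b) * real (b choose l) = real k * real (Suc b choose k)"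
      using Suc_times_binomial[of l b] unfolding Suc by (metis of_nat_mult)
    then have "real (b choose l) = real k * real (Suc b choose k) / real (Suc b)"
      by (simp add: field_simps)
    then show ?thesis unfolding binom_prob_eq cW Suc by (simp del: binomial_Suc_Suc add: mult_ac)
  qed
  finally show ?thesis .
qed

lemma double_add_eq:
  fixes i i' x y :: nat
  assumes "2 * i + x = 2 * i' + y" "x < 2" "y < 2"
  shows "i = i' \<and> x = y"
  using assms by presburger

lemma div2_eq_parity:
  fixes j j' :: nat
  assumes "j div 2 = j' div 2" "j \<noteq> j'"
  shows "even j \<noteq> even j'"
  using assms by (cases "even j"; cases "even j'") (auto elim!: evenE oddE)

text \<open>\<open>P\<close> lists the possible edges \<open>uv\<close> inside A, with ends in
  different halves of A so that each unordered pair occurs once. It is an arbitrary set of such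
  pairs because its size is adjusted later to a desired expectation.\<close>

locale stage_one =
  fixes n \<alpha> k :: nat and p :: real and P :: "(nat \<times> nat) set"
  assumes an: "2 * \<alpha> < n"
    and p: "0 < p" "p < 1"
    and P: "P \<subseteq> {..<\<alpha>} \<times> {\<alpha>..<2*\<alpha>}"
begin

definition "inA = {e \<in> all_edges n. e \<subseteq> {..<2*\<alpha>}}"
definition "touchA W = {e \<in> inA. e \<inter> W \<noteq> {}}"
definition "star x = (\<lambda>w. {x, w}) ` {2*\<alpha>..<n}"
definition "U = touching n {..<2*\<alpha>}"
definition "b = n - 2 * \<alpha>"
definition "\<pi> = binom_prob b k p"
definition V :: "nat \<times> nat \<Rightarrow> nat set" where "V t = {fst t, snd t}"

definition cand :: "nat set set \<Rightarrow> nat \<times> nat \<Rightarrow> bool" where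
  "cand E t \<longleftrightarrow> E \<inter> touchA (V t) = {V t} \<and> (\<forall>c\<in>V t. card (E \<inter> star c) = k)"

lemma finite_U [simp]: "finite U" by (simp add: U_def)
lemma finite_star [simp]: "finite (star x)" by (simp add: star_def)
lemma finite_inA [simp]: "finite inA" by (simp add: inA_def)
lemma finite_touchA [simp]: "finite (touchA W)" by (simp add: touchA_def)

lemma touchA_sub: "touchA W \<subseteq> inA" by (auto simp: touchA_def)

lemma inA_sub: "inA \<subseteq> U"
proof
  fix e assume e: "e \<in> inA"
  then have "e \<noteq> {}" by (auto simp: inA_def all_edges_def)
  then show "e \<in> U" using e by (auto simp: inA_def U_def touching_def)
qed

lemma star_sub: "x < 2*\<alpha> \<Longrightarrow> star x \<subseteq> U"
  by (auto simp: star_def U_def touching_def all_edges_iff)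

lemma star_inA: "star x \<inter> inA = {}"
  by (auto simp: star_def inA_def)

lemma star_disj: "x < 2*\<alpha> \<Longrightarrow> y < 2*\<alpha> \<Longrightarrow> x \<noteq> y \<Longrightarrow> star x \<inter> star y = {}"
  by (auto simp: star_def doubleton_eq_iff)

lemma card_star: "x < 2*\<alpha> \<Longrightarrow> card (star x) = b"
  unfolding star_def b_def by (subst card_image) (auto simp: inj_on_def doubleton_eq_iff)

lemma b_pos: "b > 0" using an by (simp add: b_def)

text \<open>The pairs inside A and the stars of distinct vertices towards the outside are disjoint
  blocks, so a first-stage event that constrains them separately has a product probability.\<close>

lemma bexp_stars:
  assumes "C \<subseteq> {..<2*\<alpha>}" "W \<subseteq> inA"
  shows "bexp p U (\<lambda>E. f (E \<inter> W) * (\<Prod>c\<in>C. g c (E \<inter> star c))) =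
    bexp p W f * (\<Prod>c\<in>C. bexp p (star c) (g c))"
proof -
  have fC: "finite C" using assms(1) finite_subset by blast
  let ?S = "\<Union>c\<in>C. star c"
  have fS: "finite ?S" using fC by simp
  have "bexp p U (\<lambda>E. f (E \<inter> W) * (\<Prod>c\<in>C. g c (E \<inter> star c))) =
    bexp p U (\<lambda>E. f (E \<inter> W) * (\<Prod>c\<in>C. g c (E \<inter> ?S \<inter> star c)))"
    by (intro bexp_cong arg_cong2[where f = "(*)"] prod.cong refl arg_cong[where f = "g _"]) auto
  also have "\<dots> = bexp p W f * bexp p ?S (\<lambda>E. \<Prod>c\<in>C. g c (E \<inter> star c))"
  proof (intro bexp_indep[where f = f and g = "\<lambda>E. \<Prod>c\<in>C. g c (E \<inter> star c)"])
    show "W \<subseteq> U" using assms(2) inA_sub by blast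
    show "?S \<subseteq> U" using star_sub assms(1) by blast
    show "W \<inter> ?S = {}" using star_inA assms(2) by blast
  qed simp
  also have "bexp p ?S (\<lambda>E. \<Prod>c\<in>C. g c (E \<inter> star c)) = (\<Prod>c\<in>C. bexp p (star c) (g c))"
    using fC fS star_disj assms(1) by (intro bexp_prod) auto
  finally show ?thesis .
qed

lemma V_props:
  assumes "t \<in> P"
  shows "V t \<subseteq> {..<2*\<alpha>}" "card (V t) = 2" "finite (V t)" "V t \<in> touchA (V t)"
  using assms P an by (auto simp: V_def touchA_def inA_def all_edges_iff)

lemma P_bounds: "t \<in> P \<Longrightarrow> fst t < \<alpha>" "t \<in> P \<Longrightarrow> \<alpha> \<le> snd t"
  using P by auto

lemma V_inj:
  assumes "s \<in> P" "t \<in> P" "V s = V t" shows "s = t"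
proof -
  have "fst s < \<alpha>" "\<alpha> \<le> snd s" "fst t < \<alpha>" "\<alpha> \<le> snd t" using assms(1,2) P by auto
  then show ?thesis using assms(3) by (auto simp: V_def doubleton_eq_iff prod_eq_iff)
qed

lemma prob_card_star: "c < 2*\<alpha> \<Longrightarrow> prob p (star c) (\<lambda>E. card E = k) = \<pi>"
  by (simp add: prob_card_eq card_star \<pi>_def)

lemma prob_cand:
  assumes t: "t \<in> P"
  shows "prob p U (\<lambda>E. cand E t) = p * (1 - p) ^ (card (touchA (V t)) - 1) * \<pi>\<^sup>2"
proof -
  note Vp = V_props[OF t]
  have "prob p U (\<lambda>E. cand E t) =
    bexp p U (\<lambda>E. of_bool (E \<inter> touchA (V t) = {V t}) * (\<Prod>c\<in>V t. of_bool (card (E \<inter> star c) = k)))"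
    using Vp(3) by (intro bexp_cong) (auto simp: cand_def intro!: prod_zero)
  also have "\<dots> = bexp p (touchA (V t)) (\<lambda>E. of_bool (E = {V t})) * (\<Prod>c\<in>V t. prob p (star c) (\<lambda>E. card E = k))"
    by (rule bexp_stars[OF Vp(1) touchA_sub, where f = "\<lambda>E. of_bool (E = {V t})" and g = "\<lambda>c E. of_bool (card E = k)"])
  also have "bexp p (touchA (V t)) (\<lambda>E. of_bool (E = {V t})) = p * (1 - p) ^ (card (touchA (V t)) - 1)"
  proof -
    have "bexp p (touchA (V t)) (\<lambda>E. of_bool (E = {V t})) = bexp p (touchA (V t)) (\<lambda>E. of_bool (E \<inter> touchA (V t) = {V t}))"
      by (intro bexp_cong) (simp add: Int_absorb2)
    then show ?thesis using bexp_eq_set[of "touchA (V t)" "touchA (V t)" "{V t}" p] Vp(4) by simp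
  qed
  also have "(\<Prod>c\<in>V t. prob p (star c) (\<lambda>E. card E = k)) = (\<Prod>c\<in>V t. \<pi>)"
    using Vp(1) by (intro prod.cong refl prob_card_star) auto
  also have "\<dots> = \<pi>\<^sup>2" using Vp(2) by simp
  finally show ?thesis .
qed

lemma cand_disjoint:
  assumes "cand E s" "cand E t" "s \<in> P" "t \<in> P" "s \<noteq> t"
  shows "V s \<inter> V t = {}"
proof (rule ccontr)
  assume ne: "V s \<inter> V t \<noteq> {}"
  have "V t \<in> E \<inter> touchA (V t)" using assms(2) by (simp add: cand_def)
  then have "V t \<in> E \<inter> touchA (V s)" using ne by (auto simp: touchA_def)
  moreover have "E \<inter> touchA (V s) = {V s}" using assms(1) by (simp add: cand_def)
  ultimately have "V t = V s" by blast
  then show False using V_inj assms(3-5) by metis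
qed

text \<open>Overlaps are estimated relative to the event that both pairs are candidates. This factor
  occurs on both sides of that comparison and can stay unevaluated there.\<close>

definition joint :: "nat \<times> nat \<Rightarrow> nat \<times> nat \<Rightarrow> real" where
  "joint s t = bexp p (touchA (V s) \<union> touchA (V t)) (\<lambda>E. of_bool (E = {V s, V t}))"

lemma cand2_iff:
  assumes "s \<in> P" "t \<in> P" "V s \<inter> V t = {}"
  shows "cand E s \<and> cand E t \<longleftrightarrow> E \<inter> (touchA (V s) \<union> touchA (V t)) = {V s, V t} \<and>
    (\<forall>c\<in>V s \<union> V t. card (E \<inter> star c) = k)"
proof -
  have "{V s} \<subseteq> touchA (V s)" "{V t} \<subseteq> touchA (V t)" using V_props(4) assms by auto
  moreover have "{V s} \<inter> touchA (V t) = {}" "{V t} \<inter> touchA (V s) = {}"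
    using assms(3) by (auto simp: touchA_def)
  ultimately have "E \<inter> touchA (V s) = {V s} \<and> E \<inter> touchA (V t) = {V t} \<longleftrightarrow>
    E \<inter> (touchA (V s) \<union> touchA (V t)) = {V s} \<union> {V t}"
    by (rule Int_Un_eq_iff)
  moreover have "{V s} \<union> {V t} = {V s, V t}" by auto
  ultimately show ?thesis unfolding cand_def by (metis Un_iff)
qed

text \<open>Extra conditions on single stars keep the product form. This makes overlaps computable,
  since they prescribe a few edges in several stars.\<close>

lemma prob_cand2_with:
  assumes st: "s \<in> P" "t \<in> P" "V s \<inter> V t = {}" and C: "V s \<union> V t \<subseteq> C" "C \<subseteq> {..<2*\<alpha>}"
  shows "bexp p U (\<lambda>E. of_bool (cand E s \<and> cand E t) * (\<Prod>c\<in>C. g c (E \<inter> star c))) =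
    joint s t * (\<Prod>c\<in>C. bexp p (star c) (\<lambda>E. of_bool (c \<in> V s \<union> V t \<longrightarrow> card E = k) * g c E))"
proof -
  have fC: "finite C" using C(2) finite_subset by blast
  have "bexp p U (\<lambda>E. of_bool (cand E s \<and> cand E t) * (\<Prod>c\<in>C. g c (E \<inter> star c))) =
    bexp p U (\<lambda>E. of_bool (E \<inter> (touchA (V s) \<union> touchA (V t)) = {V s, V t}) *
      (\<Prod>c\<in>C. of_bool (c \<in> V s \<union> V t \<longrightarrow> card (E \<inter> star c) = k) * g c (E \<inter> star c)))"
  proof (intro bexp_cong)
    fix E
    have "of_bool (cand E s \<and> cand E t) = (of_bool (E \<inter> (touchA (V s) \<union> touchA (V t)) = {V s, V t}) *
      (\<Prod>c\<in>C. of_bool (c \<in> V s \<union> V t \<longrightarrow> card (E \<inter> star c) = k)) :: real)"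
      unfolding cand2_iff[OF st] using C(1) fC by (auto intro!: prod_zero)
    then show "of_bool (cand E s \<and> cand E t) * (\<Prod>c\<in>C. g c (E \<inter> star c)) =
      of_bool (E \<inter> (touchA (V s) \<union> touchA (V t)) = {V s, V t}) *
      (\<Prod>c\<in>C. of_bool (c \<in> V s \<union> V t \<longrightarrow> card (E \<inter> star c) = k) * g c (E \<inter> star c))"
      by (simp add: prod.distrib mult.assoc)
  qed
  also have "\<dots> = joint s t * (\<Prod>c\<in>C. bexp p (star c) (\<lambda>E. of_bool (c \<in> V s \<union> V t \<longrightarrow> card E = k) * g c E))"
    unfolding joint_def using touchA_sub
    by (intro bexp_stars[OF C(2), where f = "\<lambda>E. of_bool (E = {V s, V t})"
          and g = "\<lambda>c E. of_bool (c \<in> V s \<union> V t \<longrightarrow> card E = k) * g c E"]) blast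
  finally show ?thesis .
qed

lemma card_VV: "s \<in> P \<Longrightarrow> t \<in> P \<Longrightarrow> V s \<inter> V t = {} \<Longrightarrow> card (V s \<union> V t) = 4"
  using V_props(2,3) by (subst card_Un_disjoint) auto

lemma prob_cand2:
  assumes st: "s \<in> P" "t \<in> P" "V s \<inter> V t = {}"
  shows "prob p U (\<lambda>E. cand E s \<and> cand E t) = joint s t * \<pi> ^ 4"
proof -
  have C: "V s \<union> V t \<subseteq> {..<2*\<alpha>}" using V_props(1) st by blast
  have "bexp p U (\<lambda>E. of_bool (cand E s \<and> cand E t) * (\<Prod>c\<in>V s \<union> V t. 1)) =
    joint s t * (\<Prod>c\<in>V s \<union> V t. bexp p (star c) (\<lambda>E. of_bool (c \<in> V s \<union> V t \<longrightarrow> card E = k) * 1))"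
    by (rule prob_cand2_with[OF st order_refl C, where g = "\<lambda>_ _. 1"])
  also have "(\<Prod>c\<in>V s \<union> V t. bexp p (star c) (\<lambda>E. of_bool (c \<in> V s \<union> V t \<longrightarrow> card E = k) * 1)) = (\<Prod>c\<in>V s \<union> V t. \<pi>)"
    using C prob_card_star by (intro prod.cong refl) auto
  finally show ?thesis using card_VV[OF st] by simp
qed

text \<open>At most 4 possible edges join the two pairs. The product of the single probabilities
  charges for their absence twice, which accounts for the factor.\<close>

lemma prob_cand2_le:
  assumes st: "s \<in> P" "t \<in> P" "s \<noteq> t"
  shows "prob p U (\<lambda>E. cand E s \<and> cand E t) \<le>
    1 / (1 - p) ^ 4 * (prob p U (\<lambda>E. cand E s) * prob p U (\<lambda>E. cand E t))"
proof (cases "V s \<inter> V t = {}")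
  case False
  then have "\<not> (cand E s \<and> cand E t)" for E
    using cand_disjoint[of E s t] st by blast
  then have "prob p U (\<lambda>E. cand E s \<and> cand E t) = bexp p U (\<lambda>_. 0)"
    by (intro bexp_cong) auto
  moreover have "0 \<le> prob p U (\<lambda>E. cand E r)" for r
    using p by (intro bexp_nonneg) auto
  ultimately show ?thesis using p by simp
next
  case True
  let ?S = "touchA (V s)" and ?T = "touchA (V t)"
  have VV: "V s \<noteq> V t" using V_inj st by metis
  have "joint s t = prob p (?S \<union> ?T) (\<lambda>E. E \<inter> (?S \<union> ?T) = {V s, V t})"
    unfolding joint_def by (intro bexp_cong) (simp add: Int_absorb2)
  also have "\<dots> = p\<^sup>2 * (1 - p) ^ (card (?S \<union> ?T) - 2)"
    using bexp_eq_set[of "?S \<union> ?T" "?S \<union> ?T" "{V s, V t}" p] V_props(4) st VV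
    by (simp add: card_Diff_subset power2_eq_square numeral_2_eq_2)
  finally have j: "joint s t = p\<^sup>2 * (1 - p) ^ (card (?S \<union> ?T) - 2)" .
  have "card (?S \<inter> ?T) \<le> card (touching n (V s) \<inter> touching n (V t))"
    by (intro card_mono) (auto simp: touchA_def inA_def touching_def)
  also have "\<dots> \<le> 4"
    using card_touching_Int_le[OF V_props(3)[OF st(1)] V_props(3)[OF st(2)] True, of n] V_props(2) st by simp
  finally have "card ?S + card ?T \<le> card (?S \<union> ?T) + 4" using card_Un_Int[of ?S ?T] by simp
  moreover have "card ?S \<ge> 1" "card ?T \<ge> 1"
    using V_props(4)[OF st(1)] V_props(4)[OF st(2)] by (simp_all add: Suc_le_eq card_gt_0_iff) blast+
  moreover have "card {V s, V t} \<le> card (?S \<union> ?T)"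
    using V_props(4) st by (intro card_mono) auto
  then have "2 \<le> card (?S \<union> ?T)" using VV by simp
  ultimately have "(1 - p) ^ (card (?S \<union> ?T) - 2 + 4) \<le> (1 - p) ^ ((card ?S - 1) + (card ?T - 1))"
    using p by (intro power_decreasing) auto
  then have "(1 - p) ^ (card (?S \<union> ?T) - 2) \<le> 1 / (1 - p) ^ 4 * ((1 - p) ^ (card ?S - 1) * (1 - p) ^ (card ?T - 1))"
    using p by (simp add: power_add field_simps)
  then have "p\<^sup>2 * \<pi> ^ 4 * (1 - p) ^ (card (?S \<union> ?T) - 2) \<le>
    p\<^sup>2 * \<pi> ^ 4 * (1 / (1 - p) ^ 4 * ((1 - p) ^ (card ?S - 1) * (1 - p) ^ (card ?T - 1)))"
    by (intro mult_left_mono) auto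
  then show ?thesis
    unfolding prob_cand2[OF st(1,2) True] j prob_cand[OF st(1)] prob_cand[OF st(2)]
    by (simp add: power2_eq_square eval_nat_numeral algebra_simps)
qed

text \<open>The two ways in which 2-balls of a quadruple can meet through first-stage edges: a
  common outside neighbour, or distinct outside neighbours joined to one vertex \<open>h\<close> of
  A. For \<open>h\<close> in the quadruple itself the second way contains an instance of the
  first.\<close>

definition bad :: "nat set set \<Rightarrow> nat \<times> nat \<Rightarrow> nat \<times> nat \<Rightarrow> bool" where
  "bad E s t \<longleftrightarrow> cand E s \<and> cand E t \<and> (\<exists>c\<in>V s \<union> V t. \<exists>c'\<in>V s \<union> V t. c \<noteq> c' \<and>
     ((\<exists>w\<in>{2*\<alpha>..<n}. {c, w} \<in> E \<and> {c', w} \<in> E) \<or>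
      (\<exists>h\<in>{..<2*\<alpha>} - (V s \<union> V t). \<exists>w\<in>{2*\<alpha>..<n}. \<exists>w'\<in>{2*\<alpha>..<n}. w \<noteq> w' \<and>
         {c, w} \<in> E \<and> {c', w'} \<in> E \<and> {h, w} \<in> E \<and> {h, w'} \<in> E)))"

lemma pi_nonneg: "0 \<le> \<pi>"
  unfolding \<pi>_def binom_prob_def using p by (intro bexp_nonneg) auto

lemma joint_nonneg: "0 \<le> joint s t"
  unfolding joint_def using p by (intro bexp_nonneg) auto

lemma prob_star_member:
  assumes "c < 2*\<alpha>" "w \<in> {2*\<alpha>..<n}"
  shows "prob p (star c) (\<lambda>E. card E = k \<and> {c, w} \<in> E) = real k / b * \<pi>"
  using prob_card_eq_member[of "star c" "{c, w}" p k] card_star[OF assms(1)] assms(2)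
  by (auto simp: star_def \<pi>_def)

lemma star_iff: "w \<in> {2*\<alpha>..<n} \<Longrightarrow> {c, w} \<in> E \<inter> star c \<longleftrightarrow> {c, w} \<in> E"
  by (auto simp: star_def)

text \<open>\<open>H = {}\<close> with \<open>w = w'\<close> covers common neighbours,
  \<open>H = {h}\<close> the paths through \<open>h\<close>. Each prescribed edge at a vertex of
  known outside degree \<open>k\<close> costs \<open>k / b\<close>, each edge at a free vertex costs
  \<open>p\<close>; \<open>w \<noteq> w'\<close> makes the two edges at \<open>h\<close>
  distinct.\<close>

lemma prob_overlap:
  assumes st: "s \<in> P" "t \<in> P" "V s \<inter> V t = {}"
    and c: "c \<in> V s \<union> V t" "c' \<in> V s \<union> V t" "c \<noteq> c'"
    and w: "w \<in> {2*\<alpha>..<n}" "w' \<in> {2*\<alpha>..<n}"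
    and H: "H \<subseteq> {..<2*\<alpha>} - (V s \<union> V t)" "w \<noteq> w' \<or> H = {}"
  shows "prob p U (\<lambda>E. cand E s \<and> cand E t \<and> {c, w} \<in> E \<and> {c', w'} \<in> E \<and>
      (\<forall>h\<in>H. {h, w} \<in> E \<and> {h, w'} \<in> E)) = joint s t * \<pi> ^ 4 * (real k / b)\<^sup>2 * (p\<^sup>2) ^ card H"
proof -
  let ?VV = "V s \<union> V t"
  have VV: "?VV \<subseteq> {..<2*\<alpha>}" "finite ?VV" "card ?VV = 4"
    using V_props(1,3) st card_VV[OF st] by blast+
  define r where "r = real k / b"
    have fH: "finite H" using H(1) finite_subset by blast
    define C where "C = ?VV \<union> H"
    have C: "?VV \<subseteq> C" "C \<subseteq> {..<2*\<alpha>}" "finite C" using VV H fH by (auto simp: C_def)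
    define g :: "nat \<Rightarrow> nat set set \<Rightarrow> real" where
      "g x E = of_bool ((x = c \<longrightarrow> {c, w} \<in> E) \<and> (x = c' \<longrightarrow> {c', w'} \<in> E) \<and> (x \<in> H \<longrightarrow> {x, w} \<in> E \<and> {x, w'} \<in> E))" for x E
    let ?f = "\<lambda>x. bexp p (star x) (\<lambda>E. of_bool (x \<in> ?VV \<longrightarrow> card E = k) * g x E)"
    have "prob p U (\<lambda>E. cand E s \<and> cand E t \<and> {c, w} \<in> E \<and> {c', w'} \<in> E \<and>
      (\<forall>h\<in>H. {h, w} \<in> E \<and> {h, w'} \<in> E)) =
      bexp p U (\<lambda>E. of_bool (cand E s \<and> cand E t) * (\<Prod>x\<in>C. g x (E \<inter> star x)))"
    proof (intro bexp_cong)
      fix E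
      have "(\<Prod>x\<in>C. g x (E \<inter> star x)) = of_bool (\<forall>x\<in>C. (x = c \<longrightarrow> {c, w} \<in> E) \<and> (x = c' \<longrightarrow> {c', w'} \<in> E) \<and>
          (x \<in> H \<longrightarrow> {x, w} \<in> E \<and> {x, w'} \<in> E))"
        unfolding g_def using star_iff[OF w(1)] star_iff[OF w(2)] C(3)
        by (auto intro!: prod_zero prod.neutral)
      also have "(\<forall>x\<in>C. (x = c \<longrightarrow> {c, w} \<in> E) \<and> (x = c' \<longrightarrow> {c', w'} \<in> E) \<and>
          (x \<in> H \<longrightarrow> {x, w} \<in> E \<and> {x, w'} \<in> E)) \<longleftrightarrow>
          {c, w} \<in> E \<and> {c', w'} \<in> E \<and> (\<forall>h\<in>H. {h, w} \<in> E \<and> {h, w'} \<in> E)"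
        using c(1,2) unfolding C_def by blast
      finally show "of_bool (cand E s \<and> cand E t \<and> {c, w} \<in> E \<and> {c', w'} \<in> E \<and>
        (\<forall>h\<in>H. {h, w} \<in> E \<and> {h, w'} \<in> E)) = of_bool (cand E s \<and> cand E t) * (\<Prod>x\<in>C. g x (E \<inter> star x))"
        by simp
    qed
    also have "\<dots> = joint s t * (\<Prod>x\<in>C. ?f x)"
      by (rule prob_cand2_with[OF st C(1,2)])
    also have "(\<Prod>x\<in>C. ?f x) =
      (\<Prod>x\<in>?VV. ?f x) *
      (\<Prod>x\<in>H. ?f x)"
      unfolding C_def using VV fH H by (intro prod.union_disjoint) auto
    also have "(\<Prod>x\<in>?VV. ?f x) =
      (\<Prod>x\<in>?VV. \<pi> * (if x = c then r else 1) * (if x = c' then r else 1))"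
    proof (intro prod.cong refl)
      fix x assume x: "x \<in> ?VV"
      have xa: "x < 2*\<alpha>" "x \<notin> H" using x VV H(1) by auto
      have "?f x =
        (if x = c then prob p (star x) (\<lambda>E. card E = k \<and> {x, w} \<in> E)
         else if x = c' then prob p (star x) (\<lambda>E. card E = k \<and> {x, w'} \<in> E)
         else prob p (star x) (\<lambda>E. card E = k))"
        using x xa(2) c(3) by (auto simp: g_def intro!: bexp_cong)
      then show "?f x =
        \<pi> * (if x = c then r else 1) * (if x = c' then r else 1)"
        using prob_star_member[OF xa(1) w(1)] prob_star_member[OF xa(1) w(2)] prob_card_star[OF xa(1)] c(3)
        by (auto simp: r_def)
    qed
    also have "\<dots> = \<pi> ^ 4 * r * r"
      using VV c by (simp add: prod.distrib)
    also have "(\<Prod>x\<in>H. ?f x) = (\<Prod>x\<in>H. p\<^sup>2)"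
    proof (intro prod.cong refl)
      fix x assume x: "x \<in> H"
      then have xx: "x \<notin> ?VV" "x \<noteq> c" "x \<noteq> c'" "x < 2*\<alpha>" using H(1) c by auto
      have ww: "w \<noteq> w'" using H(2) x by auto
      have sub: "{{x, w}, {x, w'}} \<subseteq> star x" using w by (auto simp: star_def)
      have "{x, w} \<noteq> {x, w'}" using ww by (auto simp: doubleton_eq_iff)
      then have "prob p (star x) (\<lambda>E. E \<inter> {{x, w}, {x, w'}} = {{x, w}, {x, w'}}) = p\<^sup>2"
        using bexp_eq_set[OF finite_star sub, of "{{x, w}, {x, w'}}" p] by (simp add: power2_eq_square)
      moreover have "of_bool (x \<in> ?VV \<longrightarrow> card E = k) * g x E = of_bool (E \<inter> {{x, w}, {x, w'}} = {{x, w}, {x, w'}})" for E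
        using x xx by (auto simp: g_def)
      ultimately show "?f x = p\<^sup>2" by simp
    qed
    finally show ?thesis by (simp add: power2_eq_square r_def)
qed

text \<open>Union bound: 16 choices of \<open>c\<close>, \<open>c'\<close>, and then
  \<open>b\<close> choices of \<open>w\<close> for the first kind of overlap or at most
  \<open>2 * \<alpha> * b\<^sup>2\<close> choices of \<open>h\<close>, \<open>w\<close>,
  \<open>w'\<close> for the second.\<close>

lemma prob_bad:
  assumes st: "s \<in> P" "t \<in> P" "V s \<inter> V t = {}"
  shows "prob p U (\<lambda>E. bad E s t) \<le>
    prob p U (\<lambda>E. cand E s \<and> cand E t) * (16 * ((real k)\<^sup>2 / b + 2 * \<alpha> * (real k * p)\<^sup>2))"
proof -
  let ?VV = "V s \<union> V t" and ?B = "{2*\<alpha>..<n}" and ?H = "{..<2*\<alpha>} - (V s \<union> V t)"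
  have VV: "finite ?VV" "card ?VV = 4" using V_props(3) st card_VV[OF st] by blast+
  define I1 where "I1 E c c' w \<longleftrightarrow> c \<noteq> c' \<and> cand E s \<and> cand E t \<and> {c, w} \<in> E \<and> {c', w} \<in> E" for E c c' w
  define I2 where "I2 E c c' h w w' \<longleftrightarrow> c \<noteq> c' \<and> w \<noteq> w' \<and> cand E s \<and> cand E t \<and> {c, w} \<in> E \<and> {c', w'} \<in> E \<and>
    (\<forall>x\<in>{h}. {x, w} \<in> E \<and> {x, w'} \<in> E)" for E c c' h w w'
  define J where "J = joint s t * \<pi> ^ 4"
  have J: "0 \<le> J" using joint_nonneg pi_nonneg by (simp add: J_def)
  have cb: "card ?B = b" by (simp add: b_def)
  have le: "of_bool (bad E s t) \<le> (\<Sum>c\<in>?VV. \<Sum>c'\<in>?VV. (\<Sum>w\<in>?B. of_bool (I1 E c c' w)) +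
      (\<Sum>h\<in>?H. \<Sum>w\<in>?B. \<Sum>w'\<in>?B. of_bool (I2 E c c' h w w')) :: real)" (is "_ \<le> (\<Sum>c\<in>?VV. \<Sum>c'\<in>?VV. ?f c c')") for E
  proof (cases "bad E s t")
    case True
    then obtain c c' where c: "c \<in> ?VV" "c' \<in> ?VV" "c \<noteq> c'" and or:
      "(\<exists>w\<in>?B. {c, w} \<in> E \<and> {c', w} \<in> E) \<or>
      (\<exists>h\<in>?H. \<exists>w\<in>?B. \<exists>w'\<in>?B. w \<noteq> w' \<and> {c, w} \<in> E \<and> {c', w'} \<in> E \<and> {h, w} \<in> E \<and> {h, w'} \<in> E)"
      and cd: "cand E s" "cand E t" unfolding bad_def by blast
    from or consider w where "w \<in> ?B" "I1 E c c' w" | h w w' where "h \<in> ?H" "w \<in> ?B" "w' \<in> ?B" "I2 E c c' h w w'"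
      unfolding I1_def I2_def using c(3) cd by blast
    then have "1 \<le> ?f c c'"
    proof cases
      case 1
      then have "1 \<le> (\<Sum>w\<in>?B. of_bool (I1 E c c' w) :: real)"
        using member_le_sum[of w ?B "\<lambda>w. of_bool (I1 E c c' w) :: real"] by simp
      moreover have "0 \<le> (\<Sum>h\<in>?H. \<Sum>w\<in>?B. \<Sum>w'\<in>?B. of_bool (I2 E c c' h w w') :: real)"
        by (intro sum_nonneg) auto
      ultimately show ?thesis by linarith
    next
      case 2
      have "1 \<le> (\<Sum>w'\<in>?B. of_bool (I2 E c c' h w w') :: real)"
        using member_le_sum[of w' ?B "\<lambda>w'. of_bool (I2 E c c' h w w') :: real"] 2 by simp
      also have "\<dots> \<le> (\<Sum>w\<in>?B. \<Sum>w'\<in>?B. of_bool (I2 E c c' h w w'))"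
        using 2 by (intro member_le_sum) (auto intro: sum_nonneg)
      also have "\<dots> \<le> (\<Sum>h\<in>?H. \<Sum>w\<in>?B. \<Sum>w'\<in>?B. of_bool (I2 E c c' h w w'))"
        using 2 by (intro member_le_sum) (auto intro: sum_nonneg)
      finally have "1 \<le> (\<Sum>h\<in>?H. \<Sum>w\<in>?B. \<Sum>w'\<in>?B. of_bool (I2 E c c' h w w') :: real)" .
      moreover have "0 \<le> (\<Sum>w\<in>?B. of_bool (I1 E c c' w) :: real)" by (intro sum_nonneg) auto
      ultimately show ?thesis by linarith
    qed
    also have "?f c c' \<le> (\<Sum>c'\<in>?VV. ?f c c')"
      using c VV by (intro member_le_sum add_nonneg_nonneg sum_nonneg) auto
    also have "\<dots> \<le> (\<Sum>c\<in>?VV. \<Sum>c'\<in>?VV. ?f c c')"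
      using c VV by (intro member_le_sum add_nonneg_nonneg sum_nonneg) auto
    finally show ?thesis using True by simp
  next
    case False
    have "0 \<le> (\<Sum>c\<in>?VV. \<Sum>c'\<in>?VV. ?f c c')" by (intro sum_nonneg add_nonneg_nonneg) auto
    then show ?thesis using False by simp
  qed
  have "prob p U (\<lambda>E. bad E s t) \<le>
     bexp p U (\<lambda>E. \<Sum>c\<in>?VV. \<Sum>c'\<in>?VV. (\<Sum>w\<in>?B. of_bool (I1 E c c' w)) +
      (\<Sum>h\<in>?H. \<Sum>w\<in>?B. \<Sum>w'\<in>?B. of_bool (I2 E c c' h w w')))"
    using p by (intro bexp_mono le) auto
  also have "\<dots> = (\<Sum>c\<in>?VV. \<Sum>c'\<in>?VV. (\<Sum>w\<in>?B. prob p U (\<lambda>E. I1 E c c' w)) +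
      (\<Sum>h\<in>?H. \<Sum>w\<in>?B. \<Sum>w'\<in>?B. prob p U (\<lambda>E. I2 E c c' h w w')))"
    by (simp only: bexp_sum bexp_add)
  also have "\<dots> \<le> (\<Sum>c\<in>?VV. \<Sum>c'\<in>?VV. (\<Sum>w\<in>?B. J * (real k / b)\<^sup>2) +
      (\<Sum>h\<in>?H. \<Sum>w\<in>?B. \<Sum>w'\<in>?B. J * (real k / b)\<^sup>2 * p\<^sup>2))"
  proof (intro sum_mono add_mono)
    fix c c' w assume c: "c \<in> ?VV" "c' \<in> ?VV" and w: "w \<in> ?B"
    show "prob p U (\<lambda>E. I1 E c c' w) \<le> J * (real k / b)\<^sup>2"
    proof (cases "c = c'")
      case True then show ?thesis using J by (simp add: I1_def)
    next
      case False
      then show ?thesis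
        using prob_overlap[OF st c _ w w, of "{}"] by (simp add: I1_def J_def)
    qed
  next
    fix c c' h w w' assume c: "c \<in> ?VV" "c' \<in> ?VV" and h: "h \<in> ?H" and w: "w \<in> ?B" "w' \<in> ?B"
    show "prob p U (\<lambda>E. I2 E c c' h w w') \<le> J * (real k / b)\<^sup>2 * p\<^sup>2"
    proof (cases "c = c' \<or> w = w'")
      case True then show ?thesis using J by (auto simp: I2_def)
    next
      case False
      then show ?thesis
        using prob_overlap[OF st c _ w, of "{h}"] h by (simp add: I2_def J_def)
    qed
  qed
  also have "\<dots> = 16 * J * (real b * (real k / b)\<^sup>2 + real (card ?H) * real b * real b * (real k / b)\<^sup>2 * p\<^sup>2)"
    by (simp only: sum_constant cb VV(2)) (simp add: algebra_simps)
  also have "\<dots> = 16 * J * ((real k)\<^sup>2 / b + real (card ?H) * (real k * p)\<^sup>2)"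
    using b_pos by (simp add: power2_eq_square field_simps)
  also have "\<dots> \<le> 16 * J * ((real k)\<^sup>2 / b + 2 * \<alpha> * (real k * p)\<^sup>2)"
  proof -
    have "card ?H \<le> card {..<2*\<alpha>}" by (intro card_mono) auto
    then show ?thesis using J by (intro mult_left_mono add_mono mult_right_mono) auto
  qed
  finally show ?thesis by (simp add: prob_cand2[OF st] J_def algebra_simps)
qed

text \<open>Any \<open>2 * m\<close> candidates are enumerated and consecutive ones combined into
  quadruples. As no two candidates are bad together, it does not matter which are combined.\<close>

lemma first_stage_exists:
  assumes E: "E \<subseteq> U" and X: "2 * m \<le> card {t \<in> P. cand E t}"
    and nbad: "\<And>s t. s \<in> P \<Longrightarrow> t \<in> P \<Longrightarrow> s \<noteq> t \<Longrightarrow> \<not> bad E s t"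
  shows "\<exists>c S. first_stage n (2 * \<alpha>) m k p E c S"
proof -
  obtain T where T: "T \<subseteq> {t \<in> P. cand E t}" "card T = 2 * m" "finite T"
    using X by (rule obtain_subset_with_card_n)
  obtain \<tau> where "bij_betw \<tau> {0..<card T} T" using ex_bij_betw_nat_finite[OF T(3)] by blast
  then have bij: "bij_betw \<tau> {0..<2*m} T" by (simp only: T(2))
  then have \<tau>: "inj_on \<tau> {0..<2*m}" "\<And>i. i < 2 * m \<Longrightarrow> \<tau> i \<in> P \<and> cand E (\<tau> i)"
    using bij_betw_imp_inj_on bij_betwE[OF bij] T(1) by auto
  have \<tau>neq: "\<tau> a \<noteq> \<tau> b" if "a < 2 * m" "b < 2 * m" "a \<noteq> b" for a b
    using inj_onD[OF \<tau>(1), of a b] that by auto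
  \<comment> \<open>\<open>j div 2\<close> selects one of the two edges of the quadruple and the
    parity of \<open>j\<close> one of its ends, so 0, 1 and 2, 3 are partners.\<close>
  define c where "c i j = (if even j then fst else snd) (\<tau> (2 * i + j div 2))" for i j :: nat
  define S where "S i j = nb E (c i j) \<inter> {2*\<alpha>..<n}" for i j
  have gE: "is_graph n E" using E by (auto simp: U_def touching_def is_graph_def)
  have j2: "j div 2 < 2" if "j < 4" for j :: nat using that by simp
  have idx: "2 * i + j div 2 < 2 * m" if "i < m" "j < 4" for i j :: nat using that by linarith
  have cV: "c i j \<in> V (\<tau> (2 * i + j div 2))" for i j by (simp add: c_def V_def)
  have cQ: "c i j \<in> V (\<tau> (2 * i)) \<union> V (\<tau> (2 * i + 1))" if "j < 4" for i j
  proof -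
    have "j div 2 = 0 \<or> j div 2 = 1" using that by linarith
    then show ?thesis using cV[of i j] by auto
  qed
  have clt: "c i j < 2 * \<alpha>" if "i < m" "j < 4" for i j
    using cV[of i j] V_props(1) \<tau>(2)[OF idx[OF that]] by blast
  have partner: "partner j < 4" "partner j div 2 = j div 2" "even (partner j) \<longleftrightarrow> odd j" if "j < 4" for j
  proof -
    from that consider "j = 0" | "j = 1" | "j = 2" | "j = 3" by linarith
    then have "partner j < 4 \<and> partner j div 2 = j div 2 \<and> (even (partner j) \<longleftrightarrow> odd j)"
      by cases (simp_all add: partner_def)
    then show "partner j < 4" "partner j div 2 = j div 2" "even (partner j) \<longleftrightarrow> odd j" by blast+
  qed
  have Vc: "V (\<tau> (2 * i + j div 2)) = {c i j, c i (partner j)}" if "i < m" "j < 4" for i j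
    unfolding V_def c_def partner(2)[OF that(2)] using partner(3)[OF that(2)]
    by (cases "even j") (simp_all add: insert_commute)
  \<comment> \<open>\<open>bad\<close> concerns two different candidates, while two positions may
    lie on the same edge. In that case the other edge of the quadruple is taken along, so some two
    candidates always cover both positions.\<close>
  have key: "\<exists>s\<in>P. \<exists>t\<in>P. s \<noteq> t \<and> cand E s \<and> cand E t \<and> c i j \<in> V s \<union> V t \<and> c i' j' \<in> V s \<union> V t \<and>
      c i j \<noteq> c i' j' \<and> (i = i' \<longrightarrow> s = \<tau> (2 * i) \<and> t = \<tau> (2 * i + 1))"
    if ij: "i < m" "j < 4" "i' < m" "j' < 4" "(i, j) \<noteq> (i', j')" for i j i' j'
  proof -
    have ne: "c i j \<noteq> c i' j'"
    proof (cases "2 * i + j div 2 = 2 * i' + j' div 2")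
      case True
      then have "i = i'" "j div 2 = j' div 2"
        using double_add_eq[OF True j2[OF ij(2)] j2[OF ij(4)]] by auto
      then have "j \<noteq> j'" using ij(5) by blast
      then have par: "even j \<noteq> even j'" using \<open>j div 2 = j' div 2\<close> div2_eq_parity by blast
      define t where "t = \<tau> (2 * i + j div 2)"
      have "t \<in> P" unfolding t_def using \<tau>(2)[OF idx[OF ij(1,2)]] by (rule conjunct1)
      then have "fst t \<noteq> snd t" using P_bounds[of t] by linarith
      moreover have "c i j = (if even j then fst else snd) t" by (simp add: c_def t_def)
      moreover have "c i' j' = (if even j' then fst else snd) t" by (simp only: c_def t_def True)
      ultimately show ?thesis using par by (cases "even j") simp_all
    next
      case False
      then have "\<tau> (2 * i + j div 2) \<noteq> \<tau> (2 * i' + j' div 2)"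
        using \<tau>neq[OF idx[OF ij(1,2)] idx[OF ij(3,4)]] by blast
      then have "V (\<tau> (2 * i + j div 2)) \<inter> V (\<tau> (2 * i' + j' div 2)) = {}"
        using \<tau>(2)[OF idx[OF ij(1,2)]] \<tau>(2)[OF idx[OF ij(3,4)]] cand_disjoint[of E] by blast
      then show ?thesis using cV[of i j] cV[of i' j'] by auto
    qed
    show ?thesis
    proof (cases "i = i'")
      case True
      have i2: "2 * i < 2 * m" "2 * i + 1 < 2 * m" using ij(1) by linarith+
      then have "\<tau> (2 * i) \<noteq> \<tau> (2 * i + 1)" using \<tau>neq by simp
      then show ?thesis
        using \<tau>(2)[OF i2(1)] \<tau>(2)[OF i2(2)] cQ[OF ij(2), of i] cQ[OF ij(4), of i'] ne True
        by (intro bexI[of _ "\<tau> (2 * i)"] bexI[of _ "\<tau> (2 * i + 1)"]) auto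
    next
      case False
      then have "2 * i + j div 2 \<noteq> 2 * i' + j' div 2"
        using double_add_eq[OF _ j2[OF ij(2)] j2[OF ij(4)]] by blast
      then have "\<tau> (2 * i + j div 2) \<noteq> \<tau> (2 * i' + j' div 2)"
        using \<tau>neq[OF idx[OF ij(1,2)] idx[OF ij(3,4)]] by blast
      then show ?thesis
        using \<tau>(2)[OF idx[OF ij(1,2)]] \<tau>(2)[OF idx[OF ij(3,4)]] cV[of i j] cV[of i' j'] ne False
        by (intro bexI[of _ "\<tau> (2 * i + j div 2)"] bexI[of _ "\<tau> (2 * i' + j' div 2)"]) auto
    qed
  qed
  have Siff: "w \<in> S i j \<longleftrightarrow> {c i j, w} \<in> E \<and> w \<in> {2*\<alpha>..<n}" if "i < m" "j < 4" for i j w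
    using clt[OF that] by (auto simp: S_def nb_def)
  have disjS: "S i j \<inter> S i' j' = {}"
    if ij: "i < m" "j < 4" "i' < m" "j' < 4" "(i, j) \<noteq> (i', j')" for i j i' j'
  proof (rule ccontr)
    assume "S i j \<inter> S i' j' \<noteq> {}"
    then obtain w where w: "w \<in> {2*\<alpha>..<n}" "{c i j, w} \<in> E" "{c i' j', w} \<in> E"
      using Siff[OF ij(1,2)] Siff[OF ij(3,4)] by blast
    obtain s t where st: "s \<in> P" "t \<in> P" "s \<noteq> t" "cand E s" "cand E t" "c i j \<in> V s \<union> V t" "c i' j' \<in> V s \<union> V t"
      "c i j \<noteq> c i' j'" using key[OF ij] by blast
    then have "bad E s t" unfolding bad_def using w by blast
    then show False using nbad st by blast
  qed
  have "first_stage n (2 * \<alpha>) m k p E c S"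
  proof
    show "2 * \<alpha> \<le> n" using an by simp
    show "0 \<le> p" "p \<le> 1" using p by auto
    show "E \<subseteq> touching n {..<2 * \<alpha>}" using E by (simp add: U_def)
  next
    fix i j assume ij: "i < m" "j < (4::nat)"
    show "c i j < 2 * \<alpha>" by (rule clt[OF ij])
    show "nb E (c i j) \<inter> {2 * \<alpha>..<n} = S i j" by (simp add: S_def)
    let ?t = "\<tau> (2 * i + j div 2)"
    have cd: "cand E ?t" and tP: "?t \<in> P" using \<tau>(2)[OF idx[OF ij]] by auto
    show "nb E (c i j) \<inter> {..<2 * \<alpha>} = {c i (partner j)}"
    proof (intro equalityI subsetI)
      fix w assume w: "w \<in> nb E (c i j) \<inter> {..<2 * \<alpha>}"
      then have cw: "{c i j, w} \<in> E" "c i j \<noteq> w" "w < 2 * \<alpha>" by (simp_all add: nb_def)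
      have "c i j < n" "w < n" using clt[OF ij] cw(3) an by linarith+
      then have "{c i j, w} \<in> inA"
        unfolding inA_def using clt[OF ij] cw(2,3) by (simp add: all_edges_iff)
      moreover have "c i j \<in> {c i j, w} \<inter> V ?t" using cV[of i j] by blast
      ultimately have "{c i j, w} \<in> E \<inter> touchA (V ?t)"
        unfolding touchA_def using cw(1) by blast
      moreover have "E \<inter> touchA (V ?t) = {V ?t}" using cd unfolding cand_def by (rule conjunct1)
      ultimately have "{c i j, w} = V ?t" by (simp only: singleton_iff)
      then show "w \<in> {c i (partner j)}"
        using cw(2) unfolding Vc[OF ij] doubleton_eq_iff singleton_iff by metis
    next
      fix w assume "w \<in> {c i (partner j)}"
      moreover have "V ?t \<in> E" using cd unfolding cand_def by blast
      then have "{c i j, c i (partner j)} \<in> E" unfolding Vc[OF ij] .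
      moreover from this have "c i j \<noteq> c i (partner j)" by (rule graph_edge(3)[OF gE])
      moreover have "c i (partner j) < 2 * \<alpha>" by (rule clt[OF ij(1) partner(1)[OF ij(2)]])
      ultimately show "w \<in> nb E (c i j) \<inter> {..<2 * \<alpha>}" by (simp add: nb_def)
    qed
    have "E \<inter> star (c i j) = (\<lambda>w. {c i j, w}) ` S i j"
      using Siff[OF ij] by (auto simp: star_def)
    moreover have "inj_on (\<lambda>w. {c i j, w}) (S i j)"
      using clt[OF ij] by (auto simp: inj_on_def doubleton_eq_iff)
    ultimately have "card (S i j) = card (E \<inter> star (c i j))" by (simp add: card_image)
    then show "card (S i j) = k" using cd cV[of i j] by (simp add: cand_def)
  next
    fix i j l assume ijl: "i < m" "j < (4::nat)" "l < (4::nat)" "j \<noteq> l"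
    have "(i, j) \<noteq> (i, l)" using ijl by simp
    from key[OF ijl(1,2) ijl(1,3) this] show "c i j \<noteq> c i l" by blast
  next
    fix i j i' j' assume "i < m" "j < (4::nat)" "i' < m" "j' < (4::nat)" "(i, j) \<noteq> (i', j')"
    then show "S i j \<inter> S i' j' = {}" by (rule disjS)
  next
    fix i j l assume ijl: "i < m" "j < (4::nat)" "l < (4::nat)" "j \<noteq> l"
    show "(\<Union>w\<in>S i j. nb E w) \<inter> (\<Union>w\<in>S i l. nb E w) = {}"
    proof (rule ccontr)
      assume "(\<Union>w\<in>S i j. nb E w) \<inter> (\<Union>w\<in>S i l. nb E w) \<noteq> {}"
      then obtain h w w' where w: "w \<in> S i j" "w' \<in> S i l" "h \<in> nb E w" "h \<in> nb E w'" by blast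
      have ne: "(i, j) \<noteq> (i, l)" using ijl by simp
      have ww: "w \<noteq> w'" using disjS[OF ijl(1,2) ijl(1,3) ne] w by blast
      have wB: "w \<in> {2*\<alpha>..<n}" "w' \<in> {2*\<alpha>..<n}" "{c i j, w} \<in> E" "{c i l, w'} \<in> E"
        using w Siff[OF ijl(1,2)] Siff[OF ijl(1,3)] by auto
      have hw: "{h, w} \<in> E" "{h, w'} \<in> E" using w by (auto simp: nb_def insert_commute)
      have "{h, w} \<in> touching n {..<2 * \<alpha>}" using hw(1) E by (auto simp: U_def)
      then have hA: "h < 2 * \<alpha>" using wB(1) by (auto simp: touching_def)
      obtain s t where st: "s \<in> P" "t \<in> P" "s \<noteq> t" "cand E s" "cand E t" "c i j \<in> V s \<union> V t" "c i l \<in> V s \<union> V t"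
        "c i j \<noteq> c i l" "s = \<tau> (2 * i)" "t = \<tau> (2 * i + 1)" using key[OF ijl(1,2) ijl(1,3) ne] by blast
      \<comment> \<open>If \<open>h = c i q\<close>, then \<open>w\<close> and \<open>w'\<close>
        both lie in \<open>S i q\<close>, and \<open>q\<close> differs from \<open>j\<close> or from
        \<open>l\<close>, against the disjointness of the first layers.\<close>
      have "h \<notin> V s \<union> V t"
      proof
        assume "h \<in> V s \<union> V t"
        moreover have "V s = {c i 0, c i 1}" "V t = {c i 2, c i 3}"
          using Vc[OF ijl(1), of 0] Vc[OF ijl(1), of 2] st by (simp_all add: partner_def)
        ultimately obtain q where q: "q < 4" "h = c i q"
          by (auto intro: that[of 0] that[of 1] that[of 2] that[of 3])
        then have "w \<in> S i q" "w' \<in> S i q" using hw wB(1,2) Siff[OF ijl(1) q(1)] by auto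
        moreover have "(i, q) \<noteq> (i, j) \<or> (i, q) \<noteq> (i, l)" using ijl by auto
        ultimately show False
          using disjS[OF ijl(1) q(1) ijl(1,2)] disjS[OF ijl(1) q(1) ijl(1,3)] w(1,2) by blast
      qed
      then have "h \<in> {..<2*\<alpha>} - (V s \<union> V t)" using hA by simp
      then have "bad E s t" unfolding bad_def using st ww wB hw by blast
      then show False using nbad st by blast
    qed
  qed
  then show ?thesis by blast
qed

text \<open>Half the expected number \<open>\<mu>\<close> of candidates is at least
  \<open>2 * m\<close>, so the second moment method supplies enough of them. The last term bounds
  the expected number of bad pairs: at most \<open>\<Delta> * \<mu>\<^sup>2\<close> expected pairs
  of candidates, times the conditional probability of an overlap.\<close>

lemma prob_first_stage:
  assumes \<mu>: "\<mu> = (\<Sum>t\<in>P. prob p U (\<lambda>E. cand E t))" "\<mu> > 0" "4 * real m \<le> \<mu>"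
  defines "\<Delta> \<equiv> 1 / (1 - p) ^ 4"
  shows "prob p U (\<lambda>E. \<exists>c S. first_stage n (2 * \<alpha>) m k p E c S) \<ge>
    1 - 4 * (1 / \<mu> + (\<Delta> - 1)) - \<Delta> * \<mu>\<^sup>2 * (16 * ((real k)\<^sup>2 / b + 2 * \<alpha> * (real k * p)\<^sup>2))"
proof -
  have fP: "finite P" by (rule finite_subset[OF P]) simp
  let ?bad = "\<lambda>E. \<exists>s\<in>P. \<exists>t\<in>P. s \<noteq> t \<and> bad E s t"
  let ?Y = "\<lambda>E. (\<Sum>s\<in>P. \<Sum>t\<in>P. of_bool (s \<noteq> t \<and> bad E s t)) :: real"
  let ?first = "\<lambda>E. \<exists>c S. first_stage n (2 * \<alpha>) m k p E c S"
  let ?N = "\<lambda>E. card {t \<in> P. cand E t}"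
  let ?few = "\<lambda>E. real (?N E) \<le> \<mu> / 2"
  define Y where "Y = 16 * ((real k)\<^sup>2 / b + 2 * \<alpha> * (real k * p)\<^sup>2)"
  have Y: "0 \<le> Y" by (simp add: Y_def)
  have \<Delta>: "1 \<le> \<Delta>" using p by (simp add: \<Delta>_def power_le_one)
  define pr where "pr t = prob p U (\<lambda>E. cand E t)" for t
  have pr0: "0 \<le> pr t" for t unfolding pr_def using p by (intro bexp_nonneg) auto
  have X: "prob p U (\<lambda>E. ?few E) \<le> 4 * (1 / \<mu> + (\<Delta> - 1))"
    using p \<Delta> prob_cand2_le by (intro bexp_second_moment[OF _ _ finite_U fP \<mu>(1,2)]) (auto simp: \<Delta>_def)
  have bd: "prob p U (\<lambda>E. bad E s t) \<le> \<Delta> * (pr s * pr t) * Y" if st: "s \<in> P" "t \<in> P" "s \<noteq> t" for s t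
  proof (cases "V s \<inter> V t = {}")
    case True
    have "prob p U (\<lambda>E. bad E s t) \<le> prob p U (\<lambda>E. cand E s \<and> cand E t) * Y"
      unfolding Y_def by (rule prob_bad[OF st(1,2) True])
    also have "\<dots> \<le> \<Delta> * (pr s * pr t) * Y"
      using prob_cand2_le[OF st] Y by (intro mult_right_mono) (auto simp: \<Delta>_def pr_def)
    finally show ?thesis .
  next
    case False
    then have "\<not> bad E s t" for E using cand_disjoint[of E s t] st unfolding bad_def by blast
    then show ?thesis using \<Delta> pr0 Y by simp
  qed
  have "prob p U (\<lambda>E. ?bad E) \<le>
    bexp p U ?Y"
  proof (intro bexp_mono)
    fix E
    show "of_bool (?bad E) \<le> ?Y E"
    proof (cases "?bad E")
      case True
      then obtain s t where st: "s \<in> P" "t \<in> P" "s \<noteq> t \<and> bad E s t" by blast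
      have "1 \<le> (\<Sum>t\<in>P. of_bool (s \<noteq> t \<and> bad E s t) :: real)"
        using member_le_sum[of t P "\<lambda>t. of_bool (s \<noteq> t \<and> bad E s t) :: real"] st fP by simp
      also have "\<dots> \<le> ?Y E"
        using st fP by (intro member_le_sum sum_nonneg) auto
      finally show ?thesis using True by simp
    next
      case False
      have "0 \<le> ?Y E" by (intro sum_nonneg) auto
      moreover have "of_bool (?bad E) = (0 :: real)"
        using False by (simp only: of_bool_eq)
      ultimately show ?thesis by linarith
    qed
  qed (use p in auto)
  also have "\<dots> = (\<Sum>s\<in>P. \<Sum>t\<in>P. prob p U (\<lambda>E. s \<noteq> t \<and> bad E s t))"
    by (simp only: bexp_sum)
  also have "\<dots> \<le> (\<Sum>s\<in>P. \<Sum>t\<in>P. \<Delta> * (pr s * pr t) * Y)"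
  proof (intro sum_mono)
    fix s t assume "s \<in> P" "t \<in> P"
    then show "prob p U (\<lambda>E. s \<noteq> t \<and> bad E s t) \<le> \<Delta> * (pr s * pr t) * Y"
      using bd[of s t] \<Delta> pr0 Y by (cases "s = t") auto
  qed
  also have "\<dots> = \<Delta> * \<mu>\<^sup>2 * Y"
    unfolding \<mu>(1) pr_def[symmetric] power2_eq_square sum_product
    by (simp add: sum_distrib_left sum_distrib_right)
  finally have B: "prob p U (\<lambda>E. ?bad E) \<le> \<Delta> * \<mu>\<^sup>2 * Y" .
  have "1 - of_bool (?few E) - of_bool (?bad E) \<le>
      (of_bool (?first E) :: real)" if "E \<subseteq> U" for E
  proof (cases "?few E \<or> (?bad E)")
    case False
    then have "2 * m \<le> ?N E" using \<mu>(3) by linarith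
    then have "?first E"
      using False by (intro first_stage_exists[OF that]) auto
    then show ?thesis by simp
  qed auto
  then have "bexp p U (\<lambda>E. 1 - of_bool (?few E) - of_bool (?bad E))
     \<le> prob p U (\<lambda>E. ?first E)"
    using p by (intro bexp_mono) auto
  then have "1 - prob p U (\<lambda>E. ?few E) - prob p U (\<lambda>E. ?bad E)
     \<le> prob p U (\<lambda>E. ?first E)"
    by (simp only: bexp_diff bexp_const[OF finite_U])
  then show ?thesis using X B unfolding Y_def by linarith
qed

end

section \<open>Quantitative form of the second stage\<close>

context first_stage
begin

lemma card_inner: "card inner_edges \<le> (4 * m * k)\<^sup>2"
proof -
  have "inner_edges \<subseteq> (\<lambda>(v, w). {v, w}) ` (N \<times> N)"
    by (auto simp: inner_edges_def all_edges_def image_iff)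
  then have "card inner_edges \<le> card (N \<times> N)"
    using finN surj_card_le[of "N \<times> N"] by auto
  also have "\<dots> \<le> (4 * m * k) * (4 * m * k)"
    using cardN by (simp only: card_cartesian_product) (intro mult_mono, auto)
  finally show ?thesis by (simp add: power2_eq_square)
qed

lemma card_Z: "n - a - 4 * m * k \<le> card Z" "card Z \<le> n"
proof -
  have "card Z = card {a..<n} - card N" unfolding Z_def using N_sub finN by (rule card_Diff_subset[rotated])
  then show "n - a - 4 * m * k \<le> card Z" "card Z \<le> n" using cardN by simp_all
qed

text \<open>The divisor 8 is 4 for the parity classes times 2 for the nontrivial characters:
  \<open>big\<close> gives \<open>k * p * card Z \<ge> 2\<close>, and
  \<open>1 - 3 * exp (-2)\<close> is at least 1/2.\<close>

lemma prob_second_stage_bound: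
  assumes kp: "real k * p \<le> 1 / 20" and big: "2 \<le> real k * p * real (n - a - 4 * m * k)"
    and small: "p * (4 * real m * real k)\<^sup>2 \<le> 1"
  defines "G \<equiv> (1 - 6 * (real k * p)\<^sup>2) ^ n / 8"
  shows "(1 - p * (4 * real m * real k)\<^sup>2) * (1 - exp (- (real m * G))) \<le>
    prob p outer_edges (\<lambda>E. \<not> reconstructible 2 n (E1 \<union> E))"
proof -
  have kp0: "0 \<le> real k * p" using p by simp
  have sq: "(real k * p)\<^sup>2 \<le> (1/20)\<^sup>2" using kp kp0 by (intro power_mono) auto
  have q: "0 \<le> 1 - 6 * (real k * p)\<^sup>2" "1 - 6 * (real k * p)\<^sup>2 \<le> 1" using sq by (simp_all add: power2_eq_square)
  have G: "0 \<le> G" "G \<le> 1" using q by (auto simp: G_def intro: order_trans[OF power_le_one])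
  have g: "G \<le> prob p (F i) (\<lambda>E. good i E)" if i: "i < m" for i
  proof -
    have "real k * p * real (n - a - 4 * m * k) \<le> real k * p * real (card Z)"
      by (intro mult_left_mono kp0) (simp only: of_nat_le_iff card_Z(1))
    then have "2 \<le> real k * p * real (card Z)" by (rule order_trans[OF big])
    then have "exp (- (real k * p * card Z)) \<le> exp (-2)" by simp
    also have "exp (-2 :: real) \<le> 1 / 6"
    proof -
      have "(6::real) \<le> (1 + 2 / real 10) ^ 10" by (simp add: power_divide)
      also have "\<dots> \<le> exp 2" by (rule exp_ge_one_plus_x_over_n_power_n) auto
      finally show ?thesis by (simp add: exp_minus field_simps)
    qed
    finally have e: "1 / 2 \<le> 1 - 3 * exp (- (real k * p * card Z))" by simp
    have "G \<le> (1 - 6 * (real k * p)\<^sup>2) ^ card Z * (1 - 3 * exp (- (real k * p * card Z))) / 4"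
    proof -
      have "(1 - 6 * (real k * p)\<^sup>2) ^ n * (1 / 2) \<le>
        (1 - 6 * (real k * p)\<^sup>2) ^ card Z * (1 - 3 * exp (- (real k * p * card Z)))"
        using q e card_Z(2) by (intro mult_mono power_decreasing) auto
      then show ?thesis by (simp add: G_def)
    qed
    also have "\<dots> \<le> prob p (F i) (\<lambda>E. good i E)"
      unfolding good_def by (rule four_stars.prob_separated_parities[OF four_stars[OF i] kp])
    finally show ?thesis .
  qed
  have "(1 - p * (4 * real m * real k)\<^sup>2) * (1 - exp (- (real m * G))) \<le>
    (1 - p) ^ card inner_edges * (1 - (1 - G) ^ m)"
  proof (rule mult_mono)
    have "real (card inner_edges) \<le> (4 * real m * real k)\<^sup>2"
      using card_inner by (metis of_nat_le_iff of_nat_mult of_nat_numeral of_nat_power)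
    then have "p * real (card inner_edges) \<le> p * (4 * real m * real k)\<^sup>2"
      using p by (intro mult_left_mono) auto
    then show "1 - p * (4 * real m * real k)\<^sup>2 \<le> (1 - p) ^ card inner_edges"
      using Bernoulli_inequality[of "- p" "card inner_edges"] p by (simp add: mult.commute)
    show "1 - exp (- (real m * G)) \<le> 1 - (1 - G) ^ m"
      using one_minus_power_le_exp[OF G(2), of m] by simp
  qed (use p G in auto)
  also have "\<dots> \<le> prob p outer_edges (\<lambda>E. E \<inter> inner_edges = {} \<and> (\<exists>i<m. good i E))"
    by (rule prob_second_stage[OF g])
  also have "\<dots> \<le> prob p outer_edges (\<lambda>E. \<not> reconstructible 2 n (E1 \<union> E))"
    using p second_stage_not_reconstructible by (intro bexp_mono) auto
  finally show ?thesis .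
qed

end

subsection \<open>The dense regime\<close>

text \<open>The second-stage bound is uniform over all successful outcomes of the first stage, so
  exposing \<open>U\<close> and then the remaining pairs multiplies the two bounds.\<close>

lemma (in stage_one) dense_bound:
  assumes kp: "real k * p \<le> 1 / 20" and big: "2 \<le> real k * p * real (n - 2 * \<alpha> - 4 * m * k)"
    and small: "p * (4 * real m * real k)\<^sup>2 \<le> 1"
    and \<mu>: "\<mu> = (\<Sum>t\<in>P. prob p U (\<lambda>E. cand E t))" "\<mu> > 0" "4 * real m \<le> \<mu>"
  defines "G \<equiv> (1 - 6 * (real k * p)\<^sup>2) ^ n / 8" and "\<Delta> \<equiv> 1 / (1 - p) ^ 4"
  shows "(1 - 4 * (1 / \<mu> + (\<Delta> - 1)) - \<Delta> * \<mu>\<^sup>2 * (16 * ((real k)\<^sup>2 / b + 2 * \<alpha> * (real k * p)\<^sup>2))) *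
    ((1 - p * (4 * real m * real k)\<^sup>2) * (1 - exp (- (real m * G)))) \<le>
    nonrec_prob n p" (is "?F * ?H \<le> _")
proof -
  define W where "W = all_edges n - U"
  have kp0: "0 \<le> real k * p" using p by simp
  have sq: "(real k * p)\<^sup>2 \<le> (1/20)\<^sup>2" using kp kp0 by (intro power_mono) auto
  then have "0 \<le> G" by (simp add: G_def power2_eq_square)
  then have H: "0 \<le> ?H" using small by simp
  let ?Q = "\<lambda>E1. \<exists>c S. first_stage n (2 * \<alpha>) m k p E1 c S"
  have sec: "of_bool (?Q E1) * ?H \<le> prob p W (\<lambda>E2. \<not> reconstructible 2 n (E1 \<union> E2))" for E1
  proof (cases "?Q E1")
    case True
    then obtain c S where fs: "first_stage n (2 * \<alpha>) m k p E1 c S" by blast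
    have "W = first_stage.outer_edges n (2 * \<alpha>)"
      by (simp add: W_def U_def first_stage.outer_edges_def[OF fs])
    then show ?thesis
      using first_stage.prob_second_stage_bound[OF fs kp big small] True by (simp add: G_def)
  next
    case False
    then show ?thesis using p by (auto intro!: bexp_nonneg)
  qed
  have "?F * ?H \<le> prob p U (\<lambda>E. ?Q E) * ?H"
    unfolding \<Delta>_def by (intro mult_right_mono prob_first_stage[OF \<mu>] H)
  also have "\<dots> = bexp p U (\<lambda>E. of_bool (?Q E) * ?H)"
    using bexp_cmult[of p U ?H "\<lambda>E. of_bool (?Q E)"] by (simp only: mult.commute)
  also have "\<dots> \<le> bexp p U (\<lambda>E1. prob p W (\<lambda>E2. \<not> reconstructible 2 n (E1 \<union> E2)))"
    using p by (intro bexp_mono sec) auto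
  also have "\<dots> = prob p (U \<union> W) (\<lambda>E. \<not> reconstructible 2 n E)"
    by (intro bexp_union[symmetric]) (auto simp: W_def)
  also have "U \<union> W = all_edges n" using touching_subset by (auto simp: W_def U_def)
  finally show ?thesis by (simp add: Gnp_prob_eq_bexp)
qed

text \<open>Pigeonhole: by Chebyshev at least half of the binomial mass lies within
  \<open>d / 20\<close> of the mean, among at most \<open>3 * d\<close> integers, so one of these
  has mass at least \<open>1 / (6 * d)\<close>. The mass outside is at most \<open>400 / d\<close>,
  hence \<open>d \<ge> 800\<close>.\<close>

lemma likely_degree:
  fixes p d :: real
  assumes p: "0 < p" "p < 1" and d: "800 \<le> d" and b: "19/20 * d \<le> real b * p" "real b * p \<le> d"
  obtains k where "9/10 * d \<le> real k" "real k \<le> 21/20 * d" "1 / (6 * d) \<le> binom_prob b k p"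
proof -
  define K where "K = {k. \<bar>real k - real b * p\<bar> < d / 20}"
  have Ksub: "K \<subseteq> {..nat \<lfloor>2 * d\<rfloor>}"
  proof
    fix k assume "k \<in> K"
    then have "\<bar>real k - real b * p\<bar> < d / 20" by (simp add: K_def)
    then have "real k < 2 * d" using b d by linarith
    then show "k \<in> {..nat \<lfloor>2 * d\<rfloor>}" by (simp add: le_nat_floor)
  qed
  then have fK: "finite K" using finite_subset by blast
  have "real (card K) \<le> real (nat \<lfloor>2 * d\<rfloor> + 1)" using card_mono[OF _ Ksub] by simp
  also have "\<dots> \<le> 3 * d" using d by linarith
  finally have cK: "real (card K) \<le> 3 * d" .
  have "prob p {..<b} (\<lambda>E. d / 20 \<le> \<bar>real (card E) - real b * p\<bar>) \<le>
    bexp p {..<b} (\<lambda>E. (real (card E) - real b * p)\<^sup>2) / (d / 20)\<^sup>2"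
    using p d by (intro bexp_chebyshev) auto
  also have "\<dots> = real b * p * (1 - p) / (d / 20)\<^sup>2"
    using bexp_binomial_moments(2)[of "{..<b}" p] by simp
  also have "\<dots> \<le> d / (d / 20)\<^sup>2"
  proof (rule divide_right_mono)
    have "real b * p * (1 - p) \<le> d * 1" using b p d by (intro mult_mono) auto
    then show "real b * p * (1 - p) \<le> d" by simp
  qed simp
  also have "\<dots> \<le> 1 / 2" using d by (simp add: power2_eq_square field_simps)
  finally have "1 / 2 \<le> prob p {..<b} (\<lambda>E. \<not> d / 20 \<le> \<bar>real (card E) - real b * p\<bar>)"
    by (subst bexp_not) auto
  also have "\<dots> = bexp p {..<b} (\<lambda>E. \<Sum>k\<in>K. of_bool (card E = k))"
    using fK by (intro bexp_cong) (auto simp: K_def of_bool_def)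
  also have "\<dots> = (\<Sum>k\<in>K. binom_prob b k p)"
    by (subst bexp_sum) (simp add: binom_prob_def)
  finally have half: "1 / 2 \<le> (\<Sum>k\<in>K. binom_prob b k p)" .
  have "\<exists>k\<in>K. 1 / (6 * d) \<le> binom_prob b k p"
  proof (rule ccontr)
    assume "\<not> ?thesis"
    then have lt: "binom_prob b k p < 1 / (6 * d)" if "k \<in> K" for k using that by force
    have "K \<noteq> {}" using half by auto
    then have "(\<Sum>k\<in>K. binom_prob b k p) < (\<Sum>k\<in>K. 1 / (6 * d))" using fK lt by (intro sum_strict_mono)
    also have "\<dots> = real (card K) / (6 * d)" by simp
    also have "\<dots> \<le> 3 * d / (6 * d)" using cK d by (intro divide_right_mono) auto
    also have "\<dots> = 1 / 2" using d by simp
    finally show False using half by simp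
  qed
  then obtain k where k: "k \<in> K" "1 / (6 * d) \<le> binom_prob b k p" by blast
  have "\<bar>real k - real b * p\<bar> < d / 20" using k(1) by (simp add: K_def)
  then have "9/10 * d \<le> real k" "real k \<le> 21/20 * d" using b by linarith+
  then show ?thesis using k(2) that by blast
qed

lemma (in stage_one) card_touchA_le:
  assumes "t \<in> P" shows "card (touchA (V t)) \<le> 4 * \<alpha>"
proof -
  have "touchA (V t) \<subseteq> touching (2 * \<alpha>) (V t)"
    by (auto simp: touchA_def inA_def touching_def all_edges_def)
  then have "card (touchA (V t)) \<le> card (touching (2 * \<alpha>) (V t))" by (intro card_mono) auto
  also have "\<dots> \<le> 4 * \<alpha>"
    using card_touching_le[OF V_props(3)[OF assms], of "2 * \<alpha>"] V_props(2)[OF assms] by simp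
  finally show ?thesis .
qed

text \<open>The number of candidate pairs inspected is tuned so that their expected number \<open>\<mu>\<close> is of
  order \<open>m\<close>, whatever the value of the point probability of the degree \<open>k\<close>.\<close>

lemma dense_bound_explicit:
  fixes p d D :: real and n \<alpha> m :: nat
  defines "d \<equiv> real n * p"
  assumes p: "0 < p" "p < 1/2" and d: "800 \<le> d" "d \<le> D" and m: "1 \<le> m"
    and \<alpha>: "40 * real \<alpha> \<le> real n" "4 * real \<alpha> * D / real n \<le> 1 / 2"
    and size: "288 * real m * D * real n + 2 \<le> (real \<alpha>)\<^sup>2"
    and md: "20 * real m * D \<le> real n"
    and DD: "22 * D\<^sup>2 \<le> real n"
    and small: "20 * (real m)\<^sup>2 * D ^ 3 / real n \<le> 1"
  shows "(1 - 4 * (1 / (4 * real m) + (1 / (1 - D / real n) ^ 4 - 1)) -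
      1 / (1 - D / real n) ^ 4 * 1296 * (real m)\<^sup>2 * (4 * D\<^sup>2 / real n + 4 * real \<alpha> * D ^ 4 / (real n)\<^sup>2)) *
      ((1 - 20 * (real m)\<^sup>2 * D ^ 3 / real n) * (1 - exp (- (real m * exp (- 7.3 * D ^ 4 / real n) / 8))))
    \<le> nonrec_prob n p"
    (is "?F * (?H1 * ?H2) \<le> _")
proof -
  have D: "800 \<le> D" "0 < D" using d by auto
  have n: "0 < real n" using DD D by (smt (verit) zero_less_power)
  have pd: "p = d / real n" using n by (simp add: d_def)
  have pD: "p \<le> D / real n" using d n by (simp add: pd divide_right_mono)
  have Dn: "D / real n < 1"
  proof -
    have "D * 1 < D * 22 * D" using D by simp
    then have "D < real n" using DD by (simp add: power2_eq_square)
    then show ?thesis using n by simp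
  qed
  define b where "b = n - 2 * \<alpha>"
  have an: "2 * \<alpha> < n" using \<alpha>(1) n by linarith
  have bn: "19/20 * real n \<le> real b" "real b \<le> real n" using \<alpha>(1) an by (simp_all add: b_def of_nat_diff)
  have bp: "19/20 * d \<le> real b * p" "real b * p \<le> d"
    using mult_right_mono[OF bn(1), of p] mult_right_mono[OF bn(2), of p] p by (simp_all add: d_def)
  obtain k where k: "9/10 * d \<le> real k" "real k \<le> 21/20 * d" "1 / (6 * d) \<le> binom_prob b k p"
    using likely_degree[OF p(1) _ d(1) bp] p by auto
  define \<pi> where "\<pi> = binom_prob b k p"
  have \<pi>: "0 < \<pi>" "\<pi> \<le> 1" "1 / (6 * d) \<le> \<pi>"
  proof -
    show "1 / (6 * d) \<le> \<pi>" using k(3) by (simp add: \<pi>_def)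
    then show "0 < \<pi>" using d by (smt (verit) divide_pos_pos)
    show "\<pi> \<le> 1" unfolding \<pi>_def binom_prob_def using p by (intro bexp_le_1) auto
  qed
  have kD: "real k \<le> 21/20 * D" using k(2) d by simp
  have pp: "0 < p * \<pi>\<^sup>2" "p * \<pi>\<^sup>2 \<le> 1" using p \<pi> mult_le_one[of p "\<pi>\<^sup>2"] power_le_one[of \<pi> 2] by auto
  \<comment> \<open>Chosen so that \<open>M * p * \<pi>\<^sup>2\<close> is \<open>8 * m\<close> up
    to rounding. Isolation inside A costs at most a factor 2, so \<open>\<mu>\<close> ends up
    between \<open>4 * m\<close> and \<open>9 * m\<close>.\<close>
  define M where "M = nat \<lceil>8 * real m / (p * \<pi>\<^sup>2)\<rceil>"
  have "0 \<le> 8 * real m / (p * \<pi>\<^sup>2)" using pp by simp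
  then have M: "8 * real m / (p * \<pi>\<^sup>2) \<le> real M" "real M \<le> 8 * real m / (p * \<pi>\<^sup>2) + 1"
    unfolding M_def by linarith+
  \<comment> \<open>So many pairs must exist between the halves of A;
    \<open>\<pi> \<ge> 1 / (6 * d)\<close> gives the constant 288 as 8 times 36.\<close>
  have M\<alpha>: "M \<le> \<alpha> * \<alpha>"
  proof -
    have "1 / (36 * d\<^sup>2) \<le> \<pi>\<^sup>2"
      using power_mono[OF \<pi>(3), of 2] d by (simp add: power_divide power_mult_distrib)
    then have "p * (1 / (36 * d\<^sup>2)) \<le> p * \<pi>\<^sup>2" using p by (intro mult_left_mono) auto
    moreover have "p * (1 / (36 * d\<^sup>2)) = 1 / (36 * d * real n)"
      using d n by (simp add: pd power2_eq_square)
    ultimately have "1 / (36 * d * real n) \<le> p * \<pi>\<^sup>2" by simp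
    then have "8 * real m / (p * \<pi>\<^sup>2) \<le> 8 * real m / (1 / (36 * d * real n))"
      using d n pp by (intro divide_left_mono) auto
    also have "\<dots> = 288 * real m * d * real n" by simp
    also have "\<dots> \<le> 288 * real m * D * real n" using d by (intro mult_right_mono mult_left_mono) auto
    finally have "real M \<le> (real \<alpha>)\<^sup>2" using M(2) size by linarith
    then have "real M \<le> real (\<alpha> * \<alpha>)" by (simp add: power2_eq_square)
    then show ?thesis by (simp only: of_nat_le_iff)
  qed
  have "card ({..<\<alpha>} \<times> {\<alpha>..<2*\<alpha>}) = \<alpha> * \<alpha>" by (simp add: card_cartesian_product)
  then obtain P where P: "P \<subseteq> {..<\<alpha>} \<times> {\<alpha>..<2*\<alpha>}" "card P = M" "finite P"
    using M\<alpha> obtain_subset_with_card_n[of M "{..<\<alpha>} \<times> {\<alpha>..<2*\<alpha>}"] by metis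
  interpret s1: stage_one n \<alpha> k p P
    using an p P by unfold_locales auto
  let ?pc = "\<lambda>t. prob p s1.U (\<lambda>E. s1.cand E t)"
  have bb: "s1.b = b" "s1.\<pi> = \<pi>" unfolding s1.b_def s1.\<pi>_def \<pi>_def b_def by (rule refl)+
  define \<mu> where "\<mu> = (\<Sum>t\<in>P. ?pc t)"
  \<comment> \<open>At most \<open>4 * \<alpha>\<close> possible edges of A meet a pair, so by
    Bernoulli's inequality those other than the pair itself are all absent with probability at least
    1/2.\<close>
  have pc: "p * \<pi>\<^sup>2 / 2 \<le> ?pc t"
    "?pc t \<le> p * \<pi>\<^sup>2" if t: "t \<in> P" for t
  proof -
    let ?c = "card (s1.touchA (s1.V t)) - 1"
    have "real ?c * p \<le> 4 * real \<alpha> * (D / real n)"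
      using s1.card_touchA_le[OF t] pD p by (intro mult_mono) auto
    then have "1 / 2 \<le> 1 - real ?c * p" using \<alpha>(2) by simp
    also have "\<dots> \<le> (1 - p) ^ ?c"
      using Bernoulli_inequality[of "- p" ?c] p by simp
    finally have "1 / 2 \<le> (1 - p) ^ ?c" .
    moreover have "(1 - p) ^ ?c \<le> 1" using p by (simp add: power_le_one)
    ultimately have "p * \<pi>\<^sup>2 * (1 / 2) \<le> p * \<pi>\<^sup>2 * (1 - p) ^ ?c" "p * \<pi>\<^sup>2 * (1 - p) ^ ?c \<le> p * \<pi>\<^sup>2 * 1"
      using pp by (intro mult_left_mono; simp)+
    then show "p * \<pi>\<^sup>2 / 2 \<le> ?pc t"
      "?pc t \<le> p * \<pi>\<^sup>2"
      unfolding s1.prob_cand[OF t] bb by (simp_all add: mult_ac)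
  qed
  have \<mu>l: "4 * real m \<le> \<mu>"
  proof -
    have "4 * real m = 8 * real m / (p * \<pi>\<^sup>2) * (p * \<pi>\<^sup>2 / 2)" using p(1) \<pi>(1) by (simp add: field_simps)
    also have "\<dots> \<le> real M * (p * \<pi>\<^sup>2 / 2)" using M(1) pp by (intro mult_right_mono) auto
    also have "\<dots> = (\<Sum>t\<in>P. p * \<pi>\<^sup>2 / 2)" by (simp add: P(2))
    also have "\<dots> \<le> \<mu>" unfolding \<mu>_def by (intro sum_mono pc)
    finally show ?thesis .
  qed
  have \<mu>u: "\<mu> \<le> 9 * real m"
  proof -
    have "\<mu> \<le> (\<Sum>t\<in>P. p * \<pi>\<^sup>2)" unfolding \<mu>_def by (intro sum_mono pc)
    also have "\<dots> = real M * (p * \<pi>\<^sup>2)" by (simp add: P(2))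
    also have "\<dots> \<le> (8 * real m / (p * \<pi>\<^sup>2) + 1) * (p * \<pi>\<^sup>2)" using M(2) pp by (intro mult_right_mono) auto
    also have "\<dots> = 8 * real m + p * \<pi>\<^sup>2" using p(1) \<pi>(1) by (simp add: field_simps)
    also have "\<dots> \<le> 9 * real m" using pp m by simp
    finally show ?thesis .
  qed
  have \<mu>0: "\<mu> > 0" using \<mu>l m by linarith
  have kp0: "0 \<le> real k * p" using p by simp
  have kpD: "real k * p \<le> 21/20 * D\<^sup>2 / real n"
  proof -
    have "real k * p \<le> (21/20 * D) * (D / real n)" using kD pD p D by (intro mult_mono) auto
    then show ?thesis by (simp add: power2_eq_square)
  qed
  have kp: "real k * p \<le> 1 / 20"
  proof -
    have "21/20 * D\<^sup>2 / real n \<le> 1 / 20" using DD n by (simp add: field_simps)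
    then show ?thesis using kpD by simp
  qed
  have mk: "4 * real m * real k \<le> 21 / 100 * real n"
  proof -
    have "4 * real m * real k \<le> 4 * real m * (21/20 * D)" using kD by (intro mult_left_mono) auto
    then show ?thesis using md by (simp add: algebra_simps)
  qed
  \<comment> \<open>A and the first layers together take less than half of the vertices.\<close>
  have big: "2 \<le> real k * p * real (n - 2 * \<alpha> - 4 * m * k)"
  proof -
    have "real (4 * m * k) \<le> 21 / 100 * real n" using mk by simp
    then have "real n / 2 \<le> real (n - 2 * \<alpha> - 4 * m * k)" using \<alpha>(1) by linarith
    then have "(9/10 * d * p) * (real n / 2) \<le> real k * p * real (n - 2 * \<alpha> - 4 * m * k)"
      using k(1) p d by (intro mult_mono) auto
    moreover have "(9/10 * d * p) * (real n / 2) = 9/20 * (d * d)" by (simp add: d_def)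
    moreover have "800 * 800 \<le> d * d" using d by (intro mult_mono) auto
    ultimately show ?thesis by linarith
  qed
  have sm: "p * (4 * real m * real k)\<^sup>2 \<le> 20 * (real m)\<^sup>2 * D ^ 3 / real n"
  proof -
    have "p * (4 * real m * real k)\<^sup>2 \<le> (D / real n) * (4 * real m * (21/20 * D))\<^sup>2"
      using pD p kD D by (intro mult_mono power_mono mult_left_mono) auto
    also have "\<dots> = 441 / 25 * ((real m)\<^sup>2 * D ^ 3 / real n)"
      by (simp add: power2_eq_square eval_nat_numeral mult_ac)
    also have "\<dots> \<le> 20 * ((real m)\<^sup>2 * D ^ 3 / real n)" using D n by (intro mult_right_mono) auto
    finally show ?thesis by simp
  qed
  have kp2: "(real k * p)\<^sup>2 \<le> 441/400 * D ^ 4 / (real n)\<^sup>2"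
    using power_mono[OF kpD kp0, of 2] by (simp add: power_mult_distrib power_divide flip: power_mult)
  define G where "G = (1 - 6 * (real k * p)\<^sup>2) ^ n / 8"
  \<comment> \<open>The factor 21/20 in the bound on \<open>k\<close> contributes its square
    441/400, and 6.6 times 441/400 is just below 7.3.\<close>
  have G: "exp (- 7.3 * D ^ 4 / real n) / 8 \<le> G"
  proof -
    have "(real k * p)\<^sup>2 \<le> (1/20)\<^sup>2" using kp kp0 by (intro power_mono) auto
    then have x: "6 * (real k * p)\<^sup>2 \<le> 1 / 20" by (simp add: power2_eq_square)
    have "(real k * p)\<^sup>2 * real n \<le> 441/400 * D ^ 4 / (real n)\<^sup>2 * real n"
      using kp2 by (intro mult_right_mono) auto
    also have "\<dots> = 441/400 * (D ^ 4 / real n)" using n by (simp add: power2_eq_square)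
    finally have "(real k * p)\<^sup>2 * real n \<le> 441/400 * (D ^ 4 / real n)" .
    moreover have "0 \<le> D ^ 4 / real n" using D n by simp
    ultimately have "6.6 * ((real k * p)\<^sup>2 * real n) \<le> 7.3 * (D ^ 4 / real n)" by linarith
    moreover have "- 1.1 * (6 * (real k * p)\<^sup>2) * real n = - (6.6 * ((real k * p)\<^sup>2 * real n))" by simp
    moreover have "- 7.3 * D ^ 4 / real n = - (7.3 * (D ^ 4 / real n))" by simp
    ultimately have "exp (- 7.3 * D ^ 4 / real n) \<le> exp (- 1.1 * (6 * (real k * p)\<^sup>2) * real n)"
      by (simp only: exp_le_cancel_iff neg_le_iff_le)
    also have "\<dots> \<le> (1 - 6 * (real k * p)\<^sup>2) ^ n"
      by (rule one_minus_power_ge_exp[OF _ x]) simp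
    finally show ?thesis by (simp add: G_def)
  qed
  let ?D1 = "1 / (1 - p) ^ 4" and ?D2 = "1 / (1 - D / real n) ^ 4"
  have \<Delta>: "?D1 \<le> ?D2" "0 \<le> ?D1"
    using pD Dn p by (auto intro!: divide_left_mono power_mono mult_pos_pos)
  let ?F' = "1 - 4 * (1 / \<mu> + (?D1 - 1)) - ?D1 * \<mu>\<^sup>2 * (16 * ((real k)\<^sup>2 / b + 2 * \<alpha> * (real k * p)\<^sup>2))"
  have F: "?F \<le> ?F'"
  proof -
    have 1: "1 / \<mu> \<le> 1 / (4 * real m)" using \<mu>l m by (intro divide_left_mono) auto
    have k2: "(real k)\<^sup>2 \<le> 441/400 * D\<^sup>2"
      using power_mono[OF kD, of 2] by (simp add: power_mult_distrib power_divide)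
    have "(real k)\<^sup>2 / b \<le> (441/400 * D\<^sup>2) / (19/20 * real n)"
      using k2 bn n by (intro frac_le) auto
    also have "\<dots> \<le> 4 * D\<^sup>2 / real n" using n by (simp add: field_simps)
    finally have 2: "(real k)\<^sup>2 / b \<le> 4 * D\<^sup>2 / real n" .
    have "2 * real \<alpha> * (real k * p)\<^sup>2 \<le> 2 * real \<alpha> * (441/400 * D ^ 4 / (real n)\<^sup>2)"
      using kp2 by (intro mult_left_mono) auto
    also have "\<dots> = 441/200 * (real \<alpha> * D ^ 4 / (real n)\<^sup>2)" by simp
    also have "\<dots> \<le> 4 * (real \<alpha> * D ^ 4 / (real n)\<^sup>2)" using D by (intro mult_right_mono) auto
    finally have 3: "2 * real \<alpha> * (real k * p)\<^sup>2 \<le> 4 * real \<alpha> * D ^ 4 / (real n)\<^sup>2" by simp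
    have "\<mu>\<^sup>2 \<le> (9 * real m)\<^sup>2" using \<mu>u \<mu>0 by (intro power_mono) auto
    then have "?D1 * \<mu>\<^sup>2 * (16 * ((real k)\<^sup>2 / b + 2 * \<alpha> * (real k * p)\<^sup>2)) \<le>
      ?D2 * (9 * real m)\<^sup>2 * (16 * (4 * D\<^sup>2 / real n + 4 * real \<alpha> * D ^ 4 / (real n)\<^sup>2))"
      using 2 3 \<Delta> by (intro mult_mono add_mono mult_nonneg_nonneg) auto
    \<comment> \<open>1296 is 16 from the union bound times the square of 9 from
      \<open>\<mu> \<le> 9 * m\<close>.\<close>
    also have "\<dots> = ?D2 * 1296 * (real m)\<^sup>2 * (4 * D\<^sup>2 / real n + 4 * real \<alpha> * D ^ 4 / (real n)\<^sup>2)"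
      by (simp add: power_mult_distrib)
    finally show ?thesis
      by (intro diff_mono mult_left_mono add_mono order_refl 1 \<Delta>(1)) simp_all
  qed
  let ?H1' = "1 - p * (4 * real m * real k)\<^sup>2" and ?H2' = "1 - exp (- (real m * G))"
  have H1: "0 \<le> ?H1" "?H1 \<le> ?H1'" using small sm by auto
  have H2: "0 \<le> ?H2" "?H2 \<le> ?H2'"
    using mult_left_mono[OF G, of "real m"] by simp_all
  have main: "?F' * (?H1' * ?H2') \<le> nonrec_prob n p"
    unfolding G_def
    by (rule s1.dense_bound[OF kp big _ \<mu>_def \<mu>0 \<mu>l, unfolded bb]) (use sm small in linarith)
  show ?thesis
  \<comment> \<open>The factors can be compared one by one if the first is nonnegative; if not, the
    left side is at most 0.\<close>
  proof (cases "0 \<le> ?F")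
    case True
    then have "?F * (?H1 * ?H2) \<le> ?F' * (?H1' * ?H2')"
      using F H1 H2 by (intro mult_mono) auto
    then show ?thesis using main by simp
  next
    case False
    then have "?F * (?H1 * ?H2) \<le> 0" using H1 H2 by (intro mult_nonpos_nonneg) auto
    moreover have "0 \<le> nonrec_prob n p"
      unfolding Gnp_prob_eq_bexp using p by (intro bexp_nonneg) auto
    ultimately show ?thesis by simp
  qed
qed

theorem dense_regime:
  fixes p :: "nat \<Rightarrow> real"
  assumes up: "\<forall>\<^sub>F n in sequentially. p n \<le> 1/3 * real n powr (-3/4) * ln (real n) powr (1/4)"
    and low: "\<forall>\<^sub>F n in sequentially. ln (real n) / (10 * real n) \<le> p n"
  shows "(\<lambda>n. nonrec_prob n (p n)) \<longlonglongrightarrow> 1"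
proof -
  define D where "D n = 1/3 * real n powr (1/4) * ln (real n) powr (1/4)" for n :: nat
  \<comment> \<open>The exponent 7/10 lies between 0.68 and 0.75: \<open>\<alpha>\<^sup>2\<close>
    must dominate \<open>m * D * n\<close> to provide enough pairs, and
    \<open>\<alpha> * D / n\<close> must be small for candidate edges to be isolated in A.\<close>
  define \<alpha> where "\<alpha> n = nat \<lfloor>real n powr (7/10)\<rfloor>" for n :: nat
  \<comment> \<open>The exponent must exceed \<open>7.3 / 81\<close>, about 0.0901, for
    \<open>T5\<close> to vanish and stay below 1/8 for \<open>T4\<close> to vanish; 11/100 does
    both.\<close>
  define m where "m n = nat \<lceil>real n powr (11/100)\<rceil>" for n :: nat
  define T1 where "T1 n = 1 / (4 * real (m n))" for n
  define T2 where "T2 n = 1 / (1 - D n / real n) ^ 4" for n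
  define T3 where "T3 n = (real (m n))\<^sup>2 * (4 * (D n)\<^sup>2 / real n + 4 * real (\<alpha> n) * D n ^ 4 / (real n)\<^sup>2)" for n
  define T4 where "T4 n = 20 * (real (m n))\<^sup>2 * D n ^ 3 / real n" for n
  define T5 where "T5 n = exp (- (real (m n) * exp (- 7.3 * D n ^ 4 / real n) / 8))" for n
  define B where "B n = (1 - 4 * (T1 n + (T2 n - 1)) - T2 n * 1296 * T3 n) * ((1 - T4 n) * (1 - T5 n))" for n
  have D0: "0 \<le> D n" for n by (simp add: D_def)
  have \<alpha>: "real (\<alpha> n) \<le> real n powr (7/10)" "real n powr (7/10) - 1 \<le> real (\<alpha> n)" for n
    using powr_ge_zero[of "real n" "7/10"] unfolding \<alpha>_def by linarith+
  have ml: "real n powr (11/100) \<le> real (m n)" for n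
    unfolding m_def by linarith
  have mu: "\<forall>\<^sub>F n in sequentially. real (m n) \<le> 2 * real n powr (11/100)"
  proof -
    have "\<forall>\<^sub>F n::nat in sequentially. 1 \<le> real n powr (11/100)" by real_asymp
    then show ?thesis
    proof eventually_elim
      case (elim n)
      then show ?case unfolding m_def by linarith
    qed
  qed
  have m1: "\<forall>\<^sub>F n in sequentially. 1 \<le> m n"
  proof -
    have "\<forall>\<^sub>F n::nat in sequentially. 1 \<le> real n powr (11/100)" by real_asymp
    then show ?thesis
    proof eventually_elim
      case (elim n)
      then have "1 \<le> real (m n)" using ml[of n] by linarith
      then show ?case by simp
    qed
  qed
  have T1: "T1 \<longlonglongrightarrow> 0"
  proof (rule tendsto_sandwich[OF _ _ tendsto_const])
    show "(\<lambda>n. 1 / (4 * real n powr (11/100))) \<longlonglongrightarrow> 0" by real_asymp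
    show "\<forall>\<^sub>F n in sequentially. T1 n \<le> 1 / (4 * real n powr (11/100))"
      using eventually_gt_at_top[of 0]
    proof eventually_elim
      case (elim n)
      then have "0 < real n powr (11/100)" by simp
      then show ?case unfolding T1_def using ml[of n] by (intro frac_le) auto
    qed
  qed (auto simp: T1_def)
  have T2: "T2 \<longlonglongrightarrow> 1" unfolding T2_def D_def by real_asymp
  have T3: "T3 \<longlonglongrightarrow> 0"
  proof (rule tendsto_sandwich[OF _ _ tendsto_const])
    show "(\<lambda>n. (2 * real n powr (11/100))\<^sup>2 * (4 * (D n)\<^sup>2 / real n + 4 * real n powr (7/10) * D n ^ 4 / (real n)\<^sup>2)) \<longlonglongrightarrow> 0"
      unfolding D_def by real_asymp
    show "\<forall>\<^sub>F n in sequentially. T3 n \<le>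
      (2 * real n powr (11/100))\<^sup>2 * (4 * (D n)\<^sup>2 / real n + 4 * real n powr (7/10) * D n ^ 4 / (real n)\<^sup>2)"
      using mu
    proof eventually_elim
      case (elim n)
      then show ?case unfolding T3_def using \<alpha>(1)[of n] D0[of n]
        by (intro mult_mono add_mono power_mono divide_right_mono mult_left_mono mult_right_mono) auto
    qed
    show "\<forall>\<^sub>F n in sequentially. 0 \<le> T3 n" using D0 by (auto simp: T3_def)
  qed
  have T4: "T4 \<longlonglongrightarrow> 0"
  proof (rule tendsto_sandwich[OF _ _ tendsto_const])
    show "(\<lambda>n. 20 * (2 * real n powr (11/100))\<^sup>2 * D n ^ 3 / real n) \<longlonglongrightarrow> 0"
      unfolding D_def by real_asymp
    show "\<forall>\<^sub>F n in sequentially. T4 n \<le> 20 * (2 * real n powr (11/100))\<^sup>2 * D n ^ 3 / real n"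
      using mu
    proof eventually_elim
      case (elim n)
      then show ?case unfolding T4_def using D0[of n]
        by (intro divide_right_mono mult_right_mono mult_left_mono power_mono) auto
    qed
    show "\<forall>\<^sub>F n in sequentially. 0 \<le> T4 n" using D0 by (auto simp: T4_def)
  qed
  have T5: "T5 \<longlonglongrightarrow> 0"
  proof (rule tendsto_sandwich[OF _ _ tendsto_const])
    show "(\<lambda>n. exp (- (real n powr (1/100) / 8))) \<longlonglongrightarrow> 0" by real_asymp
    show "\<forall>\<^sub>F n in sequentially. T5 n \<le> exp (- (real n powr (1/100) / 8))"
      using eventually_ge_at_top[of 2]
    proof eventually_elim
      case (elim n)
      then have n: "1 \<le> real n" "0 < ln (real n)" by auto
      have "(real n powr (1/4)) ^ 4 = real n" "(ln (real n) powr (1/4)) ^ 4 = ln (real n)"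
        using n by (simp_all add: powr_power)
      \<comment> \<open>The fourth power of the factor 1/3 in the upper bound on \<open>p\<close>
        produces the 81.\<close>
      then have "D n ^ 4 / real n = ln (real n) / 81"
        using n by (simp add: D_def power_mult_distrib power_divide)
      moreover have "- 7.3 * D n ^ 4 / real n = - 7.3 * (D n ^ 4 / real n)" by simp
      ultimately have "exp (- 7.3 * D n ^ 4 / real n) = real n powr (- 7.3 / 81)"
        using n by (simp add: powr_def)
      then have "real n powr (11/100) * exp (- 7.3 * D n ^ 4 / real n) = real n powr (11/100 - 7.3 / 81)"
        by (simp flip: powr_add)
      moreover have "real n powr (1/100) \<le> real n powr (11/100 - 7.3 / 81)"
        using n by (intro powr_mono) simp_all
      moreover have "real n powr (11/100) * exp (- 7.3 * D n ^ 4 / real n) \<le> real (m n) * exp (- 7.3 * D n ^ 4 / real n)"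
        using ml[of n] by (intro mult_right_mono) auto
      ultimately show ?case unfolding T5_def by simp
    qed
  qed (auto simp: T5_def)
  have B: "B \<longlonglongrightarrow> (1 - 4 * (0 + (1 - 1)) - 1 * 1296 * 0) * ((1 - 0) * (1 - 0))"
    unfolding B_def by (intro tendsto_intros T1 T2 T3 T4 T5)
  have one: "(1 - 4 * (0 + (1 - 1)) - 1 * 1296 * 0) * ((1 - 0) * (1 - 0)) = (1::real)" by simp
  have "\<forall>\<^sub>F n::nat in sequentially. 8000 \<le> ln (real n)" by real_asymp
  moreover have "\<forall>\<^sub>F n in sequentially. D n / real n < 1/2" unfolding D_def by real_asymp
  moreover have "\<forall>\<^sub>F n::nat in sequentially. 40 * real n powr (7/10) \<le> real n" by real_asymp
  moreover have "\<forall>\<^sub>F n in sequentially. 4 * real n powr (7/10) * D n / real n \<le> 1/2" unfolding D_def by real_asymp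
  moreover have "\<forall>\<^sub>F n in sequentially. 288 * (2 * real n powr (11/100)) * D n * real n + 2 \<le> (real n powr (7/10) - 1)\<^sup>2"
    unfolding D_def by real_asymp
  moreover have "\<forall>\<^sub>F n::nat in sequentially. 1 \<le> real n powr (7/10)" by real_asymp
  moreover have "\<forall>\<^sub>F n in sequentially. 20 * (2 * real n powr (11/100)) * D n \<le> real n" unfolding D_def by real_asymp
  moreover have "\<forall>\<^sub>F n in sequentially. 22 * (D n)\<^sup>2 \<le> real n" unfolding D_def by real_asymp
  moreover have "\<forall>\<^sub>F n in sequentially. T4 n \<le> 1"
    using order_tendstoD(2)[OF T4, of 1] by (auto elim: eventually_mono)
  moreover have "\<forall>\<^sub>F n::nat in sequentially. 0 < n" by (rule eventually_gt_at_top)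
  ultimately have ev: "\<forall>\<^sub>F n in sequentially. 0 \<le> p n \<and> p n \<le> 1 \<and>
      B n \<le> nonrec_prob n (p n)"
    using m1 mu up low
  proof eventually_elim
    case (elim n)
    have n: "0 < real n" using elim(10) by simp
    have "real n * (real n powr (-3/4)) = real n powr (1/4)"
      using n by (subst powr_mult_base) auto
    then have D: "real n * (1/3 * real n powr (-3/4) * ln (real n) powr (1/4)) = D n"
      by (simp add: D_def)
    have pD: "real n * p n \<le> D n"
      unfolding D[symmetric] using elim(13) n by (intro mult_left_mono) simp_all
    have pl: "ln (real n) / 10 \<le> real n * p n" using elim(14) n by (simp add: field_simps)
    have p800: "800 \<le> real n * p n" using pl elim(1) by simp
    have "0 < real n * p n" using p800 by linarith
    then have p: "0 < p n" using n by (simp add: zero_less_mult_iff)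
    have "p n \<le> D n / real n" using pD n by (simp add: field_simps)
    then have p2: "p n < 1/2" using elim(2) by linarith
    have "B n = (1 - 4 * (1 / (4 * real (m n)) + (1 / (1 - D n / real n) ^ 4 - 1)) -
        1 / (1 - D n / real n) ^ 4 * 1296 * (real (m n))\<^sup>2 *
        (4 * (D n)\<^sup>2 / real n + 4 * real (\<alpha> n) * D n ^ 4 / (real n)\<^sup>2)) *
      ((1 - 20 * (real (m n))\<^sup>2 * D n ^ 3 / real n) *
       (1 - exp (- (real (m n) * exp (- 7.3 * D n ^ 4 / real n) / 8))))"
      unfolding B_def T1_def T2_def T3_def T4_def T5_def by (simp only: mult.assoc)
    also have "\<dots> \<le> nonrec_prob n (p n)"
    proof (rule dense_bound_explicit[OF p p2 p800 pD elim(11)])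
      show "40 * real (\<alpha> n) \<le> real n" using \<alpha>(1)[of n] elim(3) by linarith
      have "4 * real (\<alpha> n) * D n / real n \<le> 4 * real n powr (7/10) * D n / real n"
        using \<alpha>(1)[of n] D0[of n] by (intro divide_right_mono mult_right_mono mult_left_mono) auto
      then show "4 * real (\<alpha> n) * D n / real n \<le> 1 / 2" using elim(4) by linarith
      have "288 * real (m n) * D n * real n \<le> 288 * (2 * real n powr (11/100)) * D n * real n"
        using elim(12) D0[of n] by (intro mult_right_mono mult_left_mono) auto
      moreover have "(real n powr (7/10) - 1)\<^sup>2 \<le> (real (\<alpha> n))\<^sup>2"
        using \<alpha>(2)[of n] elim(6) by (intro power_mono) auto
      ultimately show "288 * real (m n) * D n * real n + 2 \<le> (real (\<alpha> n))\<^sup>2" using elim(5) by linarith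
      have "20 * real (m n) * D n \<le> 20 * (2 * real n powr (11/100)) * D n"
        using elim(12) D0[of n] by (intro mult_right_mono mult_left_mono) auto
      then show "20 * real (m n) * D n \<le> real n" using elim(7) by linarith
      show "22 * (D n)\<^sup>2 \<le> real n" by (rule elim(8))
      show "20 * (real (m n))\<^sup>2 * D n ^ 3 / real n \<le> 1" using elim(9) by (simp add: T4_def)
    qed
    finally show ?case using p p2 by simp
  qed
  show ?thesis
  proof (rule tendsto_sandwich[OF _ _ B[unfolded one] tendsto_const])
    show "\<forall>\<^sub>F n in sequentially. B n \<le> nonrec_prob n (p n)"
      using ev by eventually_elim auto
    show "\<forall>\<^sub>F n in sequentially. nonrec_prob n (p n) \<le> 1"
      using ev by eventually_elim (auto intro: Gnp_prob_le_1)
  qed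
qed

text \<open>The two regimes may alternate along the sequence, so each is applied to \<open>p\<close> redefined
  off its own range.\<close>

theorem theorem1p4:
  fixes p :: "nat \<Rightarrow> real"
  assumes "\<forall>\<^sub>F n in sequentially. p n \<le> 1/3 * real n powr (-3/4) * ln (real n) powr (1/4)"
    and "filterlim (\<lambda>n. p n / real n powr (-5/4)) at_top sequentially"
  shows "(\<lambda>n. Gnp_prob n (p n) (\<lambda>E. \<not> reconstructible 2 n E)) \<longlonglongrightarrow> 1"
proof -
  define t where "t n = ln (real n) / (10 * real n)" for n :: nat
  define s d where "s n = min (p n) (t n)" and "d n = max (p n) (t n)" for n
  let ?G = "\<lambda>p n. Gnp_prob n (p n) (\<lambda>E. \<not> reconstructible 2 n E)"
  have "filterlim (\<lambda>n. t n / real n powr (-5/4)) at_top sequentially"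
    unfolding t_def by real_asymp
  then have "filterlim (\<lambda>n. s n / real n powr (-5/4)) at_top sequentially"
    using assms(2) unfolding filterlim_at_top
  proof (intro allI)
    fix Z :: real
    assume "\<forall>Z. \<forall>\<^sub>F n in sequentially. Z \<le> t n / real n powr (-5/4)"
      "\<forall>Z. \<forall>\<^sub>F n in sequentially. Z \<le> p n / real n powr (-5/4)"
    then have "\<forall>\<^sub>F n in sequentially. Z \<le> t n / real n powr (-5/4)"
      "\<forall>\<^sub>F n in sequentially. Z \<le> p n / real n powr (-5/4)" by blast+
    then show "\<forall>\<^sub>F n in sequentially. Z \<le> s n / real n powr (-5/4)"
      by eventually_elim (simp add: s_def min_def)
  qed
  then have sparse: "?G s \<longlonglongrightarrow> 1"
    by (intro sparse_regime) (auto simp: s_def t_def)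
  have "\<forall>\<^sub>F n in sequentially. t n \<le> 1/3 * real n powr (-3/4) * ln (real n) powr (1/4)"
    unfolding t_def by real_asymp
  with assms(1) have "\<forall>\<^sub>F n in sequentially. d n \<le> 1/3 * real n powr (-3/4) * ln (real n) powr (1/4)"
    by eventually_elim (simp add: d_def)
  then have dense: "?G d \<longlonglongrightarrow> 1"
    by (intro dense_regime) (auto simp: d_def t_def)
  have "(\<lambda>n. min (?G s n) (?G d n)) \<longlonglongrightarrow> min 1 1" "(\<lambda>n. max (?G s n) (?G d n)) \<longlonglongrightarrow> max 1 1"
    by (intro tendsto_min tendsto_max sparse dense)+
  \<comment> \<open>For each \<open>n\<close> the value \<open>p n\<close> is that of one of the two
    modified sequences, so its probability lies between their minimum and maximum.\<close>
  moreover have "?G p n = ?G s n \<or> ?G p n = ?G d n" for n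
    by (cases "p n \<le> t n") (simp_all add: s_def d_def)
  then have "min (?G s n) (?G d n) \<le> ?G p n \<and> ?G p n \<le> max (?G s n) (?G d n)" for n
    by (metis max.cobounded1 max.cobounded2 min.cobounded1 min.cobounded2)
  ultimately show ?thesis
    by (intro tendsto_sandwich[of "\<lambda>n. min (?G s n) (?G d n)" "?G p" _ "\<lambda>n. max (?G s n) (?G d n)"]) auto
qed

end
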